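(* Let $\mathcal{A}$ be a tame central essential arrangement in $V=\mathbb{C}^\ell$, let $0\ne\lambda\in\mathbb{C}^{\mathcal{A}}$ with $|\lambda|=\sum_{H}\lambda_H=0$, and let $p\geq0$. Assume that either $\mathcal{A}$ has rank at most $4$, or $\mathcal{A}$ is free, or $p\le2$. If $H^p(\Omega^\bullet_0(\mathcal{A}),\omega_\lambda)\ne0$, then the codimension of $\overline{\Sigma}_\lambda(\mathcal{A})$ in $V$ is at most $p$.
   Context: $\mathcal{A}$ is a finite set of distinct linear hyperplanes in $V=\mathbb{C}^\ell$ with common intersection $\{0\}$ (so its rank is $\ell$); $R=\operatorname{Sym}(V^* )=\mathbb{C}[x_1,\dots,x_\ell]$; each $H\in\mathcal{A}$ is the kernel of a linear form $\alpha_H$, and $f=\prod_{H}\alpha_H$. Set $$\Omega^p(\mathcal{A})=\Big\{\omega\in\tfrac1f\Omega^p_V\ \Big|\ \forall H\in\mathcal{A}:\ \tfrac{d\alpha_H}{\alpha_H}\wedge\omega\in\tfrac1f\Omega^{p+1}_V\Big\},$$ $\chi=\sum_ix_i\partial_i$ and $\Omega^p_0(\mathcal{A})=\ker(\iota_\chi:\Omega^p(\mathcal{A})\to\Omega^{p-1}(\mathcal{A}))$. $\mathcal{A}$ is tame if $\operatorname{pd}_R\Omega^p(\mathcal{A})\le p$ for $0\le p\le\ell$, and free if $\Omega^1(\mathcal{A})$ is a free $R$-module. For $\lambda\in\mathbb{C}^{\mathcal{A}}$ let $\omega_\lambda=\sum_{H}\lambda_H\frac{d\alpha_H}{\alpha_H}$.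 If $|\lambda|=0$ then $\omega_\lambda\in\Omega^1_0(\mathcal{A})$, and $(\Omega^\bullet_0(\mathcal{A}),\omega_\lambda)$ is the cochain complex with differential $\omega\mapsto\omega_\lambda\wedge\omega$. $D(\mathcal{A})=\{\delta\in\operatorname{Der}_{\mathbb{C}}(R,R)\mid\forall H:\delta(\alpha_H)\in\alpha_HR\}$. Let $C=\mathbb{C}[a_H:H\in\mathcal{A}]$, $S=R\otimes_{\mathbb{C}}C$, $\omega_{\mathbf a}=\sum_Ha_H\frac{d\alpha_H}{\alpha_H}$, and let $I(\mathcal{A})\subset S$ be the ideal generated by all $\langle\delta,\omega_{\mathbf a}\rangle=\sum_Ha_H\frac{\delta(\alpha_H)}{\alpha_H}$, $\delta\in D(\mathcal{A})$. Then $\overline{\Sigma}(\mathcal{A})=\operatorname{Spec}(S/I(\mathcal{A}))\subset V\times\mathbb{C}^{\mathcal{A}}$; it is known to be the closure of $\Sigma(\mathcal{A})=\{(x,\lambda)\in(V\setminus\bigcup_{H}H)\times\mathbb{C}^{\mathcal{A}}\mid\omega_\lambda(x)=0\}$. $\overline{\Sigma}_\lambda(\mathcal{A})\subset V$ is its specialization to $\mathbf a=\lambda$, i.e. the zero set of the ideal of $R$ generated by all $\sum_H\lambda_H\frac{\delta(\alpha_H)}{\alpha_H}$, $\delta\in D(\mathcal{A})$. *)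

theory Defs
  imports
    "HOL-Analysis.Analysis"
    "HOL-Library.Poly_Mapping"
    "HOL-Library.Extended_Nat"
    "HOL-Computational_Algebra.Fraction_Field"
begin

section \<open>The polynomial ring and its field of fractions\<close>

text \<open>
  \<open>V\<close> is \<open>complex ^ 'n\<close>. The linear order on the index type orders the coordinates for the signs in
  the exterior algebra; it is also what makes \<open>'n mpoly\<close> an instance of \<^class>\<open>idom\<close>.
\<close>

type_synonym 'n cvec = "(complex, 'n) vec"
type_synonym 'n mpoly = "('n \<Rightarrow>\<^sub>0 nat) \<Rightarrow>\<^sub>0 complex"
type_synonym 'n ratfun = "'n mpoly fract"

definition Const :: "complex \<Rightarrow> 'n mpoly" where
  "Const c = Poly_Mapping.single 0 c"

definition Var :: "'n \<Rightarrow> 'n mpoly" where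
  "Var i = Poly_Mapping.single (Poly_Mapping.single i 1) 1"

definition poly_eval :: "('n::finite) mpoly \<Rightarrow> 'n cvec \<Rightarrow> complex" where
  "poly_eval p x =
     (\<Sum>m\<in>Poly_Mapping.keys p. Poly_Mapping.lookup p m * (\<Prod>i\<in>UNIV. (x $ i) ^ Poly_Mapping.lookup m i))"

definition to_ratfun :: "('n::linorder) mpoly \<Rightarrow> 'n ratfun" where
  "to_ratfun p = Fract p 1"

text \<open>A linear form is given by its coefficient vector.\<close>

definition linear_form :: "'n cvec \<Rightarrow> ('n::finite) mpoly" where
  "linear_form a = (\<Sum>i\<in>UNIV. Const (a $ i) * Var i)"

text \<open>
  A ring as a module over itself: \<^term>\<open>module.span (*)\<close> is the ideal generated by a set. This is not
  an interpretation, because \<open>scale_scale\<close> would become a simp rule that undoes associativity.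
\<close>

lemma module_times: "module ((*) :: 'a::comm_ring_1 \<Rightarrow> 'a \<Rightarrow> 'a)"
  by unfold_locales (simp_all add: algebra_simps)


section \<open>Projective dimension\<close>

definition free_scale :: "'a::comm_ring_1 \<Rightarrow> (nat \<Rightarrow>\<^sub>0 'a) \<Rightarrow> (nat \<Rightarrow>\<^sub>0 'a)" where
  "free_scale r v = Poly_Mapping.map ((*) r) v"

lemma lookup_free_scale: "Poly_Mapping.lookup (free_scale r v) k = r * Poly_Mapping.lookup v k"
  by (simp add: free_scale_def map.rep_eq when_def)

interpretation free: module "free_scale :: 'a::comm_ring_1 \<Rightarrow> (nat \<Rightarrow>\<^sub>0 'a) \<Rightarrow> (nat \<Rightarrow>\<^sub>0 'a)"
  by unfold_locales (auto intro!: poly_mapping_eqI simp: lookup_free_scale lookup_add algebra_simps)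

text \<open>Direct summands of the free module of countable rank.\<close>

definition projective :: "(nat \<Rightarrow>\<^sub>0 'a::comm_ring_1) set \<Rightarrow> bool" where
  "projective P \<longleftrightarrow> free.subspace P \<and>
     (\<exists>Q. free.subspace Q \<and> P \<inter> Q = {0} \<and> (\<forall>v. \<exists>p\<in>P. \<exists>q\<in>Q. v = p + q))"

definition module_hom_between ::
  "('a \<Rightarrow> 'b \<Rightarrow> 'b) \<Rightarrow> ('a \<Rightarrow> 'c \<Rightarrow> 'c) \<Rightarrow> 'b::ab_group_add set \<Rightarrow> 'c::ab_group_add set \<Rightarrow> ('b \<Rightarrow> 'c) \<Rightarrow> bool"
where
  "module_hom_between s1 s2 M N h \<longleftrightarrow> h ` M \<subseteq> N \<and>
     (\<forall>x\<in>M. \<forall>y\<in>M. h (x + y) = h x + h y) \<and> (\<forall>r. \<forall>x\<in>M. h (s1 r x) = s2 r (h x))"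

text \<open>
  An exact sequence \<open>0 \<rightarrow> P n \<rightarrow> \<dots> \<rightarrow> P 0 \<rightarrow> M \<rightarrow> 0\<close> with augmentation \<open>e\<close> and differentials
  \<open>d i : P (i+1) \<rightarrow> P i\<close>.
\<close>

definition has_projective_resolution ::
  "('a::comm_ring_1 \<Rightarrow> 'b \<Rightarrow> 'b) \<Rightarrow> 'b::ab_group_add set \<Rightarrow> nat \<Rightarrow> bool" where
  "has_projective_resolution s M n \<longleftrightarrow>
     (\<exists>(P :: nat \<Rightarrow> (nat \<Rightarrow>\<^sub>0 'a) set) d e.
        (\<forall>i. projective (P i)) \<and> (\<forall>i>n. P i = {0}) \<and>
        module_hom_between free_scale s (P 0) M e \<and>
        (\<forall>i. module_hom_between free_scale free_scale (P (Suc i)) (P i) (d i)) \<and>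
        e ` P 0 = M \<and>
        {x \<in> P 0. e x = 0} = d 0 ` P (Suc 0) \<and>
        (\<forall>i. {x \<in> P (Suc i). d i x = 0} = d (Suc i) ` P (Suc (Suc i))))"

text \<open>
  The modules of a resolution have to live in one fixed type, so only countably generated
  projectives occur. For a finitely generated module over a Noetherian ring, as are the modules of
  logarithmic forms below, this gives the usual projective dimension, because there the minimal
  length is already attained by finitely generated projectives. It is \<open>\<infinity>\<close> if there is no finite
  resolution.
\<close>

definition projective_dimension ::
  "('a::comm_ring_1 \<Rightarrow> 'b \<Rightarrow> 'b) \<Rightarrow> 'b::ab_group_add set \<Rightarrow> enat" where
  "projective_dimension s M = (INF n\<in>{n. has_projective_resolution s M n}. enat n)"


section \<open>Rational differential forms\<close>

text \<open>
  The component of \<open>\<omega>\<close> at \<open>{i\<^sub>1 < \<dots> < i\<^sub>p}\<close> is its coefficient at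
  \<open>dx\<^sub>i\<^sub>1 \<and> \<dots> \<and> dx\<^sub>i\<^sub>p\<close>; forms of all degrees share the type.
\<close>

type_synonym 'n form = "'n ratfun ^ 'n set"

definition form_scale :: "'n mpoly \<Rightarrow> ('n::{finite,linorder}) form \<Rightarrow> 'n form" where
  "form_scale p \<omega> = to_ratfun p *s \<omega>"

lemma to_ratfun_add: "to_ratfun (p + q) = to_ratfun p + to_ratfun q"
  and to_ratfun_mult: "to_ratfun (p * q) = to_ratfun p * to_ratfun q"
  and to_ratfun_1: "to_ratfun 1 = 1"
  by (simp_all add: to_ratfun_def One_fract_def)

interpretation form: module "form_scale :: ('n::{finite,linorder}) mpoly \<Rightarrow> 'n form \<Rightarrow> 'n form"
  by unfold_locales
     (simp_all add: form_scale_def vec_eq_iff to_ratfun_add to_ratfun_mult to_ratfun_1 algebra_simps)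

definition wedge :: "('n::{finite,linorder}) form \<Rightarrow> 'n form \<Rightarrow> 'n form"  (infixl \<open>\<and>\<^sub>f\<close> 70) where
  "\<omega> \<and>\<^sub>f \<eta> = (\<chi> K. \<Sum>I\<in>Pow K.
      (-1) ^ card {(i, j). i \<in> I \<and> j \<in> K - I \<and> j < i} * (\<omega> $ I) * (\<eta> $ (K - I)))"

definition contraction :: "('n ratfun, 'n) vec \<Rightarrow> ('n::{finite,linorder}) form \<Rightarrow> 'n form" where
  "contraction v \<omega> = (\<chi> J. \<Sum>i\<in>- J. (-1) ^ card {j \<in> J. j < i} * (v $ i) * (\<omega> $ insert i J))"

definition euler_field :: "('n ratfun, 'n::{finite,linorder}) vec" where
  "euler_field = (\<chi> i. to_ratfun (Var i))"

definition d_linear :: "'n cvec \<Rightarrow> ('n::{finite,linorder}) form" where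
  "d_linear a = (\<Sum>i\<in>UNIV. to_ratfun (Const (a $ i)) *s axis {i} 1)"

definition dlog_linear :: "'n cvec \<Rightarrow> ('n::{finite,linorder}) form" where
  "dlog_linear a = inverse (to_ratfun (linear_form a)) *s d_linear a"

definition regular_forms :: "nat \<Rightarrow> ('n::{finite,linorder}) form set" where
  "regular_forms p =
     {\<omega>. \<forall>I. (card I = p \<longrightarrow> \<omega> $ I \<in> to_ratfun ` UNIV) \<and> (card I \<noteq> p \<longrightarrow> \<omega> $ I = 0)}"


section \<open>Arrangements and logarithmic forms\<close>

definition hyperplane_arrangement ::
  "('n::finite) cvec set set \<Rightarrow> ('n cvec set \<Rightarrow> 'n cvec) \<Rightarrow> bool" where
  "hyperplane_arrangement \<A> \<alpha> \<longleftrightarrow> finite \<A> \<and>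
     (\<forall>H\<in>\<A>. \<alpha> H \<noteq> 0 \<and> H = {x. (\<Sum>i\<in>UNIV. \<alpha> H $ i * x $ i) = 0})"

definition essential :: "('n::finite) cvec set set \<Rightarrow> bool" where
  "essential \<A> \<longleftrightarrow> \<Inter>\<A> = {0}"

definition arrangement_rank :: "('n::finite) cvec set set \<Rightarrow> nat" where
  "arrangement_rank \<A> = CARD('n) - vec.dim (\<Inter>\<A>)"

definition defining_poly ::
  "'n cvec set set \<Rightarrow> ('n cvec set \<Rightarrow> 'n cvec) \<Rightarrow> ('n::finite) mpoly" where
  "defining_poly \<A> \<alpha> = (\<Prod>H\<in>\<A>. linear_form (\<alpha> H))"

definition polar_forms ::
  "'n cvec set set \<Rightarrow> ('n cvec set \<Rightarrow> 'n cvec) \<Rightarrow> nat \<Rightarrow>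
   ('n::{finite,linorder}) form set" where
  "polar_forms \<A> \<alpha> p = (\<lambda>\<eta>. inverse (to_ratfun (defining_poly \<A> \<alpha>)) *s \<eta>) ` regular_forms p"

definition log_forms ::
  "'n cvec set set \<Rightarrow> ('n cvec set \<Rightarrow> 'n cvec) \<Rightarrow> nat \<Rightarrow>
   ('n::{finite,linorder}) form set" where
  "log_forms \<A> \<alpha> p =
     {\<omega> \<in> polar_forms \<A> \<alpha> p. \<forall>H\<in>\<A>. dlog_linear (\<alpha> H) \<and>\<^sub>f \<omega> \<in> polar_forms \<A> \<alpha> (Suc p)}"

definition rel_log_forms ::
  "'n cvec set set \<Rightarrow> ('n cvec set \<Rightarrow> 'n cvec) \<Rightarrow> nat \<Rightarrow>
   ('n::{finite,linorder}) form set" where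
  "rel_log_forms \<A> \<alpha> p = {\<omega> \<in> log_forms \<A> \<alpha> p. contraction euler_field \<omega> = 0}"

definition tame ::
  "('n::{finite,linorder}) cvec set set \<Rightarrow> ('n cvec set \<Rightarrow> 'n cvec) \<Rightarrow> bool" where
  "tame \<A> \<alpha> \<longleftrightarrow> (\<forall>p\<le>CARD('n). projective_dimension form_scale (log_forms \<A> \<alpha> p) \<le> enat p)"

definition free_arrangement ::
  "('n::{finite,linorder}) cvec set set \<Rightarrow> ('n cvec set \<Rightarrow> 'n cvec) \<Rightarrow> bool" where
  "free_arrangement \<A> \<alpha> \<longleftrightarrow> (\<exists>B. form.independent B \<and> form.span B = log_forms \<A> \<alpha> 1)"

definition weight_form ::
  "'n cvec set set \<Rightarrow> ('n cvec set \<Rightarrow> 'n cvec) \<Rightarrow> ('n cvec set \<Rightarrow> complex) \<Rightarrow>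
   ('n::{finite,linorder}) form" where
  "weight_form \<A> \<alpha> l = (\<Sum>H\<in>\<A>. to_ratfun (Const (l H)) *s dlog_linear (\<alpha> H))"


section \<open>Cohomology of \<open>(\<Omega>\<^sub>0, \<omega>\<^sub>\<lambda>)\<close>\<close>

definition cocycles ::
  "'n cvec set set \<Rightarrow> ('n cvec set \<Rightarrow> 'n cvec) \<Rightarrow> ('n cvec set \<Rightarrow> complex) \<Rightarrow>
   nat \<Rightarrow> ('n::{finite,linorder}) form set" where
  "cocycles \<A> \<alpha> l p = {\<omega> \<in> rel_log_forms \<A> \<alpha> p. weight_form \<A> \<alpha> l \<and>\<^sub>f \<omega> = 0}"

fun coboundaries ::
  "'n cvec set set \<Rightarrow> ('n cvec set \<Rightarrow> 'n cvec) \<Rightarrow> ('n cvec set \<Rightarrow> complex) \<Rightarrow>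
   nat \<Rightarrow> ('n::{finite,linorder}) form set" where
  "coboundaries \<A> \<alpha> l 0 = {0}"
| "coboundaries \<A> \<alpha> l (Suc p) = (\<lambda>\<omega>. weight_form \<A> \<alpha> l \<and>\<^sub>f \<omega>) ` rel_log_forms \<A> \<alpha> p"

text \<open>The quotient as a set of cosets; its zero element is the coset \<^const>\<open>coboundaries\<close>.\<close>

definition cohomology ::
  "'n cvec set set \<Rightarrow> ('n cvec set \<Rightarrow> 'n cvec) \<Rightarrow> ('n cvec set \<Rightarrow> complex) \<Rightarrow>
   nat \<Rightarrow> ('n::{finite,linorder}) form set set" where
  "cohomology \<A> \<alpha> l p = (\<lambda>z. (+) z ` coboundaries \<A> \<alpha> l p) ` cocycles \<A> \<alpha> l p"


section \<open>Logarithmic derivations and the critical set\<close>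

definition derivation :: "('n mpoly \<Rightarrow> 'n mpoly) \<Rightarrow> bool" where
  "derivation \<delta> \<longleftrightarrow> (\<forall>p q. \<delta> (p + q) = \<delta> p + \<delta> q) \<and> (\<forall>c p. \<delta> (Const c * p) = Const c * \<delta> p) \<and>
     (\<forall>p q. \<delta> (p * q) = \<delta> p * q + p * \<delta> q)"

definition log_derivations ::
  "'n cvec set set \<Rightarrow> ('n cvec set \<Rightarrow> 'n cvec) \<Rightarrow> (('n::finite) mpoly \<Rightarrow> 'n mpoly) set"
where
  "log_derivations \<A> \<alpha> =
     {\<delta>. derivation \<delta> \<and> (\<forall>H\<in>\<A>. linear_form (\<alpha> H) dvd \<delta> (linear_form (\<alpha> H)))}"

definition critical_ideal ::
  "'n cvec set set \<Rightarrow> ('n cvec set \<Rightarrow> 'n cvec) \<Rightarrow> ('n cvec set \<Rightarrow> complex) \<Rightarrow>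
   ('n::{finite,linorder}) mpoly set" where
  "critical_ideal \<A> \<alpha> l = module.span (*) {g. \<exists>\<delta>\<in>log_derivations \<A> \<alpha>.
     to_ratfun g = (\<Sum>H\<in>\<A>. to_ratfun (Const (l H)) *
                             (to_ratfun (\<delta> (linear_form (\<alpha> H))) / to_ratfun (linear_form (\<alpha> H))))}"

definition zero_locus :: "('n::finite) mpoly set \<Rightarrow> 'n cvec set" where
  "zero_locus F = {x. \<forall>g\<in>F. poly_eval g x = 0}"

definition critical_set ::
  "'n cvec set set \<Rightarrow> ('n cvec set \<Rightarrow> 'n cvec) \<Rightarrow> ('n cvec set \<Rightarrow> complex) \<Rightarrow>
   ('n::{finite,linorder}) cvec set" where
  "critical_set \<A> \<alpha> l = zero_locus (critical_ideal \<A> \<alpha> l)"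


section \<open>Codimension in the Zariski topology\<close>

definition zariski_closed :: "('n::finite) cvec set \<Rightarrow> bool" where
  "zariski_closed Z \<longleftrightarrow> (\<exists>F. Z = zero_locus F)"

definition irreducible_closed :: "('n::finite) cvec set \<Rightarrow> bool" where
  "irreducible_closed Z \<longleftrightarrow> zariski_closed Z \<and> Z \<noteq> {} \<and>
     (\<forall>Y W. zariski_closed Y \<longrightarrow> zariski_closed W \<longrightarrow> Z = Y \<union> W \<longrightarrow> Z = Y \<or> Z = W)"

definition codim_irreducible :: "('n::finite) cvec set \<Rightarrow> enat" where
  "codim_irreducible Z = (SUP n\<in>{n. \<exists>W. W 0 = Z \<and> (\<forall>i\<le>n. irreducible_closed (W i)) \<and>
                                        (\<forall>i<n. W i \<subset> W (Suc i))}. enat n)"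

text \<open>The empty set has codimension \<open>\<infinity>\<close>.\<close>

definition codimension :: "('n::finite) cvec set \<Rightarrow> enat" where
  "codimension Z = (INF Y\<in>{Y. irreducible_closed Y \<and> Y \<subseteq> Z}. codim_irreducible Y)"

end

theory Submission
  imports Defs "HOL-Computational_Algebra.Fundamental_Theorem_Algebra"
begin

text \<open>
  Suppose that the critical set has codimension at least \<open>p + 1\<close>. Then its ideal \<open>I\<close> contains a regular
  sequence \<open>a\<close> of length \<open>p + 1\<close>: after a linear change of coordinates, Noether normalisation gives
  polynomials in \<open>I\<close> that are successively monic in separate variables, and these form a regular
  sequence; if there were only \<open>k \<le> p\<close> of them, the remaining variables would be algebraically
  independent on some irreducible component, whose codimension is then at most \<open>k\<close>.

  Contraction with a logarithmic derivation \<open>\<delta>\<close> is a homotopy for multiplication by \<open>\<langle>\<delta>, \<omega>\<^sub>\<lambda>\<rangle>\<close>, so \<open>I\<close>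
  annihilates the cohomology. Tameness bounds the projective dimension of \<open>\<Omega>\<^sup>q\<close> by \<open>q\<close>, hence the Koszul
  cohomology of \<open>a\<close> on \<open>\<Omega>\<^sup>q\<close>, and on its direct summand \<open>\<Omega>\<^sub>0\<^sup>q\<close>, vanishes below degree \<open>p + 1 - q\<close>. As in
  the acyclicity lemma of Peskine and Szpiro, the complex is then exact in degrees \<open>\<le> p\<close>.
\<close>


section \<open>Exterior and interior multiplication by a vector\<close>

text \<open>Depth enters only as vanishing of Koszul cohomology, tested on explicit cochains. Its
  comparison with projective dimension then comes down to three facts: vanishing for regular
  sequences on free modules, inheritance by direct summands, and the loss of one degree in passing
  from a kernel to an image. The same formulas for exterior and interior multiplication serve the
  Koszul complex and the differential forms.

  The count is tight: in the last degree p the relative forms are only known to have vanishing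
  Koszul cohomology in degree 0 and the coboundaries in degrees 0 and 1, which is just what the
  annihilation argument consumes. This is why p + 1 elements are needed.

  Codimension is defined by chains of irreducible closed sets, so a bound from above has to control
  every chain that starts at a given set. Each strict inclusion is made to contribute one more
  algebraically independent polynomial, and counting monomials limits their number by the dimension
  of V. The Nullstellensatz rests on the complex numbers being uncountable.\<close>

definition sgn_at :: "'i::linorder \<Rightarrow> 'i set \<Rightarrow> 'a::comm_ring_1" where
  "sgn_at t T = (-1) ^ card {j \<in> T. j < t}"

lemma sgn_at_insert:
  assumes "finite J" "u \<notin> J"
  shows "(sgn_at t (insert u J) :: 'a::comm_ring_1) = (if u < t then - sgn_at t J else sgn_at t J)"
proof (cases "u < t")
  case True
  have "{j \<in> insert u J. j < t} = insert u {j \<in> J. j < t}" using True by auto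
  then show ?thesis using assms True by (simp add: sgn_at_def)
next
  case False
  have "{j \<in> insert u J. j < t} = {j \<in> J. j < t}" using False by auto
  then show ?thesis using False by (simp add: sgn_at_def)
qed

text \<open>Only elements strictly below \<open>t\<close> are counted, so it is irrelevant whether
  \<open>t\<close> itself belongs to the set. One sign therefore serves the removal of
  \<open>t\<close> in \<open>ext_mult\<close> and its insertion in \<open>int_mult\<close>.\<close>

lemma sgn_at_insert_same [simp]: "sgn_at t (insert t J) = sgn_at t J"
proof -
  have "{j \<in> insert t J. j < t} = {j \<in> J. j < t}" by auto
  then show ?thesis by (simp add: sgn_at_def)
qed

lemma sgn_at_remove_same [simp]: "sgn_at t (J - {t}) = sgn_at t J"
proof -
  have "{j \<in> J - {t}. j < t} = {j \<in> J. j < t}" by auto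
  then show ?thesis by (simp add: sgn_at_def)
qed

lemma sgn_at_square [simp]: "sgn_at t J * sgn_at t J = (1 :: 'a::comm_ring_1)"
  by (simp add: sgn_at_def flip: power_mult_distrib)

text \<open>Exactly one of \<open>t\<close> and \<open>u\<close> is the smaller one, so the presence
  of the other index changes exactly one of the signs. The next two lemmas are the versions for two
  insertions and for one insertion and one removal.\<close>

lemma sgn_at_remove_swap:
  assumes "finite T" "t \<in> T" "u \<in> T" "t \<noteq> u"
  shows "sgn_at t T * sgn_at u (T - {t}) = - (sgn_at u T * sgn_at t (T - {u}) :: 'a::comm_ring_1)"
proof -
  define J where "J = T - {t, u}"
  have J: "finite J" "t \<notin> J" "u \<notin> J" and
    T: "T = insert t (insert u J)" "T - {t} = insert u J" "T - {u} = insert t J"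
    using assms by (auto simp: J_def)
  have T': "T = insert u (insert t J)" using T by auto
  have "sgn_at t T = (sgn_at t (insert u J) :: 'a)" "sgn_at u T = (sgn_at u (insert t J) :: 'a)"
    using T(1) T' by (metis sgn_at_insert_same)+
  then show ?thesis unfolding T(2,3) using J \<open>t \<noteq> u\<close>
    by (auto simp: sgn_at_insert mult.commute)
qed

lemma sgn_at_insert_swap:
  assumes "finite J" "t \<notin> J" "u \<notin> J" "t \<noteq> u"
  shows "sgn_at t J * sgn_at u (insert t J) = - (sgn_at u J * sgn_at t (insert u J) :: 'a::comm_ring_1)"
  using assms by (auto simp: sgn_at_insert mult.commute)

lemma sgn_at_insert_remove_swap:
  assumes "finite J" "t \<in> J" "i \<notin> J"
  shows "sgn_at i J * sgn_at t (insert i J) = - (sgn_at t J * sgn_at i (J - {t}) :: 'a::comm_ring_1)"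
proof -
  define L where "L = J - {t}"
  have L: "finite L" "t \<notin> L" "i \<notin> L" "J = insert t L" "i \<noteq> t" using assms by (auto simp: L_def)
  have "sgn_at t (insert i (insert t L)) = (sgn_at t (insert i L) :: 'a)"
    by (metis insert_commute sgn_at_insert_same)
  then show ?thesis using L by (auto simp: sgn_at_insert mult.commute)
qed

text \<open>The action \<open>s\<close> and the index type are parameters. With a module action and
  indices in \<open>nat\<close> this is the Koszul differential; with multiplication of rational
  functions and the coordinates as indices it is wedging with a 1-form.\<close>

definition ext_mult :: "('a::comm_ring_1 \<Rightarrow> 'b \<Rightarrow> 'b) \<Rightarrow> ('i::linorder \<Rightarrow> 'a) \<Rightarrow> ('i set \<Rightarrow> 'b::ab_group_add) \<Rightarrow> 'i set \<Rightarrow> 'b"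
  where "ext_mult s a c T = (\<Sum>t\<in>T. s (sgn_at t T * a t) (c (T - {t})))"

definition int_mult :: "('a::comm_ring_1 \<Rightarrow> 'b \<Rightarrow> 'b) \<Rightarrow> ('i::{finite,linorder} \<Rightarrow> 'a) \<Rightarrow> ('i set \<Rightarrow> 'b::ab_group_add) \<Rightarrow> 'i set \<Rightarrow> 'b"
  where "int_mult s a c T = (\<Sum>t\<in>-T. s (sgn_at t T * a t) (c (insert t T)))"

text \<open>The vanishing diagonal is a separate assumption, because antisymmetry alone yields only
  \<open>F t t + F t t = 0\<close>, and the group may have 2-torsion.\<close>

lemma sum_antisymmetric:
  fixes F :: "'i \<Rightarrow> 'i \<Rightarrow> 'b::ab_group_add"
  assumes "finite T" "\<And>t. F t t = 0" "\<And>t u. t \<in> T \<Longrightarrow> u \<in> T \<Longrightarrow> F t u = - F u t"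
  shows "(\<Sum>t\<in>T. \<Sum>u\<in>T. F t u) = 0"
  using assms(1,3)
proof (induction T)
  case (insert x T)
  have "(\<Sum>t\<in>T. F t x) = (\<Sum>u\<in>T. - F x u)"
    using insert.prems by (intro sum.cong) blast+
  moreover have "(\<Sum>t\<in>T. \<Sum>u\<in>T. F t u) = 0"
    using insert.prems by (intro insert.IH) blast
  ultimately show ?case using insert.hyps by (simp add: sum.distrib assms(2) sum_negf)
qed simp

lemma mult_swap_minus:
  fixes x y z w :: "'a::comm_ring_1"
  assumes "x * y = - (z * w)"
  shows "x * a * (y * b) = - (z * b * (w * a))"
proof -
  have "x * a * (y * b) = x * y * (a * b)" by (simp only: ac_simps)
  then show ?thesis unfolding assms by (simp add: ac_simps)
qed

context module
begin

lemma ext_mult_ext_mult: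
  assumes "finite T"
  shows "ext_mult scale a (ext_mult scale b c) T = (\<Sum>t\<in>T. \<Sum>u\<in>T. if t = u then 0 else
    scale (sgn_at t T * a t * (sgn_at u (T - {t}) * b u)) (c (T - {t} - {u})))" (is "_ = (\<Sum>t\<in>T. \<Sum>u\<in>T. ?F t u)")
proof -
  have "scale (sgn_at t T * a t) (ext_mult scale b c (T - {t})) = (\<Sum>u\<in>T. ?F t u)" if "t \<in> T" for t
  proof -
    have "(\<Sum>u\<in>T. ?F t u) = (\<Sum>u\<in>T - {t}. ?F t u)"
      using assms that by (intro sum.mono_neutral_right) auto
    also have "\<dots> = scale (sgn_at t T * a t) (ext_mult scale b c (T - {t}))"
      unfolding ext_mult_def scale_sum_right by (intro sum.cong) auto
    finally show ?thesis by simp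
  qed
  then show ?thesis unfolding ext_mult_def[of scale a] by (intro sum.cong) auto
qed

lemma int_mult_int_mult:
  "int_mult scale a (int_mult scale b c) T = (\<Sum>t\<in>-T. \<Sum>u\<in>-T. if t = u then 0 else
    scale (sgn_at t T * a t * (sgn_at u (insert t T) * b u)) (c (insert u (insert t T))))" (is "_ = (\<Sum>t\<in>-T. \<Sum>u\<in>-T. ?F t u)")
proof -
  have "scale (sgn_at t T * a t) (int_mult scale b c (insert t T)) = (\<Sum>u\<in>-T. ?F t u)" if "t \<in> -T" for t
  proof -
    have "(\<Sum>u\<in>-T. ?F t u) = (\<Sum>u\<in>- insert t T. ?F t u)"
      using that by (intro sum.mono_neutral_right) auto
    also have "\<dots> = scale (sgn_at t T * a t) (int_mult scale b c (insert t T))"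
      unfolding int_mult_def scale_sum_right by (intro sum.cong) auto
    finally show ?thesis by simp
  qed
  then show ?thesis unfolding int_mult_def[of scale a] by (intro sum.cong) auto
qed

lemma ext_mult_anticommute:
  assumes "finite T"
  shows "ext_mult scale a (ext_mult scale b c) T + ext_mult scale b (ext_mult scale a c) T = 0"
proof -
  define F where "F = (\<lambda>a b t u. if t = u then 0 else
    scale (sgn_at t T * a t * (sgn_at u (T - {t}) * b u)) (c (T - {t} - {u})))"
  have F: "F a b t u = - F b a u t" if "t \<in> T" "u \<in> T" for t u a b
  proof (cases "t = u")
    case False
    then show ?thesis
      using mult_swap_minus[OF sgn_at_remove_swap[OF assms that False, where 'a='a], of "a t" "b u"]
      by (simp add: F_def Diff_insert2[symmetric] insert_commute[of t u])
  qed (simp add: F_def)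
  \<comment> \<open>Exchanging \<open>t\<close> and \<open>u\<close> turns the terms of one double
    sum into those of the other, so it is the sum of both that is antisymmetric.\<close>
  have "(\<Sum>t\<in>T. \<Sum>u\<in>T. F a b t u + F b a t u) = 0"
  proof (rule sum_antisymmetric)
    fix t u assume tu: "t \<in> T" "u \<in> T"
    show "F a b t u + F b a t u = - (F a b u t + F b a u t)"
      unfolding F[OF tu, of a b] F[OF tu, of b a] by simp
  qed (auto simp: F_def assms)
  then show ?thesis by (simp add: ext_mult_ext_mult assms F_def sum.distrib)
qed

text \<open>Setting \<open>b = a\<close> in \<open>ext_mult_anticommute\<close> gives only twice the
  claim, which is too weak over an arbitrary ring; here the double sum itself is
  antisymmetric.\<close>

lemma ext_mult_ext_mult_self:
  assumes "finite T"
  shows "ext_mult scale a (ext_mult scale a c) T = 0"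
  unfolding ext_mult_ext_mult[OF assms]
proof (rule sum_antisymmetric)
  fix t u assume "t \<in> T" "u \<in> T"
  then show "(if t = u then 0 else scale (sgn_at t T * a t * (sgn_at u (T - {t}) * a u)) (c (T - {t} - {u}))) =
    - (if u = t then 0 else scale (sgn_at u T * a u * (sgn_at t (T - {u}) * a t)) (c (T - {u} - {t})))"
    using mult_swap_minus[OF sgn_at_remove_swap[OF assms, where 'a='a], of t u "a t" "a u"]
    by (simp add: Diff_insert2[symmetric] insert_commute[of t u])
qed (auto simp: assms)

lemma int_mult_anticommute:
  "int_mult scale a (int_mult scale b c) T + int_mult scale b (int_mult scale a c) T = 0"
proof -
  define F where "F = (\<lambda>a b t u. if t = u then 0 else
    scale (sgn_at t T * a t * (sgn_at u (insert t T) * b u)) (c (insert u (insert t T))))"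
  have F: "F a b t u = - F b a u t" if "t \<in> -T" "u \<in> -T" for t u a b
    using that mult_swap_minus[OF sgn_at_insert_swap[of T t u, where 'a='a], of "a t" "b u"]
    by (simp add: F_def insert_commute[of t u])
  have "(\<Sum>t\<in>-T. \<Sum>u\<in>-T. F a b t u + F b a t u) = 0"
  proof (rule sum_antisymmetric)
    fix t u assume tu: "t \<in> -T" "u \<in> -T"
    show "F a b t u + F b a t u = - (F a b u t + F b a u t)"
      unfolding F[OF tu, of a b] F[OF tu, of b a] by simp
  qed (auto simp: F_def)
  then show ?thesis by (simp add: int_mult_int_mult F_def sum.distrib)
qed

text \<open>Cartan's formula. Where the same index is inserted and removed, the first product
  contributes the indices outside \<open>J\<close> and the second those inside, and together they
  give the pairing. The mixed terms, with \<open>i\<close> inserted and \<open>t\<close> removed,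
  occur in both products with opposite signs.\<close>

lemma int_mult_ext_mult:
  "int_mult scale u (ext_mult scale v c) J + ext_mult scale v (int_mult scale u c) J =
     scale (\<Sum>i\<in>UNIV. u i * v i) (c J)"
proof -
  define G where "G = (\<lambda>t i. scale (sgn_at i J * u i * (sgn_at t (insert i J) * v t)) (c (insert i J - {t})))"
  have 1: "scale (sgn_at i J * u i) (ext_mult scale v c (insert i J)) = scale (u i * v i) (c J) + (\<Sum>t\<in>J. G t i)"
    if "i \<in> -J" for i
  proof -
    have "sgn_at i J * u i * (sgn_at i J * v i) = sgn_at i J * sgn_at i J * (u i * v i)"
      by (simp only: ac_simps)
    then show ?thesis using that
      by (simp add: ext_mult_def scale_sum_right scale_right_distrib G_def)
  qed
  have 2: "scale (sgn_at t J * v t) (int_mult scale u c (J - {t})) = scale (u t * v t) (c J) - (\<Sum>i\<in>-J. G t i)"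
    if "t \<in> J" for t
  proof -
    have c: "- (J - {t}) = insert t (-J)" "insert t (J - {t}) = J" "insert t J = J" using that by auto
    have "scale (sgn_at t J * v t) (scale (sgn_at i (J - {t}) * u i) (c (insert i (J - {t})))) = - G t i"
      if "i \<in> -J" for i
    proof -
      have e: "insert i (J - {t}) = insert i J - {t}" using \<open>t \<in> J\<close> that by auto
      have "sgn_at t J * v t * (sgn_at i (J - {t}) * u i) = (sgn_at t J * sgn_at i (J - {t})) * (u i * v t)"
        by (simp only: ac_simps)
      also have "\<dots> = - (sgn_at i J * sgn_at t (insert i J)) * (u i * v t)"
        using sgn_at_insert_remove_swap[of J t i, where 'a='a] \<open>t \<in> J\<close> that by simp
      also have "\<dots> = - (sgn_at i J * u i * (sgn_at t (insert i J) * v t))"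
        by (simp add: ac_simps)
      finally show ?thesis by (simp add: G_def e)
    qed
    then have "(\<Sum>i\<in>-J. scale (sgn_at t J * v t) (scale (sgn_at i (J - {t}) * u i) (c (insert i (J - {t}))))) = (\<Sum>i\<in>-J. - G t i)"
      by (rule sum.cong[OF refl])
    moreover have "sgn_at t J * v t * (sgn_at t J * u t) = sgn_at t J * sgn_at t J * (u t * v t)"
      by (simp only: ac_simps)
    ultimately show ?thesis using that
      by (simp add: int_mult_def c scale_right_distrib scale_sum_right sum_negf del: scale_scale)
         (simp add: scale_scale)
  qed
  have "int_mult scale u (ext_mult scale v c) J = (\<Sum>i\<in>-J. scale (u i * v i) (c J)) + (\<Sum>i\<in>-J. \<Sum>t\<in>J. G t i)"
    unfolding int_mult_def[of scale u "ext_mult scale v c"]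
    using 1 by (simp add: sum.distrib)
  moreover have "ext_mult scale v (int_mult scale u c) J = (\<Sum>i\<in>J. scale (u i * v i) (c J)) - (\<Sum>t\<in>J. \<Sum>i\<in>-J. G t i)"
    unfolding ext_mult_def[of scale v "int_mult scale u c"]
    using 2 by (simp add: sum_subtractf)
  moreover have "(\<Sum>i\<in>-J. \<Sum>t\<in>J. G t i) = (\<Sum>t\<in>J. \<Sum>i\<in>-J. G t i)" by (rule sum.swap)
  moreover have "(\<Sum>i\<in>-J. scale (u i * v i) (c J)) + (\<Sum>i\<in>J. scale (u i * v i) (c J)) = (\<Sum>i\<in>UNIV. scale (u i * v i) (c J))"
    using sum.union_disjoint[of "-J" J "\<lambda>i. scale (u i * v i) (c J)"] by (simp add: Compl_partition2)
  ultimately show ?thesis by (simp add: scale_sum_left)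
qed

end


section \<open>Koszul cohomology\<close>

text \<open>
  Exactness in degree \<open>i\<close> of the Koszul complex on \<open>a 0, \<dots>, a (k - 1)\<close> with coefficients in \<open>M\<close>;
  only the values of cochains on \<open>i\<close>-element subsets of \<open>{..<k}\<close> matter.
\<close>

definition koszul_exact :: "('a::comm_ring_1 \<Rightarrow> 'b \<Rightarrow> 'b) \<Rightarrow> (nat \<Rightarrow> 'a) \<Rightarrow> nat \<Rightarrow> 'b::ab_group_add set \<Rightarrow> nat \<Rightarrow> bool"
  where "koszul_exact s a k M i \<longleftrightarrow>
    (\<forall>c. (\<forall>T\<subseteq>{..<k}. card T = i \<longrightarrow> c T \<in> M) \<longrightarrow> (\<forall>T\<subseteq>{..<k}. card T = Suc i \<longrightarrow> ext_mult s a c T = 0) \<longrightarrow>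
      (\<exists>e. (\<forall>T\<subseteq>{..<k}. Suc (card T) = i \<longrightarrow> e T \<in> M) \<and>
           (\<forall>T\<subseteq>{..<k}. card T = i \<longrightarrow> c T = ext_mult s a e T)))"

text \<open>For a finitely generated \<open>M\<close> over a Noetherian ring, this says that the
  grade of \<open>M\<close> with respect to the ideal of the sequence is at least
  \<open>m\<close>.\<close>

definition koszul_grade :: "('a::comm_ring_1 \<Rightarrow> 'b \<Rightarrow> 'b) \<Rightarrow> (nat \<Rightarrow> 'a) \<Rightarrow> nat \<Rightarrow> 'b::ab_group_add set \<Rightarrow> nat \<Rightarrow> bool"
  where "koszul_grade s a k M m \<longleftrightarrow> (\<forall>i<m. koszul_exact s a k M i)"

definition seq_multiples :: "('a::comm_ring_1 \<Rightarrow> 'b \<Rightarrow> 'b) \<Rightarrow> (nat \<Rightarrow> 'a) \<Rightarrow> nat \<Rightarrow> 'b::ab_group_add set \<Rightarrow> 'b set"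
  where "seq_multiples s a j M = {\<Sum>i<j. s (a i) (f i) |f. \<forall>i<j. f i \<in> M}"

text \<open>The quotient by the sequence may be zero, so the constant sequence 1 is regular; this
  accommodates the unit ideal.\<close>

definition regular_seq :: "('a::comm_ring_1 \<Rightarrow> 'b \<Rightarrow> 'b) \<Rightarrow> (nat \<Rightarrow> 'a) \<Rightarrow> nat \<Rightarrow> 'b::ab_group_add set \<Rightarrow> bool"
  where "regular_seq s a k M \<longleftrightarrow>
    (\<forall>j<k. \<forall>m\<in>M. s (a j) m \<in> seq_multiples s a j M \<longrightarrow> m \<in> seq_multiples s a j M)"

lemma koszul_exactD:
  assumes "koszul_exact s a k M i"
    and "\<And>T. T \<subseteq> {..<k} \<Longrightarrow> card T = i \<Longrightarrow> c T \<in> M"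
    and "\<And>T. T \<subseteq> {..<k} \<Longrightarrow> card T = Suc i \<Longrightarrow> ext_mult s a c T = 0"
  obtains e where "\<And>T. T \<subseteq> {..<k} \<Longrightarrow> Suc (card T) = i \<Longrightarrow> e T \<in> M"
    and "\<And>T. T \<subseteq> {..<k} \<Longrightarrow> card T = i \<Longrightarrow> c T = ext_mult s a e T"
proof -
  have "(\<forall>T\<subseteq>{..<k}. card T = i \<longrightarrow> c T \<in> M) \<longrightarrow> (\<forall>T\<subseteq>{..<k}. card T = Suc i \<longrightarrow> ext_mult s a c T = 0) \<longrightarrow>
      (\<exists>e. (\<forall>T\<subseteq>{..<k}. Suc (card T) = i \<longrightarrow> e T \<in> M) \<and>
           (\<forall>T\<subseteq>{..<k}. card T = i \<longrightarrow> c T = ext_mult s a e T))"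
    using assms(1) unfolding koszul_exact_def by (rule spec)
  then show thesis using assms(2,3) that by auto
qed

lemma koszul_grade_mono: "koszul_grade s a k M m \<Longrightarrow> m' \<le> m \<Longrightarrow> koszul_grade s a k M m'"
  by (simp add: koszul_grade_def)

lemma ext_mult_cong:
  "(\<And>t. t \<in> T \<Longrightarrow> c (T - {t}) = e (T - {t})) \<Longrightarrow> ext_mult s a c T = ext_mult s a e T"
  unfolding ext_mult_def by (rule sum.cong) auto

context module
begin

lemma ext_mult_add: "ext_mult scale a (\<lambda>T. c T + e T) T = ext_mult scale a c T + ext_mult scale a e T"
  by (simp add: ext_mult_def scale_right_distrib sum.distrib)

lemma ext_mult_diff: "ext_mult scale a (\<lambda>T. c T - e T) T = ext_mult scale a c T - ext_mult scale a e T"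
  by (simp add: ext_mult_def scale_right_diff_distrib sum_subtractf)

lemma ext_mult_mem:
  assumes "subspace M" "\<And>t. t \<in> T \<Longrightarrow> c (T - {t}) \<in> M"
  shows "ext_mult scale a c T \<in> M"
  unfolding ext_mult_def using assms by (intro subspace_sum subspace_scale) auto

text \<open>As \<open>k\<close> exceeds all elements of \<open>T\<close>, the signs at these
  elements ignore it. Sets with and without \<open>k\<close> thus present the Koszul complex on
  \<open>k + 1\<close> elements as the mapping cone of multiplication by \<open>a k\<close>, up to
  sign.\<close>

lemma ext_mult_insert_top:
  fixes c :: "nat set \<Rightarrow> 'b"
  assumes "T \<subseteq> {..<k}"
  shows "ext_mult scale a c (insert k T) =
    scale (sgn_at k T * a k) (c T) + ext_mult scale a (\<lambda>U. c (insert k U)) T"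
proof -
  have T: "finite T" "k \<notin> T" using assms finite_subset by auto
  have "sgn_at t (insert k T) = (sgn_at t T :: 'a)" "insert k T - {t} = insert k (T - {t})" if "t \<in> T" for t
    using that assms T by (auto simp: sgn_at_insert)
  then have "(\<Sum>t\<in>T. scale (sgn_at t (insert k T) * a t) (c (insert k T - {t}))) =
      ext_mult scale a (\<lambda>U. c (insert k U)) T"
    unfolding ext_mult_def by (intro sum.cong) auto
  then show ?thesis using T by (simp add: ext_mult_def)
qed

text \<open>Restricted to sets avoiding \<open>k\<close>, a cocycle is a cocycle for the first
  \<open>k\<close> elements and is made zero there by subtracting a coboundary. What is left lives
  on sets containing \<open>k\<close> and is a cocycle of one degree less for the first
  \<open>k\<close> elements. Regularity of \<open>a k\<close> enters in the top degree
  \<open>i = k\<close>, which the induction hypothesis does not reach.\<close>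

theorem koszul_grade_regular_seq:
  assumes M: "subspace M" and reg: "regular_seq scale a k M"
  shows "koszul_grade scale a k M k"
  using reg
proof (induction k)
  case 0
  then show ?case by (simp add: koszul_grade_def)
next
  case (Suc k)
  have IH: "koszul_exact scale a k M i" if "i < k" for i
    using Suc that by (auto simp: regular_seq_def koszul_grade_def)
  show ?case unfolding koszul_grade_def
  proof (intro allI impI)
    fix i assume i: "i < Suc k"
    show "koszul_exact scale a (Suc k) M i" unfolding koszul_exact_def
    proof (intro allI impI)
      fix c assume cM: "\<forall>T\<subseteq>{..<Suc k}. card T = i \<longrightarrow> c T \<in> M"
        and dc: "\<forall>T\<subseteq>{..<Suc k}. card T = Suc i \<longrightarrow> ext_mult scale a c T = 0"
      have sub: "T \<subseteq> {..<Suc k}" "insert k T \<subseteq> {..<Suc k}" "finite T" "k \<notin> T" if "T \<subseteq> {..<k}" for T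
        using that finite_subset by auto
      have "\<exists>e. (\<forall>T\<subseteq>{..<k}. Suc (card T) = i \<longrightarrow> e T \<in> M) \<and> (\<forall>T\<subseteq>{..<k}. card T = i \<longrightarrow> c T = ext_mult scale a e T)"
      proof (cases "i < k")
        case True
        obtain e where "\<And>T. T \<subseteq> {..<k} \<Longrightarrow> Suc (card T) = i \<Longrightarrow> e T \<in> M"
          "\<And>T. T \<subseteq> {..<k} \<Longrightarrow> card T = i \<Longrightarrow> c T = ext_mult scale a e T"
          by (rule koszul_exactD[OF IH[OF True], of c]) (use cM dc sub in auto)
        then show ?thesis by auto
      next
        case False
        then have ik: "i = k" using i by simp
        \<comment> \<open>In degree \<open>k\<close> the only set avoiding \<open>k\<close> is
          \<open>N\<close>. The cocycle condition at \<open>insert k N\<close> says that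
          \<open>a k\<close> times \<open>c N\<close> is a combination of multiples of the earlier
          \<open>a t\<close>.\<close>
        define N where "N = {..<k}"
        have N: "N \<subseteq> {..<k}" "card N = k" "finite N" "k \<notin> N" by (auto simp: N_def)
        have "ext_mult scale a c (insert k N) = 0" using dc N ik sub by auto
        then have "scale (sgn_at k N * a k) (c N) + ext_mult scale a (\<lambda>U. c (insert k U)) N = 0"
          using ext_mult_insert_top[OF N(1)] by metis
        then have "scale (sgn_at k N * a k) (c N) = - ext_mult scale a (\<lambda>U. c (insert k U)) N"
          by (rule eq_neg_iff_add_eq_0[THEN iffD2])
        then have "scale (sgn_at k N) (scale (sgn_at k N * a k) (c N)) =
            scale (sgn_at k N) (- ext_mult scale a (\<lambda>U. c (insert k U)) N)" by (rule arg_cong)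
        then have "scale (a k) (c N) = - scale (sgn_at k N) (ext_mult scale a (\<lambda>U. c (insert k U)) N)"
          by (simp add: mult.assoc[symmetric])
        also have "\<dots> = (\<Sum>t<k. scale (a t) (scale (- sgn_at k N * sgn_at t N) (c (insert k (N - {t})))))"
          by (simp add: ext_mult_def scale_sum_right N_def sum_negf ac_simps)
        finally have "scale (a k) (c N) \<in> seq_multiples scale a k M"
        proof -
          have "scale (- sgn_at k N * sgn_at t N) (c (insert k (N - {t}))) \<in> M" if "t < k" for t
          proof -
            have "card (insert k (N - {t})) = i" using N ik that by (simp add: N_def)
            moreover have "insert k (N - {t}) \<subseteq> {..<Suc k}" by (auto simp: N_def)
            ultimately have "c (insert k (N - {t})) \<in> M" using cM by blast
            then show ?thesis using M by (blast intro: subspace_scale)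
          qed
          moreover assume "scale (a k) (c N) = (\<Sum>t<k. scale (a t) (scale (- sgn_at k N * sgn_at t N) (c (insert k (N - {t})))))"
          ultimately show ?thesis unfolding seq_multiples_def
            by (intro CollectI exI[of _ "\<lambda>t. scale (- sgn_at k N * sgn_at t N) (c (insert k (N - {t})))"]) simp
        qed
        moreover have "c N \<in> M" using cM N ik sub by auto
        ultimately have "c N \<in> seq_multiples scale a k M" using Suc.prems by (auto simp: regular_seq_def)
        then obtain f where f: "\<And>t. t < k \<Longrightarrow> f t \<in> M" "c N = (\<Sum>t<k. scale (a t) (f t))"
          by (auto simp: seq_multiples_def)
        \<comment> \<open>Only the sets \<open>N - {t}\<close> matter, and there the sum has the
          single term \<open>f t\<close> up to sign.\<close>
        define e where "e = (\<lambda>T. \<Sum>t\<in>N - T. scale (sgn_at t N) (f t))"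
        have "e T \<in> M" for T unfolding e_def
          using f M by (intro subspace_sum subspace_scale) (auto simp: N_def)
        moreover have "c T = ext_mult scale a e T" if "T \<subseteq> {..<k}" "card T = i" for T
        proof -
          have "T = N" using that ik by (simp add: N_def card_subset_eq)
          moreover have "e (N - {t}) = scale (sgn_at t N) (f t)" if "t \<in> N" for t
          proof -
            have "N - (N - {t}) = {t}" using that by auto
            then show ?thesis by (simp add: e_def)
          qed
          ultimately show ?thesis
            by (simp add: f(2)[unfolded N_def] ext_mult_def N_def mult.assoc mult.commute[of _ "a _"])
        qed
        ultimately show ?thesis by blast
      qed
      then obtain e' where e': "\<And>T. T \<subseteq> {..<k} \<Longrightarrow> Suc (card T) = i \<Longrightarrow> e' T \<in> M"
        "\<And>T. T \<subseteq> {..<k} \<Longrightarrow> card T = i \<Longrightarrow> c T = ext_mult scale a e' T" by blast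
      define e1 where "e1 = (\<lambda>T. if k \<in> T then 0 else e' T)"
      have e1N: "ext_mult scale a e1 T = ext_mult scale a e' T" if "T \<subseteq> {..<k}" for T
        by (rule ext_mult_cong) (use that in \<open>auto simp: e1_def\<close>)
      have e1M: "e1 T \<in> M" if "T \<subseteq> {..<Suc k}" "Suc (card T) = i" for T
      proof (cases "k \<in> T")
        case False
        then have "T \<subseteq> {..<k}" using that(1) by (auto simp: lessThan_Suc)
        then show ?thesis using e'(1) that False by (simp add: e1_def)
      qed (simp add: e1_def subspace_0[OF M])
      define c1 where "c1 = (\<lambda>T. c T - ext_mult scale a e1 T)"
      have c1M: "c1 T \<in> M" if T: "T \<subseteq> {..<Suc k}" "card T = i" for T
      proof -
        have "e1 (T - {t}) \<in> M" if "t \<in> T" for t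
          using e1M[of "T - {t}"] that T
          card_Suc_Diff1[OF finite_subset[OF T(1)] that] by auto
        then show ?thesis unfolding c1_def using M cM T by (intro subspace_diff ext_mult_mem) auto
      qed
      have c1N: "c1 T = 0" if "T \<subseteq> {..<k}" "card T = i" for T
        using that e' by (simp add: c1_def e1N)
      have dc1: "ext_mult scale a c1 T = 0" if "T \<subseteq> {..<Suc k}" "card T = Suc i" for T
        using that dc finite_subset[OF that(1)] by (simp add: c1_def ext_mult_diff ext_mult_ext_mult_self)
      have "\<exists>e''. (\<forall>U\<subseteq>{..<k}. Suc (Suc (card U)) = i \<longrightarrow> e'' U \<in> M) \<and>
          (\<forall>U\<subseteq>{..<k}. Suc (card U) = i \<longrightarrow> c1 (insert k U) = ext_mult scale a e'' U)"
      \<comment> \<open>For \<open>i = 0\<close> both requirements are vacuous, as a set containing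
        \<open>k\<close> is not empty.\<close>
      proof (cases i)
        case (Suc j)
        have "koszul_exact scale a k M j" using IH i Suc by simp
        moreover have "c1 (insert k T) \<in> M" if "T \<subseteq> {..<k}" "card T = j" for T
          using c1M[OF sub(2)] sub[OF that(1)] that Suc by auto
        moreover have "ext_mult scale a (\<lambda>U. c1 (insert k U)) T = 0"
          if T: "T \<subseteq> {..<k}" "card T = Suc j" for T
        proof -
          have "ext_mult scale a c1 (insert k T) = 0" using dc1 sub[OF T(1)] T Suc by auto
          then show "ext_mult scale a (\<lambda>U. c1 (insert k U)) T = 0"
            using ext_mult_insert_top[OF T(1), of a c1] c1N T Suc by simp
        qed
        ultimately show ?thesis
          unfolding Suc by (rule koszul_exactD[of scale a k M j "\<lambda>U. c1 (insert k U)"]) auto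
      qed simp
      then obtain e'' where e'': "\<And>U. U \<subseteq> {..<k} \<Longrightarrow> Suc (Suc (card U)) = i \<Longrightarrow> e'' U \<in> M"
        "\<And>U. U \<subseteq> {..<k} \<Longrightarrow> Suc (card U) = i \<Longrightarrow> c1 (insert k U) = ext_mult scale a e'' U" by blast
      \<comment> \<open>Extended by zero, \<open>e2\<close> has a coboundary supported on sets
        containing \<open>k\<close>, so it does not disturb what \<open>e1\<close> achieves on the
        others.\<close>
      define e2 where "e2 = (\<lambda>T. if k \<in> T then e'' (T - {k}) else 0)"
      have e2M: "e2 T \<in> M" if T: "T \<subseteq> {..<Suc k}" "Suc (card T) = i" for T
      proof (cases "k \<in> T")
        case True
        have "finite T" using T finite_subset by auto
        then have "Suc (card (T - {k})) = card T" using True by (rule card_Suc_Diff1)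
        moreover have "T - {k} \<subseteq> {..<k}" using T by (auto simp: lessThan_Suc)
        ultimately show ?thesis using e''(1) T True by (simp add: e2_def)
      qed (simp add: e2_def subspace_0[OF M])
      show "\<exists>e. (\<forall>T\<subseteq>{..<Suc k}. Suc (card T) = i \<longrightarrow> e T \<in> M) \<and>
          (\<forall>T\<subseteq>{..<Suc k}. card T = i \<longrightarrow> c T = ext_mult scale a e T)"
      proof (intro exI conjI allI impI)
        fix T assume T: "T \<subseteq> {..<Suc k}"
        show "e1 T + e2 T \<in> M" if "Suc (card T) = i"
          using e1M[OF T that] e2M[OF T that] M by (rule subspace_add[rotated])
        assume cT: "card T = i"
        show "c T = ext_mult scale a (\<lambda>T. e1 T + e2 T) T"
        proof (cases "k \<in> T")
          case True
          define U where "U = T - {k}"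
          have U: "U \<subseteq> {..<k}" "T = insert k U" using T True by (auto simp: U_def lessThan_Suc)
          have cU: "Suc (card U) = i" using cT sub[OF U(1)] U(2) by simp
          have k: "k \<notin> U" using sub U by blast
          have "ext_mult scale a e2 T = ext_mult scale a (\<lambda>U. e2 (insert k U)) U"
            using ext_mult_insert_top[OF U(1)] k by (simp add: U(2) e2_def)
          also have "\<dots> = ext_mult scale a e'' U"
            by (rule ext_mult_cong) (use k in \<open>auto simp: e2_def\<close>)
          also have "\<dots> = c T - ext_mult scale a e1 T"
            using e''(2)[OF U(1) cU] by (simp add: c1_def U(2))
          finally show ?thesis by (simp add: ext_mult_add)
        next
          case False
          then have TN: "T \<subseteq> {..<k}" using T by (auto simp: lessThan_Suc)
          have "ext_mult scale a e2 T = ext_mult scale a (\<lambda>_. 0) T"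
            by (rule ext_mult_cong) (use False in \<open>auto simp: e2_def\<close>)
          then have "ext_mult scale a e2 T = 0" by (simp add: ext_mult_def)
          then show ?thesis using e'(2)[OF TN cT] e1N[OF TN] by (simp add: ext_mult_add)
        qed
      qed
    qed
  qed
qed

text \<open>The multiples of \<open>z\<close> by the \<open>a i\<close> form a 1-cocycle with values
  in \<open>B\<close>, being the coboundary of \<open>z\<close>. Exactness on \<open>B\<close>
  produces an element of \<open>B\<close> with the same multiples. Exactness in degree 0 on
  \<open>C\<close> says that only zero is annihilated by all \<open>a i\<close>, so this element is
  \<open>z\<close>.\<close>

lemma koszul_exact_cancel:
  assumes "subspace C" "B \<subseteq> C" "koszul_exact scale a k B 1" "koszul_exact scale a k C 0"
    and z: "z \<in> C" "\<And>i. i < k \<Longrightarrow> scale (a i) z \<in> B"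
  shows "z \<in> B"
proof -
  have sing: "ext_mult scale a c {t} = scale (a t) (c {})" for t :: nat and c
  proof -
    have "{j \<in> {t}. j < t} = {}" by auto
    then have "sgn_at t {t} = (1::'a)" by (metis card.empty power_0 sgn_at_def)
    then show ?thesis by (simp add: ext_mult_def)
  qed
  define c where "c = ext_mult scale a (\<lambda>_. z)"
  obtain e where e: "\<And>T. T \<subseteq> {..<k} \<Longrightarrow> Suc (card T) = 1 \<Longrightarrow> e T \<in> B"
     "\<And>T. T \<subseteq> {..<k} \<Longrightarrow> card T = 1 \<Longrightarrow> c T = ext_mult scale a e T"
  proof (rule koszul_exactD[OF assms(3), of c])
    show "c T \<in> B" if "T \<subseteq> {..<k}" "card T = 1" for T
      using that by (auto simp: c_def sing z card_1_singleton_iff)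
    show "ext_mult scale a c T = 0" if "T \<subseteq> {..<k}" "card T = Suc 1" for T
      unfolding c_def using that finite_subset by (blast intro: ext_mult_ext_mult_self)
  qed auto
  have eB: "e {} \<in> B" using e(1) by auto
  have 0: "scale (a t) (z - e {}) = 0" if "t < k" for t
    using e(2)[of "{t}"] that by (simp add: c_def sing scale_right_diff_distrib)
  obtain e' where "\<And>T. T \<subseteq> {..<k} \<Longrightarrow> card T = 0 \<Longrightarrow> z - e {} = ext_mult scale a e' T"
  proof (rule koszul_exactD[OF assms(4), of "\<lambda>_. z - e {}"])
    show "z - e {} \<in> C" using assms eB by (auto intro: subspace_diff)
    show "ext_mult scale a (\<lambda>_. z - e {}) T = 0" if "T \<subseteq> {..<k}" "card T = Suc 0" for T
      using that 0 by (auto simp: sing card_Suc_eq)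
  qed auto
  from this[of "{}"] have "z - e {} = 0" by (simp add: ext_mult_def)
  then show ?thesis using eB by simp
qed

end

section \<open>Koszul cohomology under module homomorphisms\<close>

lemma hom_ext_mult:
  fixes T :: "'d::linorder set" and B :: "'b::ab_group_add set" and C :: "'c::ab_group_add set"
  assumes s1: "module s1" and s2: "module s2"
    and B: "module.subspace s1 B" and h: "module_hom_between s1 s2 B C h"
    and c: "\<And>t. t \<in> T \<Longrightarrow> c (T - {t}) \<in> B" and "finite T"
  shows "h (ext_mult s1 a c T) = ext_mult s2 a (\<lambda>U. h (c U)) T"
proof -
  interpret m1: module s1 by fact
  interpret m2: module s2 by fact
  have h: "\<And>x y. x \<in> B \<Longrightarrow> y \<in> B \<Longrightarrow> h (x + y) = h x + h y" "\<And>r x. x \<in> B \<Longrightarrow> h (s1 r x) = s2 r (h x)"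
    using h by (auto simp: module_hom_between_def)
  have h0: "h 0 = 0" using h(2)[of 0 0] m1.subspace_0[OF B] by simp
  have hs: "finite U \<Longrightarrow> (\<forall>t\<in>U. f t \<in> B) \<Longrightarrow> h (sum f U) = (\<Sum>t\<in>U. h (f t)) \<and> sum f U \<in> B"
    for U :: "'d set" and f :: "'d \<Rightarrow> 'b"
    by (induction U rule: finite_induct) (auto simp: h h0 m1.subspace_0[OF B] intro: m1.subspace_add[OF B])
  have "h (\<Sum>t\<in>T. s1 (sgn_at t T * a t) (c (T - {t}))) = (\<Sum>t\<in>T. h (s1 (sgn_at t T * a t) (c (T - {t}))))"
    by (rule hs[OF \<open>finite T\<close>, THEN conjunct1]) (use c m1.subspace_scale[OF B] in blast)
  also have "\<dots> = (\<Sum>t\<in>T. s2 (sgn_at t T * a t) (h (c (T - {t}))))"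
    using c by (intro sum.cong) (auto simp: h)
  finally show ?thesis by (simp add: ext_mult_def)
qed

text \<open>A diagram chase in the long exact sequence of kernel, \<open>B\<close> and image. A
  cocycle in \<open>C\<close> is lifted to \<open>B\<close>; the coboundary of the lift lies in the
  kernel and is a coboundary there, and the lift corrected accordingly is a cocycle of
  \<open>B\<close>. The kernel is used one degree higher, hence the loss of one.\<close>

lemma koszul_grade_image:
  assumes s1: "module s1" and s2: "module s2"
    and B: "module.subspace s1 B" and h: "module_hom_between s1 s2 B C h" "h ` B = C"
    and kerg: "koszul_grade s1 a k {x \<in> B. h x = 0} (Suc m)" and Bg: "koszul_grade s1 a k B m"
  shows "koszul_grade s2 a k C m"
  unfolding koszul_grade_def koszul_exact_def
proof (intro allI impI)
  interpret m1: module s1 by fact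
  interpret m2: module s2 by fact
  fix i c assume i: "i < m" and c: "\<forall>T\<subseteq>{..<k}. card T = i \<longrightarrow> c T \<in> C"
    and dc: "\<forall>T\<subseteq>{..<k}. card T = Suc i \<longrightarrow> ext_mult s2 a c T = 0"
  have hB: "h (x - y) = h x - h y" if "x \<in> B" "y \<in> B" for x y
  proof -
    have "h ((x - y) + y) = h (x - y) + h y"
      using h(1) that m1.subspace_diff[OF B] unfolding module_hom_between_def by blast
    then show ?thesis by simp
  qed
  have fin: "finite T" if "T \<subseteq> {..<k}" for T using that finite_subset by blast
  define b where "b = (\<lambda>T. SOME x. x \<in> B \<and> h x = c T)"
  have b: "b T \<in> B" "h (b T) = c T" if "T \<subseteq> {..<k}" "card T = i" for T
  proof -
    have "c T \<in> h ` B" using that c h(2) by blast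
    then obtain x where "c T = h x" "x \<in> B" by (rule imageE)
    then have "\<exists>x. x \<in> B \<and> h x = c T" by (intro exI[of _ x]) simp
    then have "b T \<in> B \<and> h (b T) = c T" unfolding b_def by (rule someI_ex)
    then show "b T \<in> B" "h (b T) = c T" by auto
  qed
  have ker: "ext_mult s1 a b T \<in> {x \<in> B. h x = 0}" if T: "T \<subseteq> {..<k}" "card T = Suc i" for T
  proof -
    have sub: "T - {t} \<subseteq> {..<k}" "card (T - {t}) = i" if "t \<in> T" for t
      using T that fin[OF T(1)] by auto
    have "h (ext_mult s1 a b T) = ext_mult s2 a (\<lambda>U. h (b U)) T"
      using sub b fin T by (intro hom_ext_mult[OF s1 s2 B h(1)]) auto
    also have "\<dots> = ext_mult s2 a c T" using sub b by (intro ext_mult_cong) auto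
    finally have "h (ext_mult s1 a b T) = 0" using dc T by simp
    moreover have "ext_mult s1 a b T \<in> B" using sub b by (intro m1.ext_mult_mem[OF B]) auto
    ultimately show ?thesis by simp
  qed
  have dd: "ext_mult s1 a (ext_mult s1 a b) T = 0" if "T \<subseteq> {..<k}" for T
    by (rule m1.ext_mult_ext_mult_self[OF fin[OF that]])
  have "koszul_exact s1 a k {x \<in> B. h x = 0} (Suc i)" using kerg i by (simp add: koszul_grade_def)
  then obtain e where e: "\<And>T. T \<subseteq> {..<k} \<Longrightarrow> Suc (card T) = Suc i \<Longrightarrow> e T \<in> {x \<in> B. h x = 0}"
    "\<And>T. T \<subseteq> {..<k} \<Longrightarrow> card T = Suc i \<Longrightarrow> ext_mult s1 a b T = ext_mult s1 a e T"
    by (rule koszul_exactD[of s1 a k _ _ "ext_mult s1 a b"])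
      (use ker dd in auto)
  have de: "ext_mult s1 a (\<lambda>T. b T - e T) T = 0" if "T \<subseteq> {..<k}" "card T = Suc i" for T
    by (simp add: m1.ext_mult_diff e(2)[OF that])
  have "koszul_exact s1 a k B i" using Bg i by (simp add: koszul_grade_def)
  then obtain e' where e': "\<And>T. T \<subseteq> {..<k} \<Longrightarrow> Suc (card T) = i \<Longrightarrow> e' T \<in> B"
    "\<And>T. T \<subseteq> {..<k} \<Longrightarrow> card T = i \<Longrightarrow> b T - e T = ext_mult s1 a e' T"
    by (rule koszul_exactD[of s1 a k _ _ "\<lambda>T. b T - e T"])
      (use b e(1) de m1.subspace_diff[OF B] in auto)
  show "\<exists>e. (\<forall>T\<subseteq>{..<k}. Suc (card T) = i \<longrightarrow> e T \<in> C) \<and> (\<forall>T\<subseteq>{..<k}. card T = i \<longrightarrow> c T = ext_mult s2 a e T)"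
  proof (intro exI[of _ "\<lambda>T. h (e' T)"] conjI allI impI)
    show "h (e' T) \<in> C" if "T \<subseteq> {..<k}" "Suc (card T) = i" for T
      using e'(1)[OF that] h(2) by blast
    fix T assume T: "T \<subseteq> {..<k}" "card T = i"
    have sub: "T - {t} \<subseteq> {..<k}" "Suc (card (T - {t})) = i" if "t \<in> T" for t
      using T that card_Suc_Diff1[OF fin[OF T(1)] that] by auto
    have "c T = h (b T - e T)" using hB b e T by auto
    also have "\<dots> = h (ext_mult s1 a e' T)" using e'(2)[OF T] by simp
    also have "\<dots> = ext_mult s2 a (\<lambda>T. h (e' T)) T"
      using sub e' fin T by (intro hom_ext_mult[OF s1 s2 B h(1)]) auto
    finally show "c T = ext_mult s2 a (\<lambda>T. h (e' T)) T" .
  qed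
qed

text \<open>A primitive found in \<open>B\<close> is carried into \<open>P\<close> by
  \<open>r\<close>, which commutes with the differential and fixes the given cocycle.\<close>

lemma koszul_grade_retract:
  assumes s: "module s" and B: "module.subspace s B" and "P \<subseteq> B"
    and r: "module_hom_between s s B P r" "\<And>x. x \<in> P \<Longrightarrow> r x = x"
    and g: "koszul_grade s a k B m"
  shows "koszul_grade s a k P m"
  unfolding koszul_grade_def koszul_exact_def
proof (intro allI impI)
  fix i c assume i: "i < m" and c: "\<forall>T\<subseteq>{..<k}. card T = i \<longrightarrow> c T \<in> P"
    and dc: "\<forall>T\<subseteq>{..<k}. card T = Suc i \<longrightarrow> ext_mult s a c T = 0"
  have "koszul_exact s a k B i" using g i by (simp add: koszul_grade_def)
  then obtain e where e: "\<And>T. T \<subseteq> {..<k} \<Longrightarrow> Suc (card T) = i \<Longrightarrow> e T \<in> B"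
    "\<And>T. T \<subseteq> {..<k} \<Longrightarrow> card T = i \<Longrightarrow> c T = ext_mult s a e T"
    by (rule koszul_exactD[of s a k _ _ c]) (use c dc \<open>P \<subseteq> B\<close> in auto)
  show "\<exists>e. (\<forall>T\<subseteq>{..<k}. Suc (card T) = i \<longrightarrow> e T \<in> P) \<and> (\<forall>T\<subseteq>{..<k}. card T = i \<longrightarrow> c T = ext_mult s a e T)"
  proof (intro exI[of _ "\<lambda>T. r (e T)"] conjI allI impI)
    show "r (e T) \<in> P" if "T \<subseteq> {..<k}" "Suc (card T) = i" for T
      using e(1)[OF that] r by (auto simp: module_hom_between_def)
    fix T assume T: "T \<subseteq> {..<k}" "card T = i"
    have "finite T" using T finite_subset by blast
    have sub: "T - {t} \<subseteq> {..<k}" "Suc (card (T - {t})) = i" if "t \<in> T" for t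
      using T that card_Suc_Diff1[OF \<open>finite T\<close> that] by auto
    have "c T = r (c T)" using c r T by simp
    also have "\<dots> = ext_mult s a (\<lambda>T. r (e T)) T"
      unfolding e(2)[OF T] using sub e \<open>finite T\<close> by (intro hom_ext_mult[OF s s B r(1)]) auto
    finally show "c T = ext_mult s a (\<lambda>T. r (e T)) T" .
  qed
qed


section \<open>Projective modules\<close>

lemma seq_multiples_ring:
  fixes a :: "nat \<Rightarrow> 'a::comm_ring_1"
  shows "seq_multiples (*) a j UNIV = module.span (*) (a ` {..<j})"
proof -
  interpret module "(*) :: 'a \<Rightarrow> 'a \<Rightarrow> 'a" by (rule module_times)
  show ?thesis
  proof (intro equalityI subsetI)
    fix x assume "x \<in> seq_multiples (*) a j UNIV"
    then obtain f where "x = (\<Sum>i<j. a i * f i)" by (auto simp: seq_multiples_def)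
    then have "x = (\<Sum>i<j. f i * a i)" by (simp add: mult.commute)
    then show "x \<in> span (a ` {..<j})" by (auto intro: span_sum span_scale span_base)
  next
    fix x assume "x \<in> span (a ` {..<j})"
    then show "x \<in> seq_multiples (*) a j UNIV"
    proof (induction rule: span_induct_alt)
      case base
      show ?case unfolding seq_multiples_def by (auto intro!: exI[of _ "\<lambda>_. 0"])
    next
      case (step c x y)
      then obtain f i where f: "y = (\<Sum>i<j. a i * f i)" "i < j" "x = a i" by (auto simp: seq_multiples_def)
      have "c * x + y = (\<Sum>l<j. a l * ((if l = i then c else 0) + f l))"
        using f(2) by (simp add: f(1,3) distrib_left sum.distrib if_distrib[of "(*) _"] sum.delta cong: if_cong)
      then show ?case by (auto simp: seq_multiples_def)
    qed
  qed
qed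

lemma regular_seq_free:
  assumes "regular_seq (*) a k (UNIV :: 'a::comm_ring_1 set)"
  shows "regular_seq free_scale a k UNIV"
  unfolding regular_seq_def
proof (intro allI impI ballI)
  fix j m assume j: "j < k" and "free_scale (a j) m \<in> seq_multiples free_scale a j UNIV"
  then obtain f where f: "free_scale (a j) m = (\<Sum>i<j. free_scale (a i) (f i))" by (auto simp: seq_multiples_def)
  \<comment> \<open>The coefficients are taken to be zero wherever \<open>m\<close> vanishes, so
    that they assemble to finitely supported vectors.\<close>
  have "\<exists>g. Poly_Mapping.lookup m n = (\<Sum>i<j. a i * g i) \<and> (Poly_Mapping.lookup m n = 0 \<longrightarrow> g = (\<lambda>_. 0))" for n
  proof (cases "Poly_Mapping.lookup m n = 0")
    case False
    have "a j * Poly_Mapping.lookup m n = (\<Sum>i<j. a i * Poly_Mapping.lookup (f i) n)"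
      using arg_cong[OF f, of "\<lambda>v. Poly_Mapping.lookup v n"] by (simp add: lookup_free_scale lookup_sum)
    then have "a j * Poly_Mapping.lookup m n \<in> seq_multiples (*) a j UNIV" by (auto simp: seq_multiples_def)
    then have "Poly_Mapping.lookup m n \<in> seq_multiples (*) a j UNIV" using assms j by (auto simp: regular_seq_def)
    then show ?thesis using False by (auto simp: seq_multiples_def)
  qed auto
  then obtain g where g: "\<And>n. Poly_Mapping.lookup m n = (\<Sum>i<j. a i * g n i)"
    "\<And>n. Poly_Mapping.lookup m n = 0 \<Longrightarrow> g n = (\<lambda>_. 0)" by metis
  define G where "G = (\<lambda>i. Abs_poly_mapping (\<lambda>n. g n i))"
  have "finite {n. g n i \<noteq> 0}" for i
    by (rule finite_subset[OF _ finite_keys[of m]]) (use g(2) in \<open>auto simp: in_keys_iff\<close>)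
  then have G: "Poly_Mapping.lookup (G i) n = g n i" for i n by (simp add: G_def)
  have "m = (\<Sum>i<j. free_scale (a i) (G i))"
    by (rule poly_mapping_eqI) (simp add: lookup_sum lookup_free_scale G g(1))
  then show "m \<in> seq_multiples free_scale a j UNIV" by (auto simp: seq_multiples_def)
qed

lemma koszul_grade_projective:
  fixes P :: "(nat \<Rightarrow>\<^sub>0 'a::comm_ring_1) set"
  assumes reg: "regular_seq (*) a k (UNIV :: 'a set)" and "projective P"
  shows "koszul_grade free_scale a k P k"
proof -
  obtain Q where P: "free.subspace P" and Q: "free.subspace Q" and PQ: "P \<inter> Q = {0}"
    and dec: "\<And>v. \<exists>p\<in>P. \<exists>q\<in>Q. v = p + q"
    using assms(2) unfolding projective_def by blast
  \<comment> \<open>The projection onto \<open>P\<close> along \<open>Q\<close>; uniqueness of the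
    decomposition makes it linear.\<close>
  define r where "r = (\<lambda>v. SOME p. p \<in> P \<and> v - p \<in> Q)"
  have r: "r v \<in> P" "v - r v \<in> Q" for v
  proof -
    have "\<exists>p. p \<in> P \<and> v - p \<in> Q" using dec[of v] by force
    then have "r v \<in> P \<and> v - r v \<in> Q" unfolding r_def by (rule someI_ex)
    then show "r v \<in> P" "v - r v \<in> Q" by auto
  qed
  have uniq: "r v = p" if "p \<in> P" "v - p \<in> Q" for v p
  proof -
    have "r v - p \<in> P" using r(1)[of v] that(1) P by (simp add: free.subspace_diff)
    moreover have "(v - p) - (v - r v) \<in> Q" by (rule free.subspace_diff[OF Q that(2) r(2)])
    ultimately have "r v - p \<in> P \<inter> Q" by simp
    then show ?thesis using PQ by simp
  qed
  have "koszul_grade free_scale a k UNIV k"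
    by (rule free.koszul_grade_regular_seq[OF _ regular_seq_free[OF reg]]) simp
  moreover have "module_hom_between free_scale free_scale UNIV P r"
    unfolding module_hom_between_def
  proof (intro conjI allI ballI)
    show "r ` UNIV \<subseteq> P" using r by auto
    show "r (x + y) = r x + r y" for x y
    proof (rule uniq)
      show "r x + r y \<in> P" using r P by (auto intro: free.subspace_add)
      have "(x - r x) + (y - r y) \<in> Q" using r Q by (auto intro: free.subspace_add)
      then show "x + y - (r x + r y) \<in> Q" by (simp add: algebra_simps)
    qed
    show "r (free_scale c x) = free_scale c (r x)" for c x
    proof (rule uniq)
      show "free_scale c (r x) \<in> P" using r P by (auto intro: free.subspace_scale)
      have "free_scale c (x - r x) \<in> Q" using r Q by (auto intro: free.subspace_scale)
      then show "free_scale c x - free_scale c (r x) \<in> Q" by (simp add: free.scale_right_diff_distrib)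
    qed
  qed
  moreover have "r p = p" if "p \<in> P" for p
    using that Q by (intro uniq) (auto intro: free.subspace_0)
  ultimately show ?thesis
    by (intro koszul_grade_retract[OF free.module_axioms, of UNIV P r]) auto
qed

lemma koszul_exact_zero:
  assumes "module s"
  shows "koszul_exact s a k {0} i"
  unfolding koszul_exact_def
  by (auto simp: ext_mult_def module.scale_zero_right[OF assms] intro!: exI[of _ "\<lambda>_. 0"])

text \<open>One inequality of the Auslander-Buchsbaum formula. Projective modules have vanishing
  below degree \<open>k\<close>, and each step through the syzygies, from the left end of the
  resolution to \<open>M\<close>, costs one degree.\<close>

theorem koszul_grade_projective_resolution:
  fixes M :: "'b::ab_group_add set" and s :: "'a::comm_ring_1 \<Rightarrow> 'b \<Rightarrow> 'b"
  assumes s: "module s" and reg: "regular_seq (*) a k (UNIV :: 'a set)" and res: "has_projective_resolution s M n"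
  shows "koszul_grade s a k M (k - n)"
proof -
  obtain P :: "nat \<Rightarrow> (nat \<Rightarrow>\<^sub>0 'a) set" and d e where
    proj: "\<And>i. projective (P i)" and P0: "\<And>i. i > n \<Longrightarrow> P i = {0}"
    and e: "module_hom_between free_scale s (P 0) M e" "e ` P 0 = M"
    and d: "\<And>i. module_hom_between free_scale free_scale (P (Suc i)) (P i) (d i)"
    and ex0: "{x \<in> P 0. e x = 0} = d 0 ` P (Suc 0)"
    and ex: "\<And>i. {x \<in> P (Suc i). d i x = 0} = d (Suc i) ` P (Suc (Suc i))"
    using res unfolding has_projective_resolution_def by blast
  have sub: "free.subspace (P i)" for i using proj by (simp add: projective_def)
  have gP: "koszul_grade free_scale a k (P i) k" for i by (rule koszul_grade_projective[OF reg proj])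
  have step: "koszul_grade s' a k (h ` P i) (k - j)"
    if "module s'" "module_hom_between free_scale s' (P i) N h"
      "koszul_grade free_scale a k {x \<in> P i. h x = 0} (Suc k - j)"
    for i j N and h :: "_ \<Rightarrow> 'c::ab_group_add" and s' :: "'a \<Rightarrow> 'c \<Rightarrow> 'c"
  proof (cases "j \<le> k")
    case True
    have "module_hom_between free_scale s' (P i) (h ` P i) h"
      using that(2) by (auto simp: module_hom_between_def)
    then show ?thesis
      using koszul_grade_image[OF free.module_axioms that(1) sub, of i _ h a k "k - j"] that(3) True
        koszul_grade_mono[OF gP, of "k - j" i] by (simp add: Suc_diff_le)
  qed (simp add: koszul_grade_def)
  \<comment> \<open>\<open>j\<close> counts steps from the left end. For \<open>j = 0\<close> the
    image is zero and has vanishing in all degrees; starting at \<open>Suc k\<close> leaves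
    \<open>k - n\<close> for \<open>M\<close>. Truncated subtraction makes the claim empty once all
    degrees are used up.\<close>
  have "koszul_grade free_scale a k (d i ` P (Suc i)) (Suc k - j)" if "n = i + j" for i j
    using that
  proof (induction j arbitrary: i)
    case 0
    have "0 \<in> P (Suc i)" by (rule free.subspace_0[OF sub])
    then have "d i (free_scale 0 0) = free_scale 0 (d i 0)"
      using d[of i] unfolding module_hom_between_def by blast
    then have "d i ` P (Suc i) = {0}" using P0[of "Suc i"] 0 by simp
    then show ?case using koszul_exact_zero[OF free.module_axioms] unfolding koszul_grade_def by metis
  next
    case (Suc j)
    have "koszul_grade free_scale a k {x \<in> P (Suc i). d i x = 0} (Suc k - j)"
      unfolding ex using Suc by simp
    then show ?case using step[OF free.module_axioms d] by simp
  qed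
  then have "koszul_grade free_scale a k {x \<in> P 0. e x = 0} (Suc k - n)" by (simp add: ex0)
  then show ?thesis using step[OF s e(1)] e(2) by simp
qed


section \<open>Ideals\<close>

abbreviation ideal :: "'a::comm_ring_1 set \<Rightarrow> bool" where
  "ideal \<equiv> module.subspace (*)"

lemmas ideal_def = module.subspace_def[OF module_times]
lemmas ideal_0 = module.subspace_0[OF module_times]
lemmas ideal_add = module.subspace_add[OF module_times]
lemmas ideal_diff = module.subspace_diff[OF module_times]
lemmas ideal_sum = module.subspace_sum[OF module_times]
lemmas ideal_mult_left = module.subspace_scale[OF module_times]

lemma ideal_mult_right: "ideal J \<Longrightarrow> x \<in> J \<Longrightarrow> x * y \<in> J"
  using ideal_mult_left[of J x y] by (simp add: mult.commute)

lemma prime_ideal_power: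
  assumes "1 \<notin> M" "\<And>a b. a * b \<in> M \<Longrightarrow> a \<in> M \<or> b \<in> M" "x ^ k \<in> M"
  shows "x \<in> M"
  using assms(3) by (induction k) (use assms in auto)

text \<open>Zorn's lemma gives an ideal maximal among those disjoint from \<open>S\<close>. Elements
  outside it divide elements of \<open>S\<close> modulo it, and multiplying two such relations shows
  that it is prime. The last conclusion retains the maximality: after inverting \<open>S\<close>,
  everything outside \<open>M\<close> becomes invertible modulo \<open>M\<close>.\<close>

lemma exists_prime_ideal_avoiding:
  fixes I S :: "'a::comm_ring_1 set"
  assumes I: "ideal I" and S: "1 \<in> S" "\<And>x y. x \<in> S \<Longrightarrow> y \<in> S \<Longrightarrow> x * y \<in> S" and IS: "I \<inter> S = {}"
  obtains M where "ideal M" "I \<subseteq> M" "M \<inter> S = {}" "\<And>a b. a * b \<in> M \<Longrightarrow> a \<in> M \<or> b \<in> M"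
    "\<And>a. a \<notin> M \<Longrightarrow> \<exists>r. \<exists>s\<in>S. s - r * a \<in> M"
proof -
  define F where "F = {J. ideal J \<and> I \<subseteq> J \<and> J \<inter> S = {}}"
  have "\<exists>M\<in>F. \<forall>X\<in>F. M \<subseteq> X \<longrightarrow> X = M"
  proof (rule subset_Zorn_nonempty)
    show "F \<noteq> {}" using I IS by (auto simp: F_def)
    fix C assume C: "C \<noteq> {}" "subset.chain F C"
    then have CF: "\<And>J. J \<in> C \<Longrightarrow> ideal J \<and> I \<subseteq> J \<and> J \<inter> S = {}"
      by (auto simp: F_def subset.chain_def)
    have lin: "J \<subseteq> L \<or> L \<subseteq> J" if "J \<in> C" "L \<in> C" for J L
      using subset_chain_def[THEN iffD1, OF C(2)] that by blast
    have "ideal (\<Union>C)" unfolding ideal_def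
    proof (intro conjI ballI allI)
      show "0 \<in> \<Union>C" using C(1) CF ideal_0 by blast
      show "x + y \<in> \<Union>C" if xy: "x \<in> \<Union>C" "y \<in> \<Union>C" for x y
      proof -
        from xy obtain J L where JL: "J \<in> C" "L \<in> C" "x \<in> J" "y \<in> L" by blast
        then obtain N where N: "N \<in> C" "x \<in> N" "y \<in> N" using lin[of J L] by blast
        then have "x + y \<in> N" using CF by (intro ideal_add) auto
        then show ?thesis using N by blast
      qed
      show "c * x \<in> \<Union>C" if "x \<in> \<Union>C" for c x
        using that CF ideal_mult_left by (metis UnionE UnionI)
    qed
    then show "\<Union>C \<in> F" using CF C(1) by (auto simp: F_def)
  qed
  then obtain M where M: "ideal M" "I \<subseteq> M" "M \<inter> S = {}" "\<And>X. X \<in> F \<Longrightarrow> M \<subseteq> X \<Longrightarrow> X = M"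
    by (auto simp: F_def)
  have ex: "\<exists>r. \<exists>s\<in>S. s - r * a \<in> M" if "a \<notin> M" for a
  proof -
    define J where "J = {m + r * a |m r. m \<in> M}"
    have "ideal J" unfolding ideal_def
    proof (intro conjI ballI allI)
      show "0 \<in> J" using ideal_0[OF M(1)] unfolding J_def by (auto intro!: exI[of _ 0])
      show "x + y \<in> J" if xy: "x \<in> J" "y \<in> J" for x y
      proof -
        from xy obtain m r m' r' where "x = m + r * a" "y = m' + r' * a" "m \<in> M" "m' \<in> M" by (auto simp: J_def)
        then have "x + y = (m + m') + (r + r') * a" "m + m' \<in> M" using M(1) by (auto simp: algebra_simps ideal_add)
        then show ?thesis unfolding J_def by blast
      qed
      show "c * x \<in> J" if x: "x \<in> J" for c x
      proof -
        from x obtain m r where "x = m + r * a" "m \<in> M" by (auto simp: J_def)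
        then have "c * x = c * m + (c * r) * a" "c * m \<in> M" using M(1) by (auto simp: algebra_simps ideal_mult_left)
        then show ?thesis unfolding J_def by blast
      qed
    qed
    have MJ: "M \<subseteq> J"
    proof
      fix m assume "m \<in> M"
      then have "m = m + 0 * a \<and> m \<in> M" by simp
      then show "m \<in> J" unfolding J_def by blast
    qed
    have "a = 0 + 1 * a \<and> 0 \<in> M" using ideal_0[OF M(1)] by simp
    then have "a \<in> J" unfolding J_def by blast
    then have "J \<noteq> M" using that by blast
    then have "J \<notin> F" using M(4) MJ by blast
    then have "J \<inter> S \<noteq> {}" using \<open>ideal J\<close> MJ M(2) by (auto simp: F_def)
    then obtain m r where "m + r * a \<in> S" "m \<in> M" by (auto simp: J_def)
    then show ?thesis by (intro exI[of _ r] bexI[of _ "m + r * a"]) auto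
  qed
  have "a \<in> M \<or> b \<in> M" if ab: "a * b \<in> M" for a b
  proof (rule ccontr)
    assume "\<not> ?thesis"
    then obtain r s r' s' where rs: "s \<in> S" "s' \<in> S" "s - r * a \<in> M" "s' - r' * b \<in> M" using ex by metis
    have "(s - r * a) * s' + r * a * (s' - r' * b) + r * r' * (a * b) \<in> M"
      by (intro ideal_add M(1) ideal_mult_left[OF M(1) rs(4)] ideal_mult_right[OF M(1) rs(3)] ideal_mult_left[OF M(1) ab])
    also have "(s - r * a) * s' + r * a * (s' - r' * b) + r * r' * (a * b) = s * s'" by (simp add: algebra_simps)
    finally show False using S(2)[OF rs(1,2)] M(3) by blast
  qed
  then show thesis using that M ex by blast
qed


section \<open>Homomorphisms out of the polynomial ring\<close>

lemma Const_add: "Const (a + b) = Const a + Const b"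
  and Const_mult: "Const (a * b) = Const a * Const b"
  and Const_0 [simp]: "Const 0 = 0"
  and Const_1 [simp]: "Const 1 = 1"
  and Const_minus: "Const (- a) = - Const a"
  by (simp_all add: Const_def single_add mult_single single_uminus)

lemma Const_eq_0_iff [simp]: "Const c = 0 \<longleftrightarrow> c = 0"
  by (metis Const_0 Const_def inj_single injD)

text \<open>Only a ring homomorphism, as the target carries no fixed action of the constants;
  behaviour on constants is stated separately, as in \<open>alg_hom_eqI\<close>.\<close>

definition alg_hom :: "(('n::{finite,linorder}) mpoly \<Rightarrow> 'b::comm_ring_1) \<Rightarrow> bool" where
  "alg_hom \<phi> \<longleftrightarrow> (\<forall>p q. \<phi> (p + q) = \<phi> p + \<phi> q) \<and> (\<forall>p q. \<phi> (p * q) = \<phi> p * \<phi> q) \<and> \<phi> 1 = 1"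

lemma alg_hom_add: "alg_hom \<phi> \<Longrightarrow> \<phi> (p + q) = \<phi> p + \<phi> q"
  and alg_hom_mult: "alg_hom \<phi> \<Longrightarrow> \<phi> (p * q) = \<phi> p * \<phi> q"
  and alg_hom_1: "alg_hom \<phi> \<Longrightarrow> \<phi> 1 = 1"
  by (simp_all add: alg_hom_def)

lemma alg_hom_0: "alg_hom \<phi> \<Longrightarrow> \<phi> 0 = 0"
  using alg_hom_add[of \<phi> 0 0] by simp

lemma alg_hom_minus: "alg_hom \<phi> \<Longrightarrow> \<phi> (- p) = - \<phi> p"
  using alg_hom_add[of \<phi> p "- p"] by (simp add: alg_hom_0 eq_neg_iff_add_eq_0 add.commute)

lemma alg_hom_diff: "alg_hom \<phi> \<Longrightarrow> \<phi> (p - q) = \<phi> p - \<phi> q"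
  using alg_hom_add[of \<phi> p "- q"] by (simp add: alg_hom_minus)

lemma alg_hom_sum: "alg_hom \<phi> \<Longrightarrow> \<phi> (sum f A) = (\<Sum>x\<in>A. \<phi> (f x))"
  by (induction A rule: infinite_finite_induct) (simp_all add: alg_hom_0 alg_hom_add)

lemma alg_hom_prod: "alg_hom \<phi> \<Longrightarrow> \<phi> (prod f A) = (\<Prod>x\<in>A. \<phi> (f x))"
  by (induction A rule: infinite_finite_induct) (simp_all add: alg_hom_1 alg_hom_mult)

lemma alg_hom_power: "alg_hom \<phi> \<Longrightarrow> \<phi> (p ^ k) = \<phi> p ^ k"
  by (induction k) (simp_all add: alg_hom_1 alg_hom_mult)

lemma alg_hom_compose: "alg_hom \<phi> \<Longrightarrow> alg_hom \<psi> \<Longrightarrow> alg_hom (\<lambda>p. \<psi> (\<phi> p))"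
  by (simp add: alg_hom_def)

lemma sum_single_lookup: "(\<Sum>m\<in>Poly_Mapping.keys p. Poly_Mapping.single m (Poly_Mapping.lookup p m)) = p"
  by (rule poly_mapping_eqI)
    (simp add: lookup_sum lookup_single when_def in_keys_iff sum.delta' cong: sum.cong)

lemma sum_single_finite: "(\<Sum>i\<in>UNIV. Poly_Mapping.single i (Poly_Mapping.lookup m i)) = (m :: 'n::finite \<Rightarrow>\<^sub>0 nat)"
  by (rule poly_mapping_eqI) (simp add: lookup_sum lookup_single when_def)

lemma Var_power: "Var i ^ k = Poly_Mapping.single (Poly_Mapping.single i k) 1"
proof (induction k)
  case (Suc k)
  then show ?case by (simp add: Var_def mult_single flip: single_add)
qed simp

lemma prod_Var: "(\<Prod>i\<in>UNIV. Var i ^ Poly_Mapping.lookup m i) = Poly_Mapping.single (m :: 'n::finite \<Rightarrow>\<^sub>0 nat) (1::complex)"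
proof -
  have "(\<Prod>i\<in>I. Var i ^ Poly_Mapping.lookup m i) = Poly_Mapping.single (\<Sum>i\<in>I. Poly_Mapping.single i (Poly_Mapping.lookup m i)) (1::complex)" if "finite I" for I
    using that by (induction I) (simp_all add: Var_power mult_single)
  from this[of UNIV] show ?thesis by (simp add: sum_single_finite)
qed

lemma single_eq_monomial: "Poly_Mapping.single (m :: 'n::finite \<Rightarrow>\<^sub>0 nat) c = Const c * (\<Prod>i\<in>UNIV. Var i ^ Poly_Mapping.lookup m i)"
  by (simp add: prod_Var Const_def mult_single)

lemma mpoly_expansion:
  "p = (\<Sum>m\<in>Poly_Mapping.keys p. Const (Poly_Mapping.lookup p m) * (\<Prod>i\<in>UNIV. Var i ^ Poly_Mapping.lookup m (i::'n::finite)))"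
  by (simp add: sum_single_lookup flip: single_eq_monomial)

lemma mpoly_induct [case_names Const Var add mult]:
  fixes p :: "('n::{finite,linorder}) mpoly"
  assumes C: "\<And>c. P (Const c)" and V: "\<And>i. P (Var i)"
    and A: "\<And>p q. P p \<Longrightarrow> P q \<Longrightarrow> P (p + q)" and M: "\<And>p q. P p \<Longrightarrow> P q \<Longrightarrow> P (p * q)"
  shows "P p"
proof -
  have 0: "P 0" and 1: "P 1" using C[of 0] C[of 1] by simp_all
  have S: "P (sum f A)" if "\<And>x. x \<in> A \<Longrightarrow> P (f x)" for f and A :: "('n \<Rightarrow>\<^sub>0 nat) set"
    using that by (induction A rule: infinite_finite_induct) (simp_all add: 0 A)
  have R: "P (prod f A)" if "\<And>x. x \<in> A \<Longrightarrow> P (f x)" for f and A :: "'n set"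
    using that by (induction A rule: infinite_finite_induct) (simp_all add: 1 M)
  have W: "P (Var i ^ k)" for i k by (induction k) (simp_all add: 1 M V)
  show ?thesis by (subst mpoly_expansion) (intro S M C R W)
qed

lemma alg_hom_eqI:
  assumes "alg_hom \<phi>" "alg_hom \<psi>" "\<And>c. \<phi> (Const c) = \<psi> (Const c)" "\<And>i. \<phi> (Var i) = \<psi> (Var i)"
  shows "\<phi> p = \<psi> p"
  by (induction p rule: mpoly_induct) (use assms in \<open>simp_all add: alg_hom_add alg_hom_mult\<close>)

definition scalar_hom :: "(complex \<Rightarrow> 'b::comm_ring_1) \<Rightarrow> bool" where
  "scalar_hom c \<longleftrightarrow> (\<forall>x y. c (x + y) = c x + c y) \<and> (\<forall>x y. c (x * y) = c x * c y) \<and> c 1 = 1"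

text \<open>The embedding \<open>c\<close> of the scalars is a parameter, so that one construction
  covers evaluation at a point, substitution of polynomials for variables, and the passage to
  univariate polynomials over the polynomial ring.\<close>

definition subst_hom :: "(complex \<Rightarrow> 'b::comm_ring_1) \<Rightarrow> ('n \<Rightarrow> 'b) \<Rightarrow> ('n::{finite,linorder}) mpoly \<Rightarrow> 'b" where
  "subst_hom c v p = (\<Sum>m\<in>Poly_Mapping.keys p. c (Poly_Mapping.lookup p m) * (\<Prod>i\<in>UNIV. v i ^ Poly_Mapping.lookup m i))"

context
  fixes c :: "complex \<Rightarrow> 'b::comm_ring_1" and v :: "'n::{finite,linorder} \<Rightarrow> 'b"
  assumes c: "scalar_hom c"
begin

lemma scalar_hom_0: "c 0 = 0"
  using c by (metis add_cancel_right_right scalar_hom_def)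

lemma subst_hom_single: "subst_hom c v (Poly_Mapping.single m a) = c a * (\<Prod>i\<in>UNIV. v i ^ Poly_Mapping.lookup m i)"
  by (cases "a = 0") (simp_all add: subst_hom_def scalar_hom_0)

lemma subst_hom_superset:
  assumes "finite A" "Poly_Mapping.keys p \<subseteq> A"
  shows "subst_hom c v p = (\<Sum>m\<in>A. c (Poly_Mapping.lookup p m) * (\<Prod>i\<in>UNIV. v i ^ Poly_Mapping.lookup m i))"
  unfolding subst_hom_def using assms
  by (intro sum.mono_neutral_left) (auto simp: in_keys_iff scalar_hom_0)

lemma subst_hom_add: "subst_hom c v (p + q) = subst_hom c v p + subst_hom c v q"
proof -
  let ?A = "Poly_Mapping.keys p \<union> Poly_Mapping.keys q"
  have "Poly_Mapping.keys (p + q) \<subseteq> ?A" by (rule keys_add)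
  then show ?thesis using c
    by (simp add: subst_hom_superset[of ?A] lookup_add scalar_hom_def distrib_right sum.distrib)
qed

lemma subst_hom_sum: "subst_hom c v (sum f A) = (\<Sum>x\<in>A. subst_hom c v (f x))"
proof -
  have "subst_hom c v 0 = 0" by (simp add: subst_hom_def)
  then show ?thesis by (induction A rule: infinite_finite_induct) (simp_all add: subst_hom_add)
qed

lemma alg_hom_subst_hom: "alg_hom (subst_hom c v)"
  unfolding alg_hom_def
proof (intro conjI allI)
  fix p q :: "'n mpoly"
  let ?s = "\<lambda>p m. Poly_Mapping.single m (Poly_Mapping.lookup p m) :: 'n mpoly"
  have "p * q = (\<Sum>m\<in>Poly_Mapping.keys p. ?s p m) * (\<Sum>m\<in>Poly_Mapping.keys q. ?s q m)"
    by (simp add: sum_single_lookup)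
  also have "\<dots> = (\<Sum>m\<in>Poly_Mapping.keys p. \<Sum>m'\<in>Poly_Mapping.keys q.
      Poly_Mapping.single (m + m') (Poly_Mapping.lookup p m * Poly_Mapping.lookup q m'))"
    by (simp add: sum_product mult_single)
  finally have "subst_hom c v (p * q) = (\<Sum>m\<in>Poly_Mapping.keys p. \<Sum>m'\<in>Poly_Mapping.keys q.
      subst_hom c v (Poly_Mapping.single (m + m') (Poly_Mapping.lookup p m * Poly_Mapping.lookup q m')))"
    by (simp add: subst_hom_sum)
  also have "\<dots> = (\<Sum>m\<in>Poly_Mapping.keys p. \<Sum>m'\<in>Poly_Mapping.keys q.
      (c (Poly_Mapping.lookup p m) * (\<Prod>i\<in>UNIV. v i ^ Poly_Mapping.lookup m i)) *
      (c (Poly_Mapping.lookup q m') * (\<Prod>i\<in>UNIV. v i ^ Poly_Mapping.lookup m' i)))"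
    using c by (intro sum.cong refl)
      (simp add: subst_hom_single scalar_hom_def lookup_add power_add prod.distrib ac_simps)
  also have "\<dots> = subst_hom c v p * subst_hom c v q" by (simp add: subst_hom_def sum_product)
  finally show "subst_hom c v (p * q) = subst_hom c v p * subst_hom c v q" .
next
  have "subst_hom c v (Poly_Mapping.single 0 1) = 1"
    unfolding subst_hom_single using c by (simp add: scalar_hom_def)
  then show "subst_hom c v 1 = 1" by simp
qed (rule subst_hom_add)

lemma subst_hom_Const: "subst_hom c v (Const a) = c a"
  by (simp add: Const_def subst_hom_single)

lemma subst_hom_Var: "subst_hom c v (Var i) = v i"
proof -
  have "(\<Prod>j\<in>UNIV. v j ^ Poly_Mapping.lookup (Poly_Mapping.single i 1) j) = (\<Prod>j\<in>UNIV. if j = i then v i else 1)"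
    by (intro prod.cong) (auto simp: lookup_single when_def)
  then show ?thesis using c by (simp add: Var_def subst_hom_single scalar_hom_def)
qed

end

lemma scalar_hom_id: "scalar_hom (\<lambda>c. c)"
  and scalar_hom_Const: "scalar_hom (Const :: complex \<Rightarrow> ('n::{finite,linorder}) mpoly)"
  by (simp_all add: scalar_hom_def Const_add Const_mult)

lemma poly_eval_eq_subst_hom: "poly_eval p x = subst_hom (\<lambda>c. c) (($) x) p"
  by (simp add: poly_eval_def subst_hom_def)

lemma alg_hom_poly_eval: "alg_hom (\<lambda>p. poly_eval p x)"
  unfolding poly_eval_eq_subst_hom by (rule alg_hom_subst_hom[OF scalar_hom_id])

lemma poly_eval_Const [simp]: "poly_eval (Const c) (x :: ('n::{finite,linorder}) cvec) = c"
  and poly_eval_Var [simp]: "poly_eval (Var i) (x :: ('n::{finite,linorder}) cvec) = x $ i"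
  by (simp_all add: poly_eval_eq_subst_hom subst_hom_Const subst_hom_Var scalar_hom_id)

lemmas poly_eval_add = alg_hom_add[OF alg_hom_poly_eval]
  and poly_eval_mult = alg_hom_mult[OF alg_hom_poly_eval]


section \<open>The Nullstellensatz\<close>

lemma Const_diff: "Const (a - b) = Const a - Const b"
  using Const_add[of a "- b"] by (simp add: Const_minus)

definition coeff_hom :: "('a::comm_ring_1 \<Rightarrow> 'b::comm_ring_1) \<Rightarrow> bool" where
  "coeff_hom f \<longleftrightarrow> (\<forall>x y. f (x + y) = f x + f y) \<and> (\<forall>x y. f (x * y) = f x * f y) \<and> f 1 = 1"

lemma coeff_hom_0: "coeff_hom f \<Longrightarrow> f 0 = 0"
  by (metis add_cancel_right_right coeff_hom_def)

lemma coeff_hom_sum: "coeff_hom f \<Longrightarrow> f (sum g A) = (\<Sum>x\<in>A. f (g x))"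
  by (induction A rule: infinite_finite_induct) (simp_all add: coeff_hom_0 coeff_hom_def)

lemma map_poly_hom:
  assumes "coeff_hom f"
  shows "map_poly f (p + q) = map_poly f p + map_poly f q"
    and "map_poly f (p * q) = map_poly f p * map_poly f q"
    and "map_poly f 1 = 1"
    and "map_poly f [:a, b:] = [:f a, f b:]"
    and "map_poly f [:a:] = [:f a:]"
  using assms
  by (auto intro!: poly_eqI simp: coeff_map_poly coeff_hom_0 coeff_mult coeff_hom_sum coeff_pCons
      split: nat.splits) (simp_all add: coeff_hom_def)

section \<open>Points from the uncountability of the complex numbers\<close>

lemma countable_exponents: "countable (UNIV :: ('n::finite \<Rightarrow>\<^sub>0 nat) set)"
proof -
  have "inj (Poly_Mapping.lookup :: ('n \<Rightarrow>\<^sub>0 nat) \<Rightarrow> 'n \<Rightarrow> nat)" by (auto intro: injI poly_mapping_eqI)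
  then show ?thesis by (rule countable_image_inj_on[rotated]) (rule countableI_type)
qed

interpretation mpoly_space: vector_space "\<lambda>c p. Const c * (p :: ('n::{finite,linorder}) mpoly)"
  by unfold_locales (simp_all add: algebra_simps Const_add Const_mult)

lemma span_monomials:
  assumes "Poly_Mapping.keys p \<subseteq> A"
  shows "p \<in> mpoly_space.span ((\<lambda>m. Poly_Mapping.single m 1) ` A)"
proof -
  have "(\<Sum>m\<in>Poly_Mapping.keys p. Const (Poly_Mapping.lookup p m) * Poly_Mapping.single m 1) = p"
    by (simp add: Const_def mult_single sum_single_lookup)
  moreover have "(\<Sum>m\<in>Poly_Mapping.keys p. Const (Poly_Mapping.lookup p m) * Poly_Mapping.single m 1)
      \<in> mpoly_space.span ((\<lambda>m. Poly_Mapping.single m 1) ` A)"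
    using assms by (intro mpoly_space.span_sum mpoly_space.span_scale mpoly_space.span_base) auto
  ultimately show ?thesis by simp
qed

text \<open>The exponent \<open>k c\<close> and the length \<open>N c\<close> of an initial segment
  of monomials supporting \<open>u c\<close> take only countably many values together, so some
  infinite class shares both. Inside it, infinitely many distinct polynomials lie in one
  finite-dimensional space. The shared exponent \<open>k0\<close> later provides a common
  denominator.\<close>

lemma uncountable_family_dependent:
  fixes u :: "complex \<Rightarrow> ('n::{finite,linorder}) mpoly" and k :: "complex \<Rightarrow> nat"
  assumes inj: "\<And>c c'. k c = k c' \<Longrightarrow> u c = u c' \<Longrightarrow> c = c'"
  obtains T \<beta> k0 c0 where "finite T" "\<And>c. c \<in> T \<Longrightarrow> k c = k0" "(\<Sum>c\<in>T. Const (\<beta> c) * u c) = 0"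
    "c0 \<in> T" "\<beta> c0 \<noteq> 0"
proof -
  define e :: "nat \<Rightarrow> 'n \<Rightarrow>\<^sub>0 nat" where "e = from_nat_into UNIV"
  have e: "range e = UNIV" using range_from_nat_into[OF _ countable_exponents] by (auto simp: e_def)
  have "\<exists>N. Poly_Mapping.keys (u c) \<subseteq> e ` {..<N}" for c
  proof -
    have "Poly_Mapping.keys (u c) \<subseteq> e ` UNIV" using e by simp
    then obtain I where I: "finite I" "Poly_Mapping.keys (u c) = e ` I"
      by (metis finite_keys finite_subset_image)
    then obtain N where "I \<subseteq> {..<N}" using finite_nat_set_iff_bounded by (meson lessThan_iff subsetI)
    then show ?thesis using I by blast
  qed
  then obtain N where N: "\<And>c. Poly_Mapping.keys (u c) \<subseteq> e ` {..<N c}" by metis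
  define X where "X = (\<lambda>(k0, n). {c. k c = k0 \<and> N c = n})"
  have "(UNIV :: complex set) = (\<Union>z. X z)" by (auto simp: X_def)
  then have "\<not> countable (\<Union>z. X z)" using uncountable_UNIV_complex by simp
  then obtain z where "infinite (X z)"
    using countable_UN[of UNIV X] countable_finite by (metis countableI_type)
  then obtain k0 n where inf: "infinite (X (k0, n))" by (cases z) auto
  then obtain T where T: "T \<subseteq> X (k0, n)" "finite T" "card T = Suc n"
    using infinite_arbitrarily_large by blast
  have kT: "k c = k0" "N c = n" if "c \<in> T" for c using T(1) that by (auto simp: X_def)
  have injT: "inj_on u T" using inj kT by (intro inj_onI) auto
  let ?B = "(\<lambda>m. Poly_Mapping.single m 1 :: 'n mpoly) ` e ` {..<n}"
  have "u ` T \<subseteq> mpoly_space.span ?B"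
  proof (rule image_subsetI)
    fix c assume "c \<in> T"
    then show "u c \<in> mpoly_space.span ?B" using N[of c] kT(2) by (intro span_monomials) simp
  qed
  moreover have "card ?B \<le> n"
    using card_image_le[of "{..<n}" "\<lambda>j. Poly_Mapping.single (e j) 1 :: 'n mpoly"] by (simp add: image_image)
  moreover have "card (u ` T) = Suc n" using injT T by (simp add: card_image)
  moreover have "finite ?B" by simp
  ultimately have "mpoly_space.dependent (u ` T)"
    using mpoly_space.independent_span_bound[of ?B "u ` T"] by linarith
  then obtain \<gamma> where \<gamma>: "\<exists>v\<in>u ` T. \<gamma> v \<noteq> 0" "(\<Sum>v\<in>u ` T. Const (\<gamma> v) * v) = 0"
    using T(2) by (auto simp: mpoly_space.dependent_finite)
  have "(\<Sum>c\<in>T. Const (\<gamma> (u c)) * u c) = 0" using \<gamma>(2) by (simp add: sum.reindex[OF injT])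
  then show thesis using that[of T k0 "\<lambda>c. \<gamma> (u c)"] T(2) kT \<gamma>(1) by blast
qed

text \<open>Over the complex numbers \<open>q\<close> splits into linear factors, and a prime ideal
  containing a product contains a factor; the constant factor is a unit.\<close>

lemma mem_prime_ideal_linear_factor:
  fixes M :: "('n::{finite,linorder}) mpoly set" and q :: "complex poly"
  assumes M: "ideal M" "1 \<notin> M" "\<And>a b. a * b \<in> M \<Longrightarrow> a \<in> M \<or> b \<in> M"
    and "q \<noteq> 0" "poly (map_poly Const q) y \<in> M"
  shows "\<exists>c. y - Const c \<in> M"
proof -
  have C: "coeff_hom (Const :: complex \<Rightarrow> 'n mpoly)" by (simp add: coeff_hom_def Const_add Const_mult)
  show ?thesis using assms(4,5)
  proof (induction "degree q" arbitrary: q)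
  case 0
  then obtain a where a: "q = [:a:]" by (metis degree_eq_zeroE)
  then have "a \<noteq> 0" using 0(2) by simp
  have "Const a \<in> M" using 0(3) unfolding a(1) map_poly_hom(5)[OF C] by simp
  then have "Const (1 / a) * Const a \<in> M" by (rule ideal_mult_left[OF M(1)])
  then show ?case using \<open>a \<noteq> 0\<close> M(2) by (simp flip: Const_mult)
next
  case (Suc n)
  then have "\<not> constant (poly q)" by (simp add: constant_degree)
  then obtain c where "poly q c = 0" using fundamental_theorem_of_algebra by blast
  then obtain r where r: "q = [:- c, 1:] * r" by (metis dvdE poly_eq_0_iff_dvd)
  have "poly (map_poly Const q) y = (y - Const c) * poly (map_poly Const r) y"
    unfolding r map_poly_hom(2)[OF C] map_poly_hom(4)[OF C] by (simp add: Const_minus algebra_simps)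
  then have "y - Const c \<in> M \<or> poly (map_poly Const r) y \<in> M" using M(3) Suc.prems by metis
  moreover have "degree r = n" "r \<noteq> 0"
  proof -
    show "r \<noteq> 0" using Suc.prems r by auto
    then show "degree r = n" using Suc.hyps(2) unfolding r by (subst (asm) degree_mult_eq) auto
  qed
  ultimately show ?case using Suc.hyps(1)[of r] by blast
  qed
qed

text \<open>Modulo \<open>M\<close> and with \<open>h\<close> inverted, every non-zero element is
  invertible. If \<open>y\<close> were congruent to no constant, the inverses of all
  \<open>y - Const c\<close> would be an uncountable family in a space of countable dimension. A
  linear relation between them makes \<open>y\<close> algebraic over the complex numbers, hence
  congruent to a constant after all.\<close>

lemma prime_ideal_avoiding_powers_point:
  fixes M :: "('n::{finite,linorder}) mpoly set"
  assumes M: "ideal M" "1 \<notin> M" "\<And>a b. a * b \<in> M \<Longrightarrow> a \<in> M \<or> b \<in> M" and "h \<notin> M"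
    and max: "\<And>a. a \<notin> M \<Longrightarrow> \<exists>r k. h ^ k - r * a \<in> M"
  shows "\<exists>c. y - Const c \<in> M"
proof (rule ccontr)
  assume no: "\<not> ?thesis"
  then have "\<exists>r k. h ^ k - r * (y - Const c) \<in> M" for c using max by blast
  \<comment> \<open>\<open>u c / h ^ k c\<close> represents the inverse of
    \<open>y - Const c\<close>.\<close>
  then obtain u k where uk: "\<And>c. h ^ k c - u c * (y - Const c) \<in> M" by metis
  have hM: "h ^ j \<notin> M" for j using prime_ideal_power[OF M(2,3)] \<open>h \<notin> M\<close> by blast
  \<comment> \<open>Equal inverses belong to equal elements, and the difference of two distinct
    constants is a unit.\<close>
  have "c = c'" if eq: "k c = k c'" "u c = u c'" for c c'
  proof (rule ccontr)
    assume "c \<noteq> c'"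
    have "(h ^ k c' - u c' * (y - Const c')) - (h ^ k c - u c * (y - Const c)) \<in> M"
      by (rule ideal_diff[OF M(1) uk uk])
    also have "(h ^ k c' - u c' * (y - Const c')) - (h ^ k c - u c * (y - Const c)) = u c * Const (c' - c)"
      by (simp add: eq algebra_simps Const_diff)
    finally have "u c \<in> M \<or> Const (c' - c) \<in> M" using M(3) by blast
    moreover have "Const (c' - c) \<notin> M"
    proof
      assume "Const (c' - c) \<in> M"
      then have "Const (1 / (c' - c)) * Const (c' - c) \<in> M" by (rule ideal_mult_left[OF M(1)])
      then show False using \<open>c \<noteq> c'\<close> M(2) by (simp flip: Const_mult)
    qed
    ultimately have "u c * (y - Const c) \<in> M" using ideal_mult_right[OF M(1)] by blast
    then have "(h ^ k c - u c * (y - Const c)) + u c * (y - Const c) \<in> M" using uk ideal_add[OF M(1)] by blast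
    then show False using hM by simp
  qed
  note dep = this
  obtain T \<beta> k0 c0 where T: "finite T" "\<And>c. c \<in> T \<Longrightarrow> k c = k0" "(\<Sum>c\<in>T. Const (\<beta> c) * u c) = 0"
    and c0: "c0 \<in> T" "\<beta> c0 \<noteq> 0"
    by (rule uncountable_family_dependent[of k u, OF dep]) (auto intro: that)
  \<comment> \<open>The numerator of the sum of all \<open>\<beta> c / (y - c)\<close> over a common
    denominator. At \<open>c0\<close> every other summand contains the factor
    \<open>c0 - c0\<close>, so \<open>q\<close> is not zero.\<close>
  define q where "q = (\<Sum>c\<in>T. [:\<beta> c:] * (\<Prod>c'\<in>T - {c}. [:- c', 1:]))"
  have "poly q c0 = (\<Sum>c\<in>T. \<beta> c * (\<Prod>c'\<in>T - {c}. c0 - c'))"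
    by (simp add: q_def poly_sum poly_prod)
  also have "\<dots> = (\<Sum>c\<in>{c0}. \<beta> c * (\<Prod>c'\<in>T - {c}. c0 - c'))"
    using T(1) c0(1) by (intro sum.mono_neutral_right) (auto intro!: prod_zero bexI[of _ c0])
  also have "\<dots> \<noteq> 0" using T(1) c0(2) by auto
  finally have "q \<noteq> 0" by auto
  have C: "coeff_hom (Const :: complex \<Rightarrow> 'n mpoly)" by (simp add: coeff_hom_def Const_add Const_mult)
  have mp: "map_poly (Const :: complex \<Rightarrow> 'n mpoly) (\<Prod>x\<in>A. f x) = (\<Prod>x\<in>A. map_poly Const (f x))" for f :: "complex \<Rightarrow> complex poly" and A
    by (induction A rule: infinite_finite_induct) (simp_all add: map_poly_hom[OF C])
  have ms: "map_poly (Const :: complex \<Rightarrow> 'n mpoly) (\<Sum>x\<in>A. f x) = (\<Sum>x\<in>A. map_poly Const (f x))" for f :: "complex \<Rightarrow> complex poly" and A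
    by (induction A rule: infinite_finite_induct) (simp_all add: map_poly_hom[OF C])
  define L where "L = (\<lambda>c. Const (\<beta> c) * (\<Prod>c'\<in>T - {c}. y - Const c'))"
  have evq: "poly (map_poly Const q) y = (\<Sum>c\<in>T. L c)"
    unfolding q_def ms map_poly_hom(2)[OF C] mp map_poly_hom(4,5)[OF C]
    by (simp add: L_def poly_sum poly_prod Const_minus)
  \<comment> \<open>In this combination of the congruences for the inverses, the relation between
    the \<open>u c\<close> removes everything but \<open>h ^ k0\<close> times the value of
    \<open>q\<close> at \<open>y\<close>.\<close>
  have "(\<Sum>c\<in>T. L c * (h ^ k c - u c * (y - Const c))) \<in> M"
    by (intro ideal_sum[OF M(1)] ideal_mult_left[OF M(1)] uk)
  also have "(\<Sum>c\<in>T. L c * (h ^ k c - u c * (y - Const c))) =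
      (\<Sum>c\<in>T. h ^ k0 * L c - (\<Prod>c'\<in>T. y - Const c') * (Const (\<beta> c) * u c))"
  proof (rule sum.cong[OF refl])
    fix c assume c: "c \<in> T"
    have eq: "(\<Prod>c'\<in>T. y - Const c') = (y - Const c) * (\<Prod>c'\<in>T - {c}. y - Const c')"
      by (rule prod.remove[OF T(1) c])
    show "L c * (h ^ k c - u c * (y - Const c)) = h ^ k0 * L c - (\<Prod>c'\<in>T. y - Const c') * (Const (\<beta> c) * u c)"
      unfolding eq L_def T(2)[OF c] by (simp add: algebra_simps)
  qed
  also have "\<dots> = h ^ k0 * (\<Sum>c\<in>T. L c)"
    unfolding sum_subtractf sum_distrib_left[symmetric] T(3) by simp
  finally have "poly (map_poly Const q) y \<in> M" using M(3) hM evq by metis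
  then show False using mem_prime_ideal_linear_factor[OF M \<open>q \<noteq> 0\<close>] no by blast
qed

text \<open>Modulo an ideal maximal among those avoiding the powers of \<open>h\<close>, the
  variables are congruent to constants, so every polynomial is congruent to its value at one point.
  Avoiding these powers takes the place of Rabinowitsch's additional variable and keeps the
  polynomial ring fixed.\<close>

theorem nullstellensatz:
  fixes K :: "('n::{finite,linorder}) mpoly set"
  assumes K: "ideal K" and h: "\<And>k. h ^ k \<notin> K"
  obtains x where "x \<in> zero_locus K" "poly_eval h x \<noteq> 0"
proof -
  let ?S = "range (\<lambda>j. h ^ j)"
  obtain M where M: "ideal M" "K \<subseteq> M" "M \<inter> ?S = {}" "\<And>a b. a * b \<in> M \<Longrightarrow> a \<in> M \<or> b \<in> M"
    and max: "\<And>a. a \<notin> M \<Longrightarrow> \<exists>r. \<exists>s\<in>?S. s - r * a \<in> M"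
  proof (rule exists_prime_ideal_avoiding[OF K, of ?S])
    show "1 \<in> ?S" by (rule range_eqI[of _ _ 0]) simp
    show "x * y \<in> ?S" if "x \<in> ?S" "y \<in> ?S" for x y using that by (auto simp flip: power_add)
    show "K \<inter> ?S = {}" using h by auto
  qed blast
  have hM: "h ^ k \<notin> M" for k using M(3) by auto
  have M1: "1 \<notin> M" using hM[of 0] by simp
  have "\<exists>c. Var i - Const c \<in> M" for i
    using max hM[of 1] by (intro prime_ideal_avoiding_powers_point[OF M(1) M1 M(4), of h]) auto
  then obtain c where c: "\<And>i. Var i - Const (c i) \<in> M" by metis
  define x where "x = (\<chi> i. c i)"
  have p: "p - Const (poly_eval p x) \<in> M" for p
  proof (induction p rule: mpoly_induct)
    case (Const a)
    then show ?case using ideal_0[OF M(1)] by simp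
  next
    case (Var i)
    then show ?case using c by (simp add: x_def)
  next
    case (add p q)
    then have "(p - Const (poly_eval p x)) + (q - Const (poly_eval q x)) \<in> M" by (rule ideal_add[OF M(1)])
    then show ?case by (simp add: poly_eval_add Const_add algebra_simps)
  next
    case (mult p q)
    then have "(p - Const (poly_eval p x)) * q + Const (poly_eval p x) * (q - Const (poly_eval q x)) \<in> M"
      by (intro ideal_add[OF M(1)] ideal_mult_left[OF M(1)] ideal_mult_right[OF M(1)])
    then show ?case by (simp add: poly_eval_mult Const_mult algebra_simps)
  qed
  have C: "a = 0" if "Const a \<in> M" for a
  proof (rule ccontr)
    assume "a \<noteq> 0"
    have "Const (1 / a) * Const a \<in> M" by (rule ideal_mult_left[OF M(1) that])
    then show False using \<open>a \<noteq> 0\<close> M1 by (simp flip: Const_mult)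
  qed
  have "poly_eval g x = 0" if "g \<in> K" for g
    using ideal_diff[OF M(1) _ p[of g], of g] that M(2) by (intro C) auto
  moreover have "poly_eval h x \<noteq> 0" using p[of h] hM[of 1] by auto
  ultimately show thesis using that by (auto simp: zero_locus_def)
qed

lemma nonzero_poly_eval:
  assumes "(p :: ('n::{finite,linorder}) mpoly) \<noteq> 0"
  obtains x where "poly_eval p x \<noteq> 0"
  by (rule nullstellensatz[of "{0}" p]) (use assms in \<open>auto simp: ideal_def\<close>)


section \<open>Noether normalisation\<close>

definition restr :: "'n set \<Rightarrow> ('n::{finite,linorder}) mpoly \<Rightarrow> 'n mpoly" where
  "restr S = subst_hom Const (\<lambda>i. if i \<in> S then Var i else 0)"

text \<open>Stated as a fixed point of killing the other variables, rather than through exponents,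
  so that closure under ring operations and coordinate changes becomes an identity between
  homomorphisms.\<close>

definition in_vars :: "'n set \<Rightarrow> ('n::{finite,linorder}) mpoly \<Rightarrow> bool" where
  "in_vars S p \<longleftrightarrow> restr S p = p"

lemma alg_hom_restr: "alg_hom (restr S)"
  unfolding restr_def by (rule alg_hom_subst_hom[OF scalar_hom_Const])

lemma restr_Const [simp]: "restr S (Const c) = Const c"
  and restr_Var [simp]: "restr S (Var i) = (if i \<in> S then Var i else 0)"
  by (simp_all add: restr_def subst_hom_Const subst_hom_Var scalar_hom_Const)

lemma alg_hom_id: "alg_hom (\<lambda>p. p)"
  by (simp add: alg_hom_def)

lemma restr_UNIV [simp]: "restr UNIV p = p"
  by (rule alg_hom_eqI[OF alg_hom_restr alg_hom_id]) simp_all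

lemma restr_restr:
  assumes "S \<subseteq> U" shows "restr U (restr S p) = restr S p"
  by (rule alg_hom_eqI[OF alg_hom_compose[OF alg_hom_restr alg_hom_restr] alg_hom_restr])
    (use assms in \<open>auto simp: alg_hom_0[OF alg_hom_restr]\<close>)

lemma in_vars_mono: "in_vars S p \<Longrightarrow> S \<subseteq> U \<Longrightarrow> in_vars U p"
  by (metis in_vars_def restr_restr)

lemma in_vars_UNIV [simp]: "in_vars UNIV p"
  by (simp add: in_vars_def)

lemma in_vars_Const: "in_vars S (Const c)"
  and in_vars_Var: "i \<in> S \<Longrightarrow> in_vars S (Var i)"
  and in_vars_add: "in_vars S p \<Longrightarrow> in_vars S q \<Longrightarrow> in_vars S (p + q)"
  and in_vars_mult: "in_vars S p \<Longrightarrow> in_vars S q \<Longrightarrow> in_vars S (p * q)"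
  by (simp_all add: in_vars_def alg_hom_add[OF alg_hom_restr] alg_hom_mult[OF alg_hom_restr])

lemma in_vars_empty:
  assumes "in_vars {} p" obtains c where "p = Const c"
proof -
  have h: "alg_hom (subst_hom (\<lambda>c. c) (\<lambda>i::'a. 0 :: complex))"
    by (rule alg_hom_subst_hom[OF scalar_hom_id])
  have "alg_hom (\<lambda>p. Const (subst_hom (\<lambda>c. c) (\<lambda>i::'a. 0) p) :: 'a mpoly)"
    by (simp add: alg_hom_def alg_hom_add[OF h] alg_hom_mult[OF h] alg_hom_1[OF h] Const_add Const_mult)
  then have "restr {} p = Const (subst_hom (\<lambda>c. c) (\<lambda>i. 0) p)"
    by (rule alg_hom_eqI[OF alg_hom_restr]) (simp_all add: subst_hom_Const subst_hom_Var scalar_hom_id)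
  then show thesis using assms that by (metis in_vars_def)
qed

lemma keys_in_vars:
  assumes "in_vars S p" "m \<in> Poly_Mapping.keys p" "i \<notin> S"
  shows "Poly_Mapping.lookup m i = 0"
proof (rule ccontr)
  assume nz: "Poly_Mapping.lookup m i \<noteq> 0"
  have "p = (\<Sum>m'\<in>Poly_Mapping.keys p. Const (Poly_Mapping.lookup p m') * (\<Prod>j\<in>UNIV. (if j \<in> S then Var j else 0) ^ Poly_Mapping.lookup m' j))"
    using assms(1) by (simp add: in_vars_def restr_def subst_hom_def)
  then have "Poly_Mapping.lookup p m = (\<Sum>m'\<in>Poly_Mapping.keys p. Poly_Mapping.lookup (Const (Poly_Mapping.lookup p m') * (\<Prod>j\<in>UNIV. (if j \<in> S then Var j else 0) ^ Poly_Mapping.lookup m' j)) m)"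
    by (metis (no_types, lifting) lookup_sum sum.cong)
  also have "\<dots> = 0"
  proof (rule sum.neutral, intro ballI)
    fix m' assume "m' \<in> Poly_Mapping.keys p"
    show "Poly_Mapping.lookup (Const (Poly_Mapping.lookup p m') * (\<Prod>j\<in>UNIV. (if j \<in> S then Var j else 0) ^ Poly_Mapping.lookup m' j)) m = 0"
    proof (cases "\<exists>j. j \<notin> S \<and> Poly_Mapping.lookup m' j \<noteq> 0")
      case True
      then have *: "(\<Prod>j\<in>UNIV. (if j \<in> S then Var j else 0) ^ Poly_Mapping.lookup m' j) = (0 :: 'a mpoly)"
        by (intro prod_zero) auto
      show ?thesis unfolding * by simp
    next
      case False
      then have "(\<Prod>j\<in>UNIV. (if j \<in> S then Var j else 0) ^ Poly_Mapping.lookup m' j) = (\<Prod>j\<in>UNIV. Var j ^ Poly_Mapping.lookup m' j :: 'a mpoly)"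
        by (intro prod.cong) auto
      moreover have "m' \<noteq> m" using False nz assms(3) by auto
      ultimately show ?thesis by (simp add: prod_Var Const_def mult_single lookup_single_not_eq)
    qed
  qed
  finally show False using assms(2) by (simp add: in_keys_iff)
qed

section \<open>Polynomials as univariate in one variable\<close>

definition upoly :: "'n \<Rightarrow> ('n::{finite,linorder}) mpoly \<Rightarrow> 'n mpoly poly" where
  "upoly z = subst_hom (\<lambda>c. [:Const c:]) (\<lambda>i. if i = z then [:0, 1:] else [:Var i:])"

lemma scalar_hom_const_poly: "scalar_hom (\<lambda>c. [:Const c :: ('n::{finite,linorder}) mpoly:])"
  by (simp add: scalar_hom_def Const_add Const_mult)

lemma alg_hom_upoly: "alg_hom (upoly z)"
  unfolding upoly_def by (rule alg_hom_subst_hom[OF scalar_hom_const_poly])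

lemma upoly_Const [simp]: "upoly z (Const c) = [:Const c:]"
  and upoly_Var: "upoly z (Var i) = (if i = z then [:0, 1:] else [:Var i:])"
  by (simp_all add: upoly_def subst_hom_Const subst_hom_Var scalar_hom_const_poly)

lemma poly_upoly: "poly (upoly z p) (Var z) = p"
proof (rule alg_hom_eqI[OF _ alg_hom_id])
  show "alg_hom (\<lambda>p. poly (upoly z p) (Var z))"
    by (simp add: alg_hom_def alg_hom_add[OF alg_hom_upoly] alg_hom_mult[OF alg_hom_upoly] alg_hom_1[OF alg_hom_upoly])
qed (simp_all add: upoly_Var)

lemma upoly_in_vars:
  assumes "in_vars S p" "z \<notin> S"
  shows "upoly z p = [:p:]"
proof -
  have "alg_hom (\<lambda>q. [:restr S q:])"
    by (simp add: alg_hom_def alg_hom_add[OF alg_hom_restr] alg_hom_mult[OF alg_hom_restr] alg_hom_1[OF alg_hom_restr])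
  then have "upoly z (restr S p) = [:restr S p:]"
    by (rule alg_hom_eqI[OF alg_hom_compose[OF alg_hom_restr alg_hom_upoly]])
      (use assms(2) in \<open>auto simp: upoly_Var alg_hom_0[OF alg_hom_upoly]\<close>)
  then show ?thesis using assms(1) by (simp add: in_vars_def)
qed

text \<open>Generators free of \<open>z\<close> are constants for \<open>upoly z\<close>, so
  membership in their ideal is decided coefficient by coefficient. Coefficients are kept in the full
  polynomial ring, which lets both sides refer to the same ideal.\<close>

lemma span_coeff_iff:
  fixes G :: "('n::{finite,linorder}) mpoly set"
  assumes G: "\<And>g. g \<in> G \<Longrightarrow> in_vars (- {z}) g"
  shows "h \<in> module.span (*) G \<longleftrightarrow> (\<forall>k. coeff (upoly z h) k \<in> module.span (*) G)"
proof -
  interpret module "(*) :: 'n mpoly \<Rightarrow> _ \<Rightarrow> _" by (rule module_times)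
  show ?thesis
  proof
    assume "h \<in> span G"
    then show "\<forall>k. coeff (upoly z h) k \<in> span G"
    proof (induction rule: span_induct_alt)
      case base
      show ?case by (simp add: alg_hom_0[OF alg_hom_upoly] span_zero)
    next
      case (step c x y)
      have "upoly z (c * x + y) = upoly z c * [:x:] + upoly z y"
        using upoly_in_vars[OF G[OF step(1)]]
        by (simp add: alg_hom_add[OF alg_hom_upoly] alg_hom_mult[OF alg_hom_upoly])
      moreover have "coeff (upoly z c) k * x \<in> span G" for k using step(1) by (intro span_scale span_base)
      ultimately show ?case using step(2) by (auto simp: mult.commute[of _ "[:x:]"] mult.commute[of x] intro!: span_add)
    qed
  next
    assume "\<forall>k. coeff (upoly z h) k \<in> span G"
    then have "(\<Sum>k\<le>degree (upoly z h). Var z ^ k * coeff (upoly z h) k) \<in> span G"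
      by (intro span_sum span_scale) auto
    then have "poly (upoly z h) (Var z) \<in> span G" by (simp add: poly_altdef mult.commute)
    then show "h \<in> span G" by (simp add: poly_upoly)
  qed
qed

text \<open>Let \<open>m\<close> be the highest index at which a coefficient of \<open>h\<close> is
  not in the ideal. With \<open>g\<close> monic of degree \<open>d\<close>, the coefficient of
  \<open>g * h\<close> at \<open>d + m\<close> is congruent to that coefficient, yet it lies in the
  ideal.\<close>

lemma monic_nonzerodivisor:
  fixes G :: "('n::{finite,linorder}) mpoly set"
  assumes G: "\<And>g. g \<in> G \<Longrightarrow> in_vars (- {z}) g" and g: "lead_coeff (upoly z g) = 1"
    and gh: "g * h \<in> module.span (*) G"
  shows "h \<in> module.span (*) G"
proof (rule ccontr)
  interpret module "(*) :: 'n mpoly \<Rightarrow> _ \<Rightarrow> _" by (rule module_times)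
  have iff: "x \<in> span G \<longleftrightarrow> (\<forall>k. coeff (upoly z x) k \<in> span G)" for x
    by (rule span_coeff_iff) (rule G)
  assume "h \<notin> span G"
  define K where "K = {k. coeff (upoly z h) k \<notin> span G}"
  have "K \<noteq> {}" using \<open>h \<notin> span G\<close> iff[of h] unfolding K_def by blast
  have "K \<subseteq> {..degree (upoly z h)}"
  proof
    fix k assume "k \<in> K"
    then have "coeff (upoly z h) k \<noteq> 0" using span_zero by (auto simp: K_def)
    then show "k \<in> {..degree (upoly z h)}" by (simp add: le_degree)
  qed
  then have "finite K" by (rule finite_subset) simp
  define m where "m = Max K"
  have m: "coeff (upoly z h) m \<notin> span G" using Max_in[OF \<open>finite K\<close> \<open>K \<noteq> {}\<close>] by (simp add: m_def K_def)
  have above: "coeff (upoly z h) k \<in> span G" if "k > m" for k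
    using Max_ge[OF \<open>finite K\<close>, of k] that by (force simp: m_def K_def)
  define d where "d = degree (upoly z g)"
  have "coeff (upoly z (g * h)) (d + m) = (\<Sum>i\<le>d + m. coeff (upoly z g) i * coeff (upoly z h) (d + m - i))"
    by (simp add: alg_hom_mult[OF alg_hom_upoly] coeff_mult)
  also have "\<dots> = coeff (upoly z h) m + (\<Sum>i\<in>{..d + m} - {d}. coeff (upoly z g) i * coeff (upoly z h) (d + m - i))"
    using g by (subst sum.remove[of _ d]) (auto simp: d_def)
  finally have "coeff (upoly z h) m = coeff (upoly z (g * h)) (d + m) - (\<Sum>i\<in>{..d + m} - {d}. coeff (upoly z g) i * coeff (upoly z h) (d + m - i))"
    by simp
  also have "\<dots> \<in> span G"
  proof (intro span_diff span_sum)
    show "coeff (upoly z (g * h)) (d + m) \<in> span G" using iff gh by blast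
    fix i assume i: "i \<in> {..d + m} - {d}"
    show "coeff (upoly z g) i * coeff (upoly z h) (d + m - i) \<in> span G"
    proof (cases "i < d")
      case True
      then show ?thesis by (intro span_scale above) auto
    next
      case False
      then have "coeff (upoly z g) i = 0" using i by (intro coeff_eq_0) (auto simp: d_def)
      then show ?thesis by (simp add: span_zero)
    qed
  qed
  finally show False using m by simp
qed

section \<open>Coordinate changes affecting only some variables\<close>

definition coord_change :: "'n set \<Rightarrow> (('n::{finite,linorder}) mpoly \<Rightarrow> 'n mpoly) \<Rightarrow> bool" where
  "coord_change S \<sigma> \<longleftrightarrow> alg_hom \<sigma> \<and> bij \<sigma> \<and> (\<forall>c. \<sigma> (Const c) = Const c) \<and>
     (\<forall>i. i \<notin> S \<longrightarrow> \<sigma> (Var i) = Var i) \<and> (\<forall>i\<in>S. in_vars S (\<sigma> (Var i)))"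

lemma coord_change_in_vars:
  assumes "coord_change S \<sigma>" "S \<subseteq> U" "in_vars U p"
  shows "in_vars U (\<sigma> p)"
proof -
  have h: "alg_hom \<sigma>" using assms(1) by (simp add: coord_change_def)
  have "restr U (\<sigma> (restr U p)) = \<sigma> (restr U p)"
  proof (rule alg_hom_eqI[OF alg_hom_compose[OF alg_hom_compose[OF alg_hom_restr h] alg_hom_restr] alg_hom_compose[OF alg_hom_restr h]])
    fix i show "restr U (\<sigma> (restr U (Var i))) = \<sigma> (restr U (Var i))"
    proof (cases "i \<in> S")
      case True
      then have "in_vars U (\<sigma> (Var i))"
        using assms(1) by (intro in_vars_mono[OF _ assms(2)]) (simp add: coord_change_def)
      then show ?thesis using True assms(2) by (auto simp: in_vars_def)
    next
      case False
      then show ?thesis using assms(1) by (auto simp: coord_change_def alg_hom_0[OF h] alg_hom_0[OF alg_hom_restr])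
    qed
  qed (use assms(1) in \<open>auto simp: coord_change_def\<close>)
  then show ?thesis using assms(3) by (simp add: in_vars_def)
qed

lemma coord_change_compose:
  assumes "coord_change S \<tau>" "coord_change U \<sigma>" "U \<subseteq> S"
  shows "coord_change S (\<lambda>p. \<sigma> (\<tau> p))"
proof -
  have "bij (\<lambda>p. \<sigma> (\<tau> p))" using assms bij_comp[of \<tau> \<sigma>] by (simp add: coord_change_def comp_def)
  moreover have "in_vars S (\<sigma> (\<tau> (Var i)))" if "i \<in> S" for i
    using coord_change_in_vars[OF assms(2,3)] assms(1) that by (auto simp: coord_change_def)
  ultimately show ?thesis using assms by (auto simp: coord_change_def alg_hom_compose)
qed

lemma upoly_coord_change:
  assumes "coord_change S \<sigma>" "z \<notin> S"
  shows "upoly z (\<sigma> p) = map_poly \<sigma> (upoly z p)"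
proof -
  have h: "alg_hom \<sigma>" using assms(1) by (simp add: coord_change_def)
  then have c: "coeff_hom \<sigma>" by (simp add: alg_hom_def coeff_hom_def)
  have "alg_hom (\<lambda>p. map_poly \<sigma> (upoly z p))"
    by (simp add: alg_hom_def alg_hom_add[OF alg_hom_upoly] alg_hom_mult[OF alg_hom_upoly] alg_hom_1[OF alg_hom_upoly] map_poly_hom(1-3)[OF c])
  then show ?thesis
  proof (rule alg_hom_eqI[OF alg_hom_compose[OF h alg_hom_upoly]])
    fix a show "upoly z (\<sigma> (Const a)) = map_poly \<sigma> (upoly z (Const a))"
      using assms(1) by (simp add: map_poly_hom(5)[OF c] coord_change_def)
  next
    fix i show "upoly z (\<sigma> (Var i)) = map_poly \<sigma> (upoly z (Var i))"
    proof (cases "i \<in> S")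
      case True
      then have "in_vars S (\<sigma> (Var i))" using assms(1) by (simp add: coord_change_def)
      then show ?thesis using True assms(2) upoly_in_vars by (auto simp: upoly_Var map_poly_hom(5)[OF c])
    next
      case False
      then have "\<sigma> (Var i) = Var i" using assms(1) by (simp add: coord_change_def)
      then show ?thesis
        by (auto simp: upoly_Var map_poly_hom(4,5)[OF c] alg_hom_0[OF h] alg_hom_1[OF h])
    qed
  qed
qed

text \<open>A change away from \<open>z\<close> acts on the coefficients with respect to
  \<open>z\<close> and fixes the leading 1. Polynomials made monic at one stage therefore survive
  the changes of all later stages.\<close>

lemma monic_coord_change:
  assumes "coord_change S \<sigma>" "z \<notin> S" "lead_coeff (upoly z p) = 1"
  shows "lead_coeff (upoly z (\<sigma> p)) = 1"
proof -
  have h: "alg_hom \<sigma>" using assms(1) by (simp add: coord_change_def)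
  have c: "coeff (upoly z (\<sigma> p)) k = \<sigma> (coeff (upoly z p) k)" for k
    unfolding upoly_coord_change[OF assms(1,2)] by (rule coeff_map_poly) (simp add: alg_hom_0[OF h])
  have "degree (upoly z (\<sigma> p)) = degree (upoly z p)"
  proof (rule antisym)
    show "degree (upoly z (\<sigma> p)) \<le> degree (upoly z p)"
      by (rule degree_le) (simp add: c coeff_eq_0 alg_hom_0[OF h])
    show "degree (upoly z p) \<le> degree (upoly z (\<sigma> p))"
      by (rule le_degree) (simp add: c assms(3) alg_hom_1[OF h])
  qed
  then show ?thesis by (simp add: c assms(3) alg_hom_1[OF h])
qed

text \<open>\<open>a\<close> and \<open>b\<close> are only bounds for the degrees: the coefficient
  in the expected top degree can be computed before it is known to be non-zero.\<close>

lemma coeff_mult_bound: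
  fixes p q :: "'a::comm_semiring_1 poly"
  assumes "degree p \<le> a" "degree q \<le> b"
  shows "degree (p * q) \<le> a + b \<and> coeff (p * q) (a + b) = coeff p a * coeff q b"
proof
  show "degree (p * q) \<le> a + b" using degree_mult_le[of p q] assms by linarith
  have "coeff (p * q) (a + b) = (\<Sum>i\<in>{a}. coeff p i * coeff q (a + b - i))"
    unfolding coeff_mult
  proof (rule sum.mono_neutral_right)
    show "\<forall>i\<in>{..a + b} - {a}. coeff p i * coeff q (a + b - i) = 0"
    proof
      fix i assume i: "i \<in> {..a + b} - {a}"
      show "coeff p i * coeff q (a + b - i) = 0"
      proof (cases "i < a")
        case True
        then have "coeff q (a + b - i) = 0" using assms(2) by (intro coeff_eq_0) linarith
        then show ?thesis by simp
      next
        case False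
        then have "coeff p i = 0" using assms(1) i by (intro coeff_eq_0) auto
        then show ?thesis by simp
      qed
    qed
  qed auto
  then show "coeff (p * q) (a + b) = coeff p a * coeff q b" by simp
qed

lemma coeff_power_bound:
  fixes p :: "'a::comm_semiring_1 poly"
  assumes "degree p \<le> 1"
  shows "degree (p ^ k) \<le> k \<and> coeff (p ^ k) k = coeff p 1 ^ k"
proof (induction k)
  case (Suc k)
  then show ?case using coeff_mult_bound[OF assms, of "p ^ k" k] by simp
qed simp

lemma coeff_prod_bound:
  fixes f :: "'i \<Rightarrow> 'a::comm_semiring_1 poly"
  assumes "\<And>i. i \<in> I \<Longrightarrow> degree (f i) \<le> d i" "finite I"
  shows "degree (prod f I) \<le> sum d I \<and> coeff (prod f I) (sum d I) = (\<Prod>i\<in>I. coeff (f i) (d i))"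
  using assms(2,1)
proof (induction I)
  case (insert x I)
  then show ?case using coeff_mult_bound[of "f x" "d x" "prod f I" "sum d I"] by simp
qed simp

lemma Const_mult_left: "Const a * (Const b * y) = Const (a * b) * (y :: ('n::{finite,linorder}) mpoly)"
  by (simp only: Const_mult mult.assoc)

text \<open>Let \<open>N\<close> be the total degree of \<open>g\<close>. Adding the multiple
  \<open>x $ i\<close> of the variable \<open>s\<close> to each other variable of \<open>S\<close>,
  and scaling \<open>s\<close> by \<open>x $ s\<close>, turns the coefficient of the
  \<open>N\<close>-th power of \<open>s\<close> into the value at \<open>x\<close> of the top
  homogeneous part of \<open>g\<close>.\<close>

lemma monic_linear_change:
  fixes g :: "('n::{finite,linorder}) mpoly"
  assumes "g \<noteq> 0" "in_vars S g" "s \<in> S"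
  obtains \<tau> u where "coord_change S \<tau>" "u \<noteq> 0" "lead_coeff (upoly s (\<tau> g)) = Const u"
proof -
  define tdeg :: "('n \<Rightarrow>\<^sub>0 nat) \<Rightarrow> nat" where "tdeg = (\<lambda>m. \<Sum>i\<in>UNIV. Poly_Mapping.lookup m i)"
  define N where "N = Max (tdeg ` Poly_Mapping.keys g)"
  have kne: "Poly_Mapping.keys g \<noteq> {}" using assms(1) by simp
  then have "N \<in> tdeg ` Poly_Mapping.keys g" unfolding N_def by (intro Max_in) auto
  then obtain m0 where m0: "m0 \<in> Poly_Mapping.keys g" "tdeg m0 = N" by auto
  have le: "tdeg m \<le> N" if "m \<in> Poly_Mapping.keys g" for m using that by (simp add: N_def)
  define top where "top = {m \<in> Poly_Mapping.keys g. tdeg m = N}"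
  define gN where "gN = (\<Sum>m\<in>top. Poly_Mapping.single m (Poly_Mapping.lookup g m))"
  have fin: "finite top" by (simp add: top_def)
  have "Poly_Mapping.lookup gN m0 = Poly_Mapping.lookup g m0"
    using m0 fin by (simp add: gN_def lookup_sum lookup_single when_def top_def)
  then have "gN \<noteq> 0" using m0(1) by (auto simp: in_keys_iff)
  moreover have "Var s \<noteq> (0 :: 'n mpoly)" using poly_eval_Var[of s "\<chi> i. 1"] alg_hom_0[OF alg_hom_poly_eval] by (metis vec_lambda_beta zero_neq_one)
  \<comment> \<open>The extra factor forces \<open>x $ s\<close> to be non-zero as well, which makes
    the substitution invertible.\<close>
  ultimately have "gN * Var s \<noteq> 0" by simp
  then obtain x where x: "poly_eval (gN * Var s) x \<noteq> 0" by (rule nonzero_poly_eval)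
  then have xs: "x $ s \<noteq> 0" and xN: "poly_eval gN x \<noteq> 0" by (auto simp: poly_eval_mult)
  define v where "v = (\<lambda>i. if i = s then Const (x $ s) * Var s else if i \<in> S then Var i + Const (x $ i) * Var s else Var i :: 'n mpoly)"
  define w where "w = (\<lambda>i. if i = s then Const (1 / x $ s) * Var s else if i \<in> S then Var i - Const (x $ i / x $ s) * Var s else Var i :: 'n mpoly)"
  define \<tau> where "\<tau> = subst_hom Const v"
  define \<tau>' where "\<tau>' = subst_hom Const w"
  have hom: "alg_hom \<tau>" "alg_hom \<tau>'" unfolding \<tau>_def \<tau>'_def by (rule alg_hom_subst_hom[OF scalar_hom_Const])+
  have C: "\<tau> (Const a) = Const a" "\<tau>' (Const a) = Const a" "\<tau> (Var i) = v i" "\<tau>' (Var i) = w i" for a i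
    by (simp_all add: \<tau>_def \<tau>'_def subst_hom_Const subst_hom_Var scalar_hom_Const)
  have hv: "\<tau>' (v i) = Var i" for i
    using xs by (simp add: v_def alg_hom_add[OF hom(2)] alg_hom_mult[OF hom(2)] C) (simp add: w_def Const_mult_left)
  have hw: "\<tau> (w i) = Var i" for i
    using xs by (simp add: w_def alg_hom_diff[OF hom(1)] alg_hom_mult[OF hom(1)] C) (simp add: v_def Const_mult_left)
  have inv: "\<tau>' (\<tau> p) = p" "\<tau> (\<tau>' p) = p" for p
    by (rule alg_hom_eqI[OF alg_hom_compose[OF hom(1,2)] alg_hom_id], simp_all add: C hv)
      (rule alg_hom_eqI[OF alg_hom_compose[OF hom(2,1)] alg_hom_id], simp_all add: C hw)
  have "bij \<tau>" by (rule o_bij[of \<tau>']) (auto simp: inv fun_eq_iff)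
  then have cc: "coord_change S \<tau>"
    using hom(1) assms(3) by (auto simp: coord_change_def C v_def intro!: in_vars_add in_vars_mult in_vars_Const in_vars_Var)
  have lin: "degree (upoly s (v i)) \<le> 1" "i \<in> S \<Longrightarrow> coeff (upoly s (v i)) 1 = Const (x $ i)" for i
    by (auto simp: v_def alg_hom_add[OF alg_hom_upoly] alg_hom_mult[OF alg_hom_upoly] upoly_Var degree_pCons_eq_if)
  define mon where "mon = (\<lambda>m. \<Prod>i\<in>UNIV. upoly s (v i) ^ Poly_Mapping.lookup m i)"
  have mon: "degree (mon m) \<le> tdeg m" "coeff (mon m) (tdeg m) = Const (\<Prod>i\<in>UNIV. (x $ i) ^ Poly_Mapping.lookup m i)"
    if "m \<in> Poly_Mapping.keys g" for m
  proof -
    have *: "degree (upoly s (v i) ^ Poly_Mapping.lookup m i) \<le> Poly_Mapping.lookup m i"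
      "coeff (upoly s (v i) ^ Poly_Mapping.lookup m i) (Poly_Mapping.lookup m i) = Const ((x $ i) ^ Poly_Mapping.lookup m i)" for i
    proof -
      have Cp: "Const a ^ k = (Const (a ^ k) :: 'n mpoly)" for a k by (induction k) (simp_all add: Const_mult)
      show "degree (upoly s (v i) ^ Poly_Mapping.lookup m i) \<le> Poly_Mapping.lookup m i"
        using coeff_power_bound[OF lin(1)] by blast
      show "coeff (upoly s (v i) ^ Poly_Mapping.lookup m i) (Poly_Mapping.lookup m i) = Const ((x $ i) ^ Poly_Mapping.lookup m i)"
      proof (cases "i \<in> S")
        case True
        then show ?thesis using coeff_power_bound[OF lin(1)] lin(2) Cp by metis
      next
        case False
        then have "Poly_Mapping.lookup m i = 0" by (rule keys_in_vars[OF assms(2) that])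
        then show ?thesis by simp
      qed
    qed
    have Cpr: "(\<Prod>i\<in>I. Const (f i)) = (Const (prod f I) :: 'n mpoly)" for f and I :: "'n set"
      by (induction I rule: infinite_finite_induct) (simp_all add: Const_mult)
    show "degree (mon m) \<le> tdeg m" "coeff (mon m) (tdeg m) = Const (\<Prod>i\<in>UNIV. (x $ i) ^ Poly_Mapping.lookup m i)"
      unfolding mon_def tdeg_def using coeff_prod_bound[of UNIV "\<lambda>i. upoly s (v i) ^ Poly_Mapping.lookup m i" "Poly_Mapping.lookup m", OF *(1) finite]
      by (auto simp only: *(2) Cpr)
  qed
  have up: "upoly s (\<tau> g) = (\<Sum>m\<in>Poly_Mapping.keys g. [:Const (Poly_Mapping.lookup g m):] * mon m)"
    by (simp add: \<tau>_def subst_hom_def mon_def alg_hom_sum[OF alg_hom_upoly] alg_hom_mult[OF alg_hom_upoly]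
        alg_hom_prod[OF alg_hom_upoly] alg_hom_power[OF alg_hom_upoly])
  have Cs: "(\<Sum>i\<in>I. Const (f i)) = (Const (sum f I) :: 'n mpoly)" for f and I :: "('n \<Rightarrow>\<^sub>0 nat) set"
    by (induction I rule: infinite_finite_induct) (simp_all add: Const_add)
  have high: "coeff (mon m) k = 0" if "m \<in> Poly_Mapping.keys g" "k \<ge> N" "k \<noteq> tdeg m" for m k
    using mon(1)[OF that(1)] le[OF that(1)] that(2,3) by (intro coeff_eq_0) linarith
  have "coeff (upoly s (\<tau> g)) N = (\<Sum>m\<in>Poly_Mapping.keys g. Const (Poly_Mapping.lookup g m) * coeff (mon m) N)"
    by (simp add: up coeff_sum)
  also have "\<dots> = (\<Sum>m\<in>top. Const (Poly_Mapping.lookup g m) * coeff (mon m) N)"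
  proof (intro sum.mono_neutral_right ballI)
    fix m assume "m \<in> Poly_Mapping.keys g - top"
    then have "coeff (mon m) N = 0" by (intro high) (auto simp: top_def)
    then show "Const (Poly_Mapping.lookup g m) * coeff (mon m) N = 0" by simp
  qed (auto simp: top_def)
  also have "\<dots> = (\<Sum>m\<in>top. Const (Poly_Mapping.lookup g m * (\<Prod>i\<in>UNIV. (x $ i) ^ Poly_Mapping.lookup m i)))"
    using mon(2) by (intro sum.cong refl) (auto simp: top_def Const_mult)
  also have "\<dots> = Const (poly_eval gN x)"
    unfolding gN_def alg_hom_sum[OF alg_hom_poly_eval]
    by (simp add: Cs poly_eval_eq_subst_hom subst_hom_single[OF scalar_hom_id])
  finally have cN: "coeff (upoly s (\<tau> g)) N = Const (poly_eval gN x)" .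
  have "degree (upoly s (\<tau> g)) = N"
  proof (rule antisym)
    show "degree (upoly s (\<tau> g)) \<le> N"
    proof (rule degree_le, intro allI impI)
      fix k assume "N < k"
      then have "coeff (mon m) k = 0" if "m \<in> Poly_Mapping.keys g" for m
        using le[OF that] by (intro high[OF that]) auto
      then show "coeff (upoly s (\<tau> g)) k = 0" by (simp add: up coeff_sum)
    qed
    show "N \<le> degree (upoly s (\<tau> g))" by (rule le_degree) (simp add: cN xN)
  qed
  then show thesis using that[OF cc xN] cN by simp
qed

text \<open>Induction on the number of variables still available, looking only at the elements of
  \<open>J\<close> in these variables. A non-zero one is made monic in some \<open>s\<close>, which
  is then given up; later changes do not touch \<open>s\<close>. The process stops when the
  remaining variables are independent modulo the transformed ideal.\<close>

theorem noether_normalization: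
  fixes J :: "('n::{finite,linorder}) mpoly set"
  assumes "ideal J" "1 \<notin> J"
  shows "\<exists>\<sigma> js g. coord_change S \<sigma> \<and> distinct js \<and> set js \<subseteq> S \<and>
    (\<forall>r<length js. g r \<in> \<sigma> ` J \<and> in_vars (S - set (take r js)) (g r) \<and> lead_coeff (upoly (js ! r) (g r)) = 1) \<and>
    (\<forall>q\<in>\<sigma> ` J. in_vars (S - set js) q \<longrightarrow> q = 0)"
  using assms
proof (induction "card S" arbitrary: S J rule: less_induct)
  case less
  show ?case
  proof (cases "\<forall>q\<in>J. in_vars S q \<longrightarrow> q = 0")
    case True
    have "coord_change S (\<lambda>p. p)"
      by (auto simp: coord_change_def alg_hom_id in_vars_Var intro: bij_id[unfolded id_def])
    then show ?thesis using True by (intro exI[of _ "\<lambda>p. p"] exI[of _ "[]"]) auto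
  next
    case False
    then obtain g0 where g0: "g0 \<in> J" "in_vars S g0" "g0 \<noteq> 0" by blast
    have "S \<noteq> {}"
    proof
      assume "S = {}"
      then obtain c where c: "g0 = Const c" using g0(2) in_vars_empty by blast
      have "Const (1 / c) * g0 \<in> J" using ideal_mult_left[OF less.prems(1) g0(1)] .
      then show False using c g0(3) less.prems(2) by (simp flip: Const_mult)
    qed
    then obtain s where s: "s \<in> S" by blast
    obtain \<tau> u where \<tau>: "coord_change S \<tau>" "u \<noteq> 0" "lead_coeff (upoly s (\<tau> g0)) = Const u"
      by (rule monic_linear_change[OF g0(3,2) s])
    have h\<tau>: "alg_hom \<tau>" "bij \<tau>" using \<tau>(1) by (auto simp: coord_change_def)
    have J1: "ideal (\<tau> ` J)"
      unfolding ideal_def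
    proof (intro conjI ballI allI)
      show "0 \<in> \<tau> ` J" using ideal_0[OF less.prems(1)] alg_hom_0[OF h\<tau>(1)] by (metis image_eqI)
      show "a + b \<in> \<tau> ` J" if ab: "a \<in> \<tau> ` J" "b \<in> \<tau> ` J" for a b
      proof -
        obtain a' b' where ab': "a' \<in> J" "a = \<tau> a'" "b' \<in> J" "b = \<tau> b'" using ab by blast
        then have "a + b = \<tau> (a' + b')" by (simp add: alg_hom_add[OF h\<tau>(1)])
        then show ?thesis using ideal_add[OF less.prems(1) ab'(1,3)] by blast
      qed
      show "c * b \<in> \<tau> ` J" if b: "b \<in> \<tau> ` J" for c b
      proof -
        obtain b' where b': "b' \<in> J" "b = \<tau> b'" using b by blast
        obtain c' where c': "c = \<tau> c'" using h\<tau>(2) by (meson bij_pointE)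
        show ?thesis using ideal_mult_left[OF less.prems(1) b'(1), of c'] b' c' alg_hom_mult[OF h\<tau>(1)] by (metis image_eqI)
      qed
    qed
    have J1': "1 \<notin> \<tau> ` J"
      using less.prems(2) alg_hom_1[OF h\<tau>(1)] h\<tau>(2) by (metis bij_is_inj imageE injD)
    have "card (S - {s}) < card S" using s by (intro psubset_card_mono) auto
    from less.hyps[OF this J1 J1'] obtain \<sigma> js g where \<sigma>: "coord_change (S - {s}) \<sigma>" and js: "distinct js" "set js \<subseteq> S - {s}"
      and g: "\<forall>r<length js. g r \<in> \<sigma> ` \<tau> ` J \<and> in_vars (S - {s} - set (take r js)) (g r) \<and> lead_coeff (upoly (js ! r) (g r)) = 1"
      and fin: "\<forall>q\<in>\<sigma> ` \<tau> ` J. in_vars (S - {s} - set js) q \<longrightarrow> q = 0"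
      by (elim exE conjE)
    define g1 where "g1 = Const (1 / u) * \<tau> g0"
    have g1: "g1 \<in> \<tau> ` J" unfolding g1_def using g0(1) by (intro ideal_mult_left[OF J1]) auto
    have "in_vars S g1" unfolding g1_def
      by (intro in_vars_mult in_vars_Const coord_change_in_vars[OF \<tau>(1) _ g0(2)]) simp
    then have g1S: "in_vars S (\<sigma> g1)" by (intro coord_change_in_vars[OF \<sigma>]) auto
    have "lead_coeff (upoly s g1) = Const (1 / u) * Const u"
    proof -
      have "upoly s g1 = smult (Const (1 / u)) (upoly s (\<tau> g0))"
        by (simp add: g1_def alg_hom_mult[OF alg_hom_upoly])
      then show ?thesis using \<tau>(2,3) by (simp add: lead_coeff_smult)
    qed
    then have "lead_coeff (upoly s g1) = 1" using \<tau>(2) by (simp flip: Const_mult)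
    then have g1m: "lead_coeff (upoly s (\<sigma> g1)) = 1" by (intro monic_coord_change[OF \<sigma>]) auto
    define G where "G = (\<lambda>r. case r of 0 \<Rightarrow> \<sigma> g1 | Suc r \<Rightarrow> g r)"
    show ?thesis
    proof (intro exI conjI allI impI ballI)
      show "coord_change S (\<lambda>p. \<sigma> (\<tau> p))" by (rule coord_change_compose[OF \<tau>(1) \<sigma>]) auto
      show "distinct (s # js)" "set (s # js) \<subseteq> S" using js s by auto
      have im: "(\<lambda>p. \<sigma> (\<tau> p)) ` J = \<sigma> ` \<tau> ` J" by (simp add: image_image)
      show "q = 0" if "q \<in> (\<lambda>p. \<sigma> (\<tau> p)) ` J" "in_vars (S - set (s # js)) q" for q
      proof -
        have "S - set (s # js) = S - {s} - set js" by auto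
        then show ?thesis using fin that unfolding im by metis
      qed
      fix r assume r: "r < length (s # js)"
      have "G r \<in> \<sigma> ` \<tau> ` J \<and> in_vars (S - set (take r (s # js))) (G r) \<and> lead_coeff (upoly ((s # js) ! r) (G r)) = 1"
      proof (cases r)
        case 0
        then show ?thesis using g1 g1S g1m by (simp add: G_def)
      next
        case (Suc r')
        have "S - set (take r (s # js)) = S - {s} - set (take r' js)" using Suc by auto
        then show ?thesis using g r Suc by (simp add: G_def)
      qed
      then show "G r \<in> (\<lambda>p. \<sigma> (\<tau> p)) ` J" "in_vars (S - set (take r (s # js))) (G r)"
        "lead_coeff (upoly ((s # js) ! r) (G r)) = 1" unfolding im by auto
    qed
  qed
qed

text \<open>The order is reversed: \<open>g r\<close> is monic in \<open>js ! r\<close>, and the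
  polynomials with larger index are free of this variable. Once these come first,
  \<open>monic_nonzerodivisor\<close> applies at each stage.\<close>

lemma regular_seq_monic:
  fixes g :: "nat \<Rightarrow> ('n::{finite,linorder}) mpoly"
  assumes "distinct js" "\<And>r. r < length js \<Longrightarrow> in_vars (- set (take r js)) (g r)"
    "\<And>r. r < length js \<Longrightarrow> lead_coeff (upoly (js ! r) (g r)) = 1"
  shows "regular_seq (*) (\<lambda>j. g (length js - 1 - j)) (length js) UNIV"
  unfolding regular_seq_def seq_multiples_ring
proof (intro allI impI ballI)
  fix j m assume j: "j < length js" and m: "g (length js - 1 - j) * m \<in> module.span (*) ((\<lambda>j. g (length js - 1 - j)) ` {..<j})"
  define r where "r = length js - 1 - j"
  have r: "r < length js" using j by (simp add: r_def)
  show "m \<in> module.span (*) ((\<lambda>j. g (length js - 1 - j)) ` {..<j})"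
  proof (rule monic_nonzerodivisor[OF _ assms(3)[OF r]])
    show "g r * m \<in> module.span (*) ((\<lambda>j. g (length js - 1 - j)) ` {..<j})" using m by (simp add: r_def)
    fix p assume "p \<in> (\<lambda>j. g (length js - 1 - j)) ` {..<j}"
    then obtain i where i: "i < j" "p = g (length js - 1 - i)" by auto
    define r' where "r' = length js - 1 - i"
    have r': "r < r'" "r' < length js" using i(1) j by (auto simp: r_def r'_def)
    have p: "in_vars (- set (take r' js)) p" using assms(2)[OF r'(2)] i(2) by (simp add: r'_def)
    have "js ! r \<in> set (take r' js)" using r' by (metis in_set_conv_nth length_take min.absorb4 nth_take)
    then show "in_vars (- {js ! r}) p" by (intro in_vars_mono[OF p]) auto
  qed
qed

lemma alg_hom_inv:
  fixes \<sigma> :: "('n::{finite,linorder}) mpoly \<Rightarrow> 'n mpoly"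
  assumes "alg_hom \<sigma>" "bij \<sigma>"
  shows "alg_hom (inv \<sigma>)"
  unfolding alg_hom_def
proof (intro conjI allI)
  fix p q
  have s: "\<sigma> (inv \<sigma> x) = x" for x using assms(2) by (simp add: bij_is_surj surj_f_inv_f)
  have i: "inv \<sigma> (\<sigma> x) = x" for x using assms(2) by (simp add: bij_is_inj)
  show "inv \<sigma> (p + q) = inv \<sigma> p + inv \<sigma> q" using i[of "inv \<sigma> p + inv \<sigma> q"] by (simp add: alg_hom_add[OF assms(1)] s)
  show "inv \<sigma> (p * q) = inv \<sigma> p * inv \<sigma> q" using i[of "inv \<sigma> p * inv \<sigma> q"] by (simp add: alg_hom_mult[OF assms(1)] s)
  show "inv \<sigma> 1 = 1" using i[of 1] by (simp add: alg_hom_1[OF assms(1)])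
qed

lemma regular_seq_inv:
  fixes \<sigma> :: "('n::{finite,linorder}) mpoly \<Rightarrow> 'n mpoly"
  assumes h: "alg_hom \<sigma>" "bij \<sigma>" and reg: "regular_seq (*) a k UNIV"
  shows "regular_seq (*) (\<lambda>j. inv \<sigma> (a j)) k UNIV"
  unfolding regular_seq_def
proof (intro allI impI ballI)
  have s: "\<sigma> (inv \<sigma> x) = x" for x using h(2) by (simp add: bij_is_surj surj_f_inv_f)
  have i: "inv \<sigma> (\<sigma> x) = x" for x using h(2) by (simp add: bij_is_inj)
  note hi = alg_hom_inv[OF h]
  fix j m assume j: "j < k" and "inv \<sigma> (a j) * m \<in> seq_multiples (*) (\<lambda>j. inv \<sigma> (a j)) j UNIV"
  then obtain f where f: "inv \<sigma> (a j) * m = (\<Sum>i<j. inv \<sigma> (a i) * f i)" by (auto simp: seq_multiples_def)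
  have "a j * \<sigma> m = (\<Sum>i<j. a i * \<sigma> (f i))"
    using arg_cong[OF f, of \<sigma>] by (simp add: alg_hom_mult[OF h(1)] alg_hom_sum[OF h(1)] s)
  then have "a j * \<sigma> m \<in> seq_multiples (*) a j UNIV" by (auto simp: seq_multiples_def)
  then have "\<sigma> m \<in> seq_multiples (*) a j UNIV" using reg j by (auto simp: regular_seq_def)
  then obtain e where e: "\<sigma> m = (\<Sum>i<j. a i * e i)" by (auto simp: seq_multiples_def)
  have "m = (\<Sum>l<j. inv \<sigma> (a l) * inv \<sigma> (e l))"
    using arg_cong[OF e, of "inv \<sigma>"] by (simp add: alg_hom_mult[OF hi] alg_hom_sum[OF hi] i)
  then show "m \<in> seq_multiples (*) (\<lambda>j. inv \<sigma> (a j)) j UNIV"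
    unfolding seq_multiples_def by (intro CollectI exI[of _ "\<lambda>l. inv \<sigma> (e l)"]) simp
qed


section \<open>Algebraic independence and codimension\<close>

definition monomial_in :: "(nat \<Rightarrow> ('n::{finite,linorder}) mpoly) \<Rightarrow> nat \<Rightarrow> (nat \<Rightarrow> nat) \<Rightarrow> 'n mpoly" where
  "monomial_in w D e = (\<Prod>i<D. w i ^ e i)"

text \<open>Exponents are functions on \<open>nat\<close>, while a monomial sees only the first
  \<open>D\<close> values; vanishing from \<open>D\<close> on prevents spurious relations between
  functions that agree on these.\<close>

definition alg_indep :: "('n::{finite,linorder}) mpoly set \<Rightarrow> (nat \<Rightarrow> 'n mpoly) \<Rightarrow> nat \<Rightarrow> bool" where
  "alg_indep P w D \<longleftrightarrow> (\<forall>E \<beta>. finite E \<longrightarrow> (\<forall>e\<in>E. \<forall>i\<ge>D. e i = 0) \<longrightarrow>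
     (\<Sum>e\<in>E. Const (\<beta> e) * monomial_in w D e) \<in> P \<longrightarrow> (\<forall>e\<in>E. \<beta> e = 0))"

lemma alg_indepD:
  assumes "alg_indep P w D" "finite E" "\<And>e i. e \<in> E \<Longrightarrow> i \<ge> D \<Longrightarrow> e i = 0"
    "(\<Sum>e\<in>E. Const (\<beta> e) * monomial_in w D e) \<in> P" "e \<in> E"
  shows "\<beta> e = 0"
  using assms unfolding alg_indep_def by blast

text \<open>
  In a relation modulo \<open>P\<close> one may cancel the common power of \<open>f\<close>; modulo \<open>Q\<close> only the terms free of \<open>f\<close>
  then survive.
\<close>

lemma alg_indep_extend:
  fixes P Q :: "('n::{finite,linorder}) mpoly set"
  assumes P: "ideal P" "1 \<notin> P" "\<And>a b. a * b \<in> P \<Longrightarrow> a \<in> P \<or> b \<in> P" and Q: "ideal Q" and PQ: "P \<subseteq> Q"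
    and f: "f \<in> Q" "f \<notin> P" and indep: "alg_indep Q w D"
  shows "alg_indep P (w(D := f)) (Suc D)"
  unfolding alg_indep_def
proof (intro allI impI ballI, rule ccontr)
  fix E \<beta> e assume E: "finite E" "\<forall>e\<in>E. \<forall>i\<ge>Suc D. e i = 0"
    and sum: "(\<Sum>e\<in>E. Const (\<beta> e) * monomial_in (w(D := f)) (Suc D) e) \<in> P" and e: "e \<in> E" "\<beta> e \<noteq> 0"
  \<comment> \<open>Terms with coefficient zero go before the minimum is taken: the minimal exponent
    of \<open>f\<close> must be attained by a term that really occurs, since this term yields the
    contradiction.\<close>
  define E' where "E' = {e \<in> E. \<beta> e \<noteq> 0}"
  have E': "finite E'" "E' \<noteq> {}" using E(1) e by (auto simp: E'_def)
  define \<mu> where "\<mu> = Min ((\<lambda>e. e D) ` E')"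
  have \<mu>_le: "\<mu> \<le> e D" if "e \<in> E'" for e using E'(1) that by (simp add: \<mu>_def)
  have "\<mu> \<in> (\<lambda>e. e D) ` E'" unfolding \<mu>_def using E' by (intro Min_in) auto
  then obtain e0 where e0: "e0 \<in> E'" "e0 D = \<mu>" by auto
  have mon: "monomial_in (w(D := f)) (Suc D) e = monomial_in w D e * f ^ e D" for e
    by (simp add: monomial_in_def)
  have fp: "f ^ e D = f ^ \<mu> * f ^ (e D - \<mu>)" if "e \<in> E'" for e
    using \<mu>_le[OF that] by (simp flip: power_add)
  have "(\<Sum>e\<in>E. Const (\<beta> e) * monomial_in (w(D := f)) (Suc D) e) = (\<Sum>e\<in>E'. Const (\<beta> e) * monomial_in (w(D := f)) (Suc D) e)"
    using E(1) by (intro sum.mono_neutral_right) (auto simp: E'_def)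
  also have "\<dots> = f ^ \<mu> * (\<Sum>e\<in>E'. Const (\<beta> e) * monomial_in w D e * f ^ (e D - \<mu>))"
    unfolding sum_distrib_left mon by (intro sum.cong refl) (simp only: fp ac_simps)
  finally have "f ^ \<mu> * (\<Sum>e\<in>E'. Const (\<beta> e) * monomial_in w D e * f ^ (e D - \<mu>)) \<in> P" using sum by simp
  moreover have "f ^ \<mu> \<notin> P" using prime_ideal_power[OF P(2,3)] f(2) by blast
  ultimately have inP: "(\<Sum>e\<in>E'. Const (\<beta> e) * monomial_in w D e * f ^ (e D - \<mu>)) \<in> Q" using P(3) PQ by blast
  define E0 where "E0 = {e \<in> E'. e D = \<mu>}"
  have "(\<Sum>e\<in>E' - E0. Const (\<beta> e) * monomial_in w D e * f ^ (e D - \<mu>)) \<in> Q"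
  proof (rule ideal_sum[OF Q])
    fix e assume "e \<in> E' - E0"
    then have "e D > \<mu>" using \<mu>_le[of e] by (auto simp: E0_def)
    then have "e D - \<mu> = Suc (e D - \<mu> - 1)" by simp
    then have "f ^ (e D - \<mu>) = f * f ^ (e D - \<mu> - 1)" by (metis power_Suc)
    then have "f ^ (e D - \<mu>) \<in> Q" using ideal_mult_right[OF Q f(1)] by simp
    then show "Const (\<beta> e) * monomial_in w D e * f ^ (e D - \<mu>) \<in> Q" by (rule ideal_mult_left[OF Q])
  qed
  from ideal_diff[OF Q inP this]
  have "(\<Sum>e\<in>E0. Const (\<beta> e) * monomial_in w D e * f ^ (e D - \<mu>)) \<in> Q"
    using sum.subset_diff[of E0 E' "\<lambda>e. Const (\<beta> e) * monomial_in w D e * f ^ (e D - \<mu>)"] E'(1)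
    by (simp add: E0_def)
  also have "(\<Sum>e\<in>E0. Const (\<beta> e) * monomial_in w D e * f ^ (e D - \<mu>)) = (\<Sum>e\<in>E0. Const (\<beta> e) * monomial_in w D e)"
    by (intro sum.cong refl) (simp add: E0_def)
  finally have "(\<Sum>e\<in>E0. Const (\<beta> e) * monomial_in w D e) \<in> Q" .
  \<comment> \<open>On \<open>E0\<close> the exponent of \<open>f\<close> is always
    \<open>\<mu>\<close>, so resetting it to 0 loses nothing and gives exponents admissible for
    \<open>w\<close> and \<open>D\<close>.\<close>
  moreover have inj: "inj_on (\<lambda>e. e(D := 0)) E0"
  proof (rule inj_onI)
    fix x y assume "x \<in> E0" "y \<in> E0" "x(D := 0) = y(D := 0)"
    moreover have "x = (x(D := 0))(D := x D)" "y = (y(D := 0))(D := y D)" by simp_all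
    ultimately show "x = y" by (metis (mono_tags, lifting) E0_def mem_Collect_eq)
  qed
  moreover have "(\<Sum>e\<in>(\<lambda>e. e(D := 0)) ` E0. Const (\<beta> (e(D := \<mu>))) * monomial_in w D e) = (\<Sum>e\<in>E0. Const (\<beta> e) * monomial_in w D e)"
    unfolding sum.reindex[OF inj]
  proof (intro sum.cong refl)
    fix e assume "e \<in> E0"
    then have "(e(D := 0))(D := \<mu>) = e" by (auto simp: E0_def)
    then show "((\<lambda>e. Const (\<beta> (e(D := \<mu>))) * monomial_in w D e) \<circ> (\<lambda>e. e(D := 0))) e = Const (\<beta> e) * monomial_in w D e"
      by (simp add: monomial_in_def)
  qed
  ultimately have in0: "(\<Sum>e\<in>(\<lambda>e. e(D := 0)) ` E0. Const (\<beta> (e(D := \<mu>))) * monomial_in w D e) \<in> Q" by simp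
  have "\<beta> ((e0(D := 0))(D := \<mu>)) = 0"
  proof (rule alg_indepD[OF indep _ _ in0])
    show "finite ((\<lambda>e. e(D := 0)) ` E0)" using E'(1) by (simp add: E0_def)
    show "e i = 0" if "e \<in> (\<lambda>e. e(D := 0)) ` E0" "i \<ge> D" for e i
      using that E(2) by (auto simp: E0_def E'_def)
    show "e0(D := 0) \<in> (\<lambda>e. e(D := 0)) ` E0" using e0 by (auto simp: E0_def)
  qed
  moreover have "(e0(D := 0))(D := \<mu>) = e0" using e0(2) by auto
  ultimately show False using e0(1) by (simp add: E'_def)
qed

section \<open>Counting monomials\<close>

definition exp_box :: "nat \<Rightarrow> ('n \<Rightarrow>\<^sub>0 nat) set" where
  "exp_box N = {m. \<forall>i. Poly_Mapping.lookup m i \<le> N}"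

lemma card_exp_box: "finite (exp_box N :: ('n::finite \<Rightarrow>\<^sub>0 nat) set) \<and> card (exp_box N :: ('n \<Rightarrow>\<^sub>0 nat) set) \<le> (N + 1) ^ CARD('n)"
proof -
  have inj: "inj_on (Poly_Mapping.lookup :: ('n \<Rightarrow>\<^sub>0 nat) \<Rightarrow> 'n \<Rightarrow> nat) (exp_box N)" by (auto intro: inj_onI poly_mapping_eqI)
  have sub: "Poly_Mapping.lookup ` (exp_box N :: ('n \<Rightarrow>\<^sub>0 nat) set) \<subseteq> PiE UNIV (\<lambda>_. {..N})" by (auto simp: exp_box_def)
  have fin: "finite (PiE (UNIV :: 'n set) (\<lambda>_. {..N}))" by (intro finite_PiE) auto
  have "finite (exp_box N :: ('n \<Rightarrow>\<^sub>0 nat) set)" using finite_subset[OF sub fin] inj by (rule finite_imageD)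
  moreover have "card (exp_box N :: ('n \<Rightarrow>\<^sub>0 nat) set) \<le> card (PiE (UNIV :: 'n set) (\<lambda>_. {..N}))"
    using card_mono[OF fin sub] card_image[OF inj] by simp
  ultimately show ?thesis by (simp add: card_PiE)
qed

lemma keys_mult_exp_box:
  assumes "Poly_Mapping.keys p \<subseteq> exp_box a" "Poly_Mapping.keys q \<subseteq> exp_box b"
  shows "Poly_Mapping.keys (p * q :: ('n::{finite,linorder}) mpoly) \<subseteq> exp_box (a + b)"
proof
  fix m assume "m \<in> Poly_Mapping.keys (p * q)"
  then obtain x y where "m = x + y" "x \<in> Poly_Mapping.keys p" "y \<in> Poly_Mapping.keys q"
    using keys_mult[of p q] by blast
  then show "m \<in> exp_box (a + b)" using assms by (auto simp: exp_box_def lookup_add intro!: add_mono)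
qed

lemma keys_one_exp_box: "Poly_Mapping.keys (1 :: ('n::{finite,linorder}) mpoly) \<subseteq> exp_box a"
  by (simp add: exp_box_def)

lemma keys_power_exp_box:
  assumes "Poly_Mapping.keys (p :: ('n::{finite,linorder}) mpoly) \<subseteq> exp_box a"
  shows "Poly_Mapping.keys (p ^ k) \<subseteq> exp_box (a * k)"
proof (induction k)
  case 0
  then show ?case using keys_one_exp_box by simp
next
  case (Suc k)
  show ?case using keys_mult_exp_box[OF assms Suc] by simp
qed

lemma keys_monomial_exp_box:
  fixes w :: "nat \<Rightarrow> ('n::{finite,linorder}) mpoly"
  assumes "\<And>i. i < D \<Longrightarrow> Poly_Mapping.keys (w i) \<subseteq> exp_box a" "\<And>i. i < D \<Longrightarrow> e i \<le> t"
  shows "Poly_Mapping.keys (monomial_in w D e) \<subseteq> exp_box (a * t * D)"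
  using assms
proof (induction D)
  case 0
  then show ?case using keys_one_exp_box by (simp add: monomial_in_def)
next
  case (Suc D)
  have "exp_box (a * e D) \<subseteq> (exp_box (a * t) :: ('n \<Rightarrow>\<^sub>0 nat) set)"
    using Suc.prems(2)[of D] unfolding exp_box_def by (auto intro: order_trans mult_le_mono2)
  then have "Poly_Mapping.keys (w D ^ e D) \<subseteq> exp_box (a * t)"
    using keys_power_exp_box[OF Suc.prems(1)[of D], of "e D"] by auto
  then have "Poly_Mapping.keys (monomial_in w D e * w D ^ e D) \<subseteq> exp_box (a * t * D + a * t)"
    using Suc by (intro keys_mult_exp_box) auto
  then show ?case by (simp add: monomial_in_def add.commute)
qed

text \<open>The products of the first \<open>D\<close> elements of \<open>w\<close> with exponents
  up to \<open>t\<close> number \<open>(t + 1) ^ D\<close> and are linearly independent. They are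
  supported in a box of exponents whose size grows only like \<open>t\<close> to the power of the
  number of variables.\<close>

lemma alg_indep_le_CARD:
  fixes w :: "nat \<Rightarrow> ('n::{finite,linorder}) mpoly"
  assumes P: "0 \<in> P" and indep: "alg_indep P w D"
  shows "D \<le> CARD('n)"
proof (rule ccontr)
  assume "\<not> ?thesis"
  then have D: "CARD('n) < D" by simp
  have "\<exists>a. Poly_Mapping.keys (w i) \<subseteq> exp_box a" for i
  proof -
    define a where "a = Max (insert 0 ((\<lambda>(m, j). Poly_Mapping.lookup m j) ` (Poly_Mapping.keys (w i) \<times> UNIV)))"
    have "Poly_Mapping.lookup m j \<le> a" if "m \<in> Poly_Mapping.keys (w i)" for m j
      unfolding a_def using that by (intro Max_ge) (auto intro!: image_eqI[of _ _ "(m, j)"])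
    then show ?thesis by (auto simp: exp_box_def)
  qed
  then obtain a where a: "\<And>i. Poly_Mapping.keys (w i) \<subseteq> exp_box (a i)" by metis
  define A where "A = (\<Sum>i<D. a i)"
  have wA: "Poly_Mapping.keys (w i) \<subseteq> exp_box A" if "i < D" for i
  proof -
    have "a i \<le> A" unfolding A_def using that by (intro member_le_sum) auto
    then show ?thesis using a[of i] unfolding exp_box_def by (auto intro: order_trans)
  qed
  \<comment> \<open>With this \<open>t\<close> the box has at most
    \<open>(B * (t + 1)) ^ CARD('n)\<close> elements. This bound equals
    \<open>t * (t + 1) ^ CARD('n)\<close>, which stays below
    \<open>(t + 1) ^ Suc (CARD('n))\<close>.\<close>
  define B where "B = A * D + 1"
  define t where "t = B ^ CARD('n)"
  define E where "E = {e :: nat \<Rightarrow> nat. (\<forall>i<D. e i \<le> t) \<and> (\<forall>i\<ge>D. e i = 0)}"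
  define L where "L = (\<lambda>f i. if i < D then f i else (0::nat))"
  have "E = L ` (PiE {..<D} (\<lambda>_. {..t}))"
  proof (intro equalityI subsetI)
    fix e assume e: "e \<in> E"
    then have "e = L (restrict e {..<D})" by (auto simp: E_def L_def fun_eq_iff)
    moreover have "restrict e {..<D} \<in> PiE {..<D} (\<lambda>_. {..t})" using e by (auto simp: E_def)
    ultimately show "e \<in> L ` (PiE {..<D} (\<lambda>_. {..t}))" by blast
  qed (auto simp: E_def L_def PiE_def Pi_def)
  moreover have "inj_on L (PiE {..<D} (\<lambda>_. {..t}))"
    by (rule inj_onI, rule PiE_ext) (auto simp: L_def fun_eq_iff split: if_splits)
  ultimately have cE: "card E = (t + 1) ^ D" by (simp add: card_image card_PiE)
  then have fE: "finite E" by (metis card.infinite power_not_zero add_is_0 one_neq_zero)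
  have injm: "inj_on (monomial_in w D) E"
  proof (rule inj_onI, rule ccontr)
    fix e e' assume ee: "e \<in> E" "e' \<in> E" "monomial_in w D e = monomial_in w D e'" "e \<noteq> e'"
    have "(\<Sum>x\<in>{e, e'}. Const (if x = e then 1 else - 1) * monomial_in w D x) = 0"
      using ee(3,4) by (simp add: Const_minus)
    then have "(if e = e then 1 else - 1 :: complex) = 0"
      using ee(1,2) P by (intro alg_indepD[OF indep, of "{e, e'}" "\<lambda>x. if x = e then 1 else - 1" e]) (auto simp: E_def)
    then show False by simp
  qed
  let ?V = "(\<lambda>m. Poly_Mapping.single m 1 :: 'n mpoly) ` exp_box (A * t * D)"
  have "monomial_in w D ` E \<subseteq> mpoly_space.span ?V"
  proof (rule image_subsetI)
    fix e assume "e \<in> E"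
    then show "monomial_in w D e \<in> mpoly_space.span ?V"
      by (intro span_monomials keys_monomial_exp_box wA) (auto simp: E_def)
  qed
  moreover have "mpoly_space.independent (monomial_in w D ` E)"
  proof
    assume "mpoly_space.dependent (monomial_in w D ` E)"
    then obtain \<gamma> where \<gamma>: "\<exists>v\<in>monomial_in w D ` E. \<gamma> v \<noteq> 0" "(\<Sum>v\<in>monomial_in w D ` E. Const (\<gamma> v) * v) = 0"
      using fE by (auto simp: mpoly_space.dependent_finite)
    from \<gamma>(1) obtain e where e: "e \<in> E" "\<gamma> (monomial_in w D e) \<noteq> 0" by blast
    have "(\<Sum>e\<in>E. Const (\<gamma> (monomial_in w D e)) * monomial_in w D e) \<in> P"
      using \<gamma>(2) P by (simp add: sum.reindex[OF injm])
    then have "\<gamma> (monomial_in w D e) = 0"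
      using e(1) by (intro alg_indepD[OF indep fE, of "\<lambda>e. \<gamma> (monomial_in w D e)"]) (auto simp: E_def)
    then show False using e(2) by simp
  qed
  moreover have "finite ?V" using card_exp_box by blast
  ultimately have "card (monomial_in w D ` E) \<le> card ?V"
    using mpoly_space.independent_span_bound[of ?V "monomial_in w D ` E"] by blast
  also have "card ?V \<le> card (exp_box (A * t * D) :: ('n \<Rightarrow>\<^sub>0 nat) set)" using card_exp_box by (intro card_image_le) blast
  also have "\<dots> \<le> (A * t * D + 1) ^ CARD('n)" using card_exp_box by blast
  also have "\<dots> \<le> (B * (t + 1)) ^ CARD('n)"
    by (intro power_mono) (auto simp: B_def algebra_simps)
  also have "\<dots> = t * (t + 1) ^ CARD('n)" by (simp only: t_def power_mult_distrib)
  also have "\<dots> < (t + 1) ^ Suc (CARD('n))" by simp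
  also have "\<dots> \<le> (t + 1) ^ D" using D by (intro power_increasing) auto
  finally show False using cE card_image[OF injm] by simp
qed

section \<open>Vanishing ideals and chains of irreducible closed sets\<close>

definition vanishing :: "('n::{finite,linorder}) cvec set \<Rightarrow> 'n mpoly set" where
  "vanishing Z = {p. \<forall>x\<in>Z. poly_eval p x = 0}"

lemma ideal_vanishing: "ideal (vanishing Z)"
  unfolding ideal_def by (auto simp: vanishing_def poly_eval_add poly_eval_mult alg_hom_0[OF alg_hom_poly_eval])

lemma one_notin_vanishing: "Z \<noteq> {} \<Longrightarrow> 1 \<notin> vanishing Z"
  by (auto simp: vanishing_def alg_hom_1[OF alg_hom_poly_eval])

lemma zariski_closed_Int_zero:
  assumes "zariski_closed (Z :: ('n::{finite,linorder}) cvec set)"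
  shows "zariski_closed {x \<in> Z. poly_eval a x = 0}"
proof -
  obtain F where "Z = zero_locus F" using assms by (auto simp: zariski_closed_def)
  then have "{x \<in> Z. poly_eval a x = 0} = zero_locus (insert a F)" by (auto simp: zero_locus_def)
  then show ?thesis by (auto simp: zariski_closed_def)
qed

lemma prime_vanishing:
  fixes Z :: "('n::{finite,linorder}) cvec set"
  assumes Z: "irreducible_closed Z" and ab: "a * b \<in> vanishing Z"
  shows "a \<in> vanishing Z \<or> b \<in> vanishing Z"
proof -
  have zc: "zariski_closed Z" using Z by (simp add: irreducible_closed_def)
  have irr: "Z = Y \<or> Z = W" if "zariski_closed Y" "zariski_closed W" "Z = Y \<union> W" for Y W
    using Z that by (simp add: irreducible_closed_def)
  have "Z = {x \<in> Z. poly_eval a x = 0} \<union> {x \<in> Z. poly_eval b x = 0}"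
    using ab by (auto simp: vanishing_def poly_eval_mult)
  then have "Z = {x \<in> Z. poly_eval a x = 0} \<or> Z = {x \<in> Z. poly_eval b x = 0}"
    by (rule irr[OF zariski_closed_Int_zero[OF zc] zariski_closed_Int_zero[OF zc]])
  then show ?thesis unfolding vanishing_def by blast
qed

lemma vanishing_strict:
  fixes Z :: "('n::{finite,linorder}) cvec set"
  assumes "zariski_closed Z" "Z \<subset> W"
  obtains f where "f \<in> vanishing Z" "f \<notin> vanishing W"
proof -
  obtain F where F: "Z = zero_locus F" using assms by (auto simp: zariski_closed_def)
  obtain x where x: "x \<in> W" "x \<notin> Z" using assms(2) by blast
  then obtain f where "f \<in> F" "poly_eval f x \<noteq> 0" by (auto simp: F zero_locus_def)
  then have "f \<in> vanishing Z" "f \<notin> vanishing W" using x(1) by (auto simp: F zero_locus_def vanishing_def)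
  then show thesis by (rule that)
qed

text \<open>Along a chain that ascends from \<open>Y\<close>, each strict inclusion provides a
  polynomial vanishing on the smaller set but not on the larger, and \<open>alg_indep_extend\<close>
  adds it to the family. A chain of length \<open>m\<close> thus leads to \<open>d + m\<close>
  independent elements, which are at most as many as the variables.\<close>

lemma codim_irreducible_le:
  fixes Y :: "('n::{finite,linorder}) cvec set"
  assumes "alg_indep (vanishing Y) w d"
  shows "codim_irreducible Y \<le> enat (CARD('n) - d)"
  unfolding codim_irreducible_def
proof (rule SUP_least)
  fix m assume "m \<in> {n. \<exists>W. W 0 = Y \<and> (\<forall>i\<le>n. irreducible_closed (W i)) \<and> (\<forall>i<n. W i \<subset> W (Suc i))}"
  then obtain W where W: "W 0 = Y" "\<And>i. i \<le> m \<Longrightarrow> irreducible_closed (W i)" "\<And>i. i < m \<Longrightarrow> W i \<subset> W (Suc i)" by blast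
  have "\<exists>w. alg_indep (vanishing (W i)) w (d + i)" if "i \<le> m" for i
    using that
  proof (induction i)
    case 0
    then show ?case using assms W(1) by auto
  next
    case (Suc i)
    then obtain w where w: "alg_indep (vanishing (W i)) w (d + i)" by auto
    have irr: "irreducible_closed (W i)" "irreducible_closed (W (Suc i))" and lt: "W i \<subset> W (Suc i)"
      using W Suc.prems by auto
    then have "zariski_closed (W i)" by (simp add: irreducible_closed_def)
    then obtain f where f: "f \<in> vanishing (W i)" "f \<notin> vanishing (W (Suc i))" using lt by (rule vanishing_strict)
    have "W (Suc i) \<noteq> {}" using irr by (simp add: irreducible_closed_def)
    then have "alg_indep (vanishing (W (Suc i))) (w(d + i := f)) (Suc (d + i))"
      using lt by (intro alg_indep_extend[OF ideal_vanishing one_notin_vanishing prime_vanishing[OF irr(2)] ideal_vanishing _ f w])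
        (auto simp: vanishing_def)
    then show ?case by auto
  qed
  then obtain w where "alg_indep (vanishing (W m)) w (d + m)" by blast
  then have "d + m \<le> CARD('n)" by (rule alg_indep_le_CARD[OF ideal_0[OF ideal_vanishing]])
  then show "enat m \<le> enat (CARD('n) - d)" by simp
qed

lemma regular_seq_prefix: "regular_seq s a k M \<Longrightarrow> m \<le> k \<Longrightarrow> regular_seq s a m M"
  unfolding regular_seq_def by (meson less_le_trans)

lemma prod_Var_list:
  "(\<Prod>i<(d::nat). Var (s i) ^ e i) = (Poly_Mapping.single (\<Sum>i<d. Poly_Mapping.single (s i) (e i)) 1 :: ('n::{finite,linorder}) mpoly)"
  by (induction d) (simp_all add: Var_power mult_single)

text \<open>\<open>\<sigma>\<close> carries a relation between the pulled back coordinates to a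
  polynomial in variables from \<open>U\<close>. Such elements of \<open>K\<close> are zero, and
  distinct exponents give distinct monomials, so all coefficients vanish.\<close>

lemma alg_indep_coordinates:
  fixes \<sigma> :: "('n::{finite,linorder}) mpoly \<Rightarrow> 'n mpoly"
  assumes \<sigma>: "alg_hom \<sigma>" "bij \<sigma>" "\<And>c. \<sigma> (Const c) = Const c"
    and s: "inj_on s {..<d}" "s ` {..<d} \<subseteq> U"
    and K: "\<And>q. q \<in> K \<Longrightarrow> in_vars U (\<sigma> q) \<Longrightarrow> q = 0"
  shows "alg_indep K (\<lambda>i. inv \<sigma> (Var (s i))) d"
  unfolding alg_indep_def
proof (intro allI impI ballI)
  fix E \<beta> e assume E: "finite E" "\<forall>e\<in>E. \<forall>i\<ge>d. e i = 0" and e: "e \<in> E"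
    and sum: "(\<Sum>e\<in>E. Const (\<beta> e) * monomial_in (\<lambda>i. inv \<sigma> (Var (s i))) d e) \<in> K"
  have si: "\<sigma> (inv \<sigma> x) = x" for x using \<sigma>(2) by (simp add: bij_is_surj surj_f_inv_f)
  define F where "F = (\<Sum>e\<in>E. Const (\<beta> e) * (\<Prod>i<d. Var (s i) ^ e i))"
  have F: "\<sigma> (\<Sum>e\<in>E. Const (\<beta> e) * monomial_in (\<lambda>i. inv \<sigma> (Var (s i))) d e) = F"
    by (simp add: F_def monomial_in_def alg_hom_sum[OF \<sigma>(1)] alg_hom_mult[OF \<sigma>(1)] alg_hom_prod[OF \<sigma>(1)]
        alg_hom_power[OF \<sigma>(1)] \<sigma>(3) si)
  have "in_vars U F"
  proof -
    have "s i \<in> U" if "i < d" for i using s(2) that by auto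
    then show ?thesis
      by (simp add: in_vars_def F_def alg_hom_sum[OF alg_hom_restr] alg_hom_mult[OF alg_hom_restr]
        alg_hom_prod[OF alg_hom_restr] alg_hom_power[OF alg_hom_restr])
  qed
  then have "(\<Sum>e\<in>E. Const (\<beta> e) * monomial_in (\<lambda>i. inv \<sigma> (Var (s i))) d e) = 0"
    using K[OF sum] F by simp
  then have F0: "F = 0" using F alg_hom_0[OF \<sigma>(1)] by simp
  define ex where "ex = (\<lambda>e. \<Sum>i<d. Poly_Mapping.single (s i) (e i) :: 'n \<Rightarrow>\<^sub>0 nat)"
  have ex: "Poly_Mapping.lookup (ex e) (s j) = e j" if "j < d" for e j
  proof -
    have "Poly_Mapping.lookup (ex e) (s j) = (\<Sum>i<d. if i = j then e j else 0)"
      unfolding ex_def lookup_sum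
      using s(1) that by (intro sum.cong refl) (auto simp: lookup_single when_def inj_on_def)
    then show ?thesis using that by simp
  qed
  have inj: "x = y" if "x \<in> E" "y \<in> E" "ex x = ex y" for x y
  proof
    fix j show "x j = y j"
    proof (cases "j < d")
      case True
      then show ?thesis using ex that(3) by metis
    next
      case False
      then have "x j = 0" "y j = 0" using E(2) that(1,2) by auto
      then show ?thesis by simp
    qed
  qed
  have "F = (\<Sum>x\<in>E. Poly_Mapping.single (ex x) (\<beta> x))"
    by (simp add: F_def prod_Var_list ex_def Const_def mult_single)
  then have "0 = (\<Sum>x\<in>E. Poly_Mapping.lookup (Poly_Mapping.single (ex x) (\<beta> x)) (ex e))"
    using F0 by (metis lookup_sum lookup_zero)
  also have "\<dots> = (\<Sum>x\<in>E. if x = e then \<beta> e else 0)"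
    using inj[OF _ e] by (intro sum.cong refl) (auto simp: lookup_single when_def)
  also have "\<dots> = \<beta> e" using E(1) e by simp
  finally show "\<beta> e = 0" by simp
qed

text \<open>A prime ideal that contains \<open>I\<close> and avoids the non-zero polynomials in the
  \<open>U\<close>-coordinates defines an irreducible closed subset on which these coordinates stay
  independent. Codimension is an infimum over such subsets, so one is enough and no decomposition
  into components is involved.\<close>

lemma codimension_le_normalization:
  fixes I :: "('n::{finite,linorder}) mpoly set" and U :: "'n set"
  assumes I: "ideal I" and \<sigma>: "alg_hom \<sigma>" "bij \<sigma>" "\<And>c. \<sigma> (Const c) = Const c"
    and U: "\<And>q. q \<in> I \<Longrightarrow> in_vars U (\<sigma> q) \<Longrightarrow> q = 0"
  shows "codimension (zero_locus I) \<le> enat (CARD('n) - card U)"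
proof -
  define T where "T = {q. in_vars U (\<sigma> q) \<and> q \<noteq> 0}"
  obtain K where K: "ideal K" "I \<subseteq> K" "K \<inter> T = {}" "\<And>a b. a * b \<in> K \<Longrightarrow> a \<in> K \<or> b \<in> K"
  proof (rule exists_prime_ideal_avoiding[OF I, of T])
    show "1 \<in> T" using in_vars_Const[of U 1] by (simp add: T_def alg_hom_1[OF \<sigma>(1)])
    show "x * y \<in> T" if "x \<in> T" "y \<in> T" for x y using that by (simp add: T_def alg_hom_mult[OF \<sigma>(1)] in_vars_mult)
    show "I \<inter> T = {}" using U by (auto simp: T_def)
  qed blast
  have K1: "1 \<notin> K" using K(3) in_vars_Const[of U 1] by (auto simp: T_def alg_hom_1[OF \<sigma>(1)])
  define Y where "Y = zero_locus K"
  \<comment> \<open>The Nullstellensatz returns \<open>K\<close> itself, since a prime ideal omits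
    all powers of an element that it omits.\<close>
  have van: "vanishing Y = K"
  proof (intro equalityI subsetI)
    fix h assume h: "h \<in> vanishing Y"
    show "h \<in> K"
    proof (rule ccontr)
      assume "h \<notin> K"
      then have "h ^ k \<notin> K" for k using prime_ideal_power[OF K1 K(4)] by blast
      then obtain x where "x \<in> zero_locus K" "poly_eval h x \<noteq> 0" by (rule nullstellensatz[OF K(1)])
      then show False using h by (simp add: Y_def vanishing_def)
    qed
  qed (simp add: Y_def vanishing_def zero_locus_def)
  have irr: "irreducible_closed Y"
    unfolding irreducible_closed_def
  proof (intro conjI allI impI)
    show "zariski_closed Y" by (auto simp: zariski_closed_def Y_def)
    show "Y \<noteq> {}" using van K1 by (auto simp: vanishing_def)
    fix A B assume A: "zariski_closed A" and B: "zariski_closed B" and AB: "Y = A \<union> B"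
    show "Y = A \<or> Y = B"
    proof (rule ccontr)
      assume "\<not> ?thesis"
      then have "A \<subset> Y" "B \<subset> Y" using AB by auto
      then obtain f h where f: "f \<in> vanishing A" "f \<notin> vanishing Y" and h: "h \<in> vanishing B" "h \<notin> vanishing Y"
        using vanishing_strict[OF A] vanishing_strict[OF B] by metis
      have "f * h \<in> vanishing Y" using f(1) h(1) unfolding AB by (auto simp: vanishing_def poly_eval_mult)
      then show False using K(4) f(2) h(2) unfolding van by blast
    qed
  qed
  obtain s :: "nat \<Rightarrow> 'n" where s: "bij_betw s {..<card U} U"
    using ex_bij_betw_nat_finite[of U] by (auto simp: atLeast0LessThan)
  have "alg_indep (vanishing Y) (\<lambda>i. inv \<sigma> (Var (s i))) (card U)"
    unfolding van using s K(3)
    by (intro alg_indep_coordinates[OF \<sigma>, of s _ U]) (auto simp: bij_betw_def T_def)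
  then have "codim_irreducible Y \<le> enat (CARD('n) - card U)" by (rule codim_irreducible_le)
  moreover have "Y \<subseteq> zero_locus I" using K(2) by (auto simp: Y_def zero_locus_def)
  then have "codimension (zero_locus I) \<le> codim_irreducible Y"
    unfolding codimension_def using irr by (intro INF_lower) auto
  ultimately show ?thesis by (rule order_trans[rotated])
qed

text \<open>If \<open>k\<close> variables are eliminated, the remaining ones bound the codimension
  by \<open>k\<close>, so a codimension above \<open>p\<close> forces \<open>k > p\<close>. The
  eliminating polynomials, in reversed order and transported back by the inverse coordinate change,
  form a regular sequence, which is cut off after \<open>p + 1\<close> terms.\<close>

theorem regular_seq_of_codimension:
  fixes I :: "('n::{finite,linorder}) mpoly set"
  assumes I: "ideal I" and codim: "\<not> codimension (zero_locus I) \<le> enat p"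
  obtains a where "\<And>i. i < Suc p \<Longrightarrow> a i \<in> I" "regular_seq (*) a (Suc p) UNIV"
proof (cases "1 \<in> I")
  \<comment> \<open>Normalisation needs a proper ideal. The unit ideal, whose zero locus is empty,
    is served by the constant sequence 1.\<close>
  case True
  have "regular_seq (*) (\<lambda>_. 1) (Suc p) (UNIV :: 'n mpoly set)" by (simp add: regular_seq_def)
  then show thesis using that[of "\<lambda>_. 1"] True by simp
next
  case False
  obtain \<sigma> js g where \<sigma>: "coord_change UNIV \<sigma>" and js: "distinct js"
    and g: "\<forall>r<length js. g r \<in> \<sigma> ` I \<and> in_vars (UNIV - set (take r js)) (g r) \<and> lead_coeff (upoly (js ! r) (g r)) = 1"
    and fin: "\<forall>q\<in>\<sigma> ` I. in_vars (UNIV - set js) q \<longrightarrow> q = 0"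
    using noether_normalization[OF I False, of UNIV] by (elim exE conjE)
  have h: "alg_hom \<sigma>" "bij \<sigma>" "\<And>c. \<sigma> (Const c) = Const c" using \<sigma> by (auto simp: coord_change_def)
  have i: "inv \<sigma> (\<sigma> x) = x" for x using h(2) by (simp add: bij_is_inj)
  define k where "k = length js"
  have "codimension (zero_locus I) \<le> enat (CARD('n) - card (UNIV - set js))"
  proof (rule codimension_le_normalization[OF I h])
    fix q assume "q \<in> I" "in_vars (UNIV - set js) (\<sigma> q)"
    then have "\<sigma> q = 0" using fin by blast
    then show "q = 0" using i[of q] i[of 0] by (simp add: alg_hom_0[OF h(1)])
  qed
  also have "CARD('n) - card (UNIV - set js) = k"
    using js card_mono[of UNIV "set js"] by (simp add: k_def card_Diff_subset distinct_card)
  finally have "Suc p \<le> k" using codim by (metis enat_ord_simps(1) not_less_eq_eq order_trans)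
  define a where "a = (\<lambda>j. inv \<sigma> (g (k - 1 - j)))"
  have "regular_seq (*) a k UNIV"
    unfolding a_def k_def using g
    by (intro regular_seq_inv[OF h(1,2)] regular_seq_monic[OF js]) (auto simp: Compl_eq_Diff_UNIV)
  then have "regular_seq (*) a (Suc p) UNIV" using \<open>Suc p \<le> k\<close> by (rule regular_seq_prefix)
  moreover have "a j \<in> I" if "j < Suc p" for j
  proof -
    have "g (k - 1 - j) \<in> \<sigma> ` I" using g \<open>Suc p \<le> k\<close> that by (simp add: k_def)
    then show ?thesis by (auto simp: a_def i)
  qed
  ultimately show thesis using that by blast
qed


section \<open>Linear forms\<close>

lemma alg_hom_linear_form: "alg_hom \<phi> \<Longrightarrow> \<phi> (linear_form a) = (\<Sum>i\<in>UNIV. \<phi> (Const (a $ i)) * \<phi> (Var i))"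
  by (simp add: linear_form_def alg_hom_sum alg_hom_mult)

lemma poly_eval_linear_form: "poly_eval (linear_form a) x = (\<Sum>i\<in>UNIV. a $ i * x $ (i :: 'n::{finite,linorder}))"
  by (simp add: alg_hom_linear_form[OF alg_hom_poly_eval])

lemma linear_form_diff: "linear_form (b - c *s a) = linear_form b - Const c * linear_form (a :: ('n::{finite,linorder}) cvec)"
  unfolding linear_form_def sum_distrib_left sum_subtractf[symmetric]
  by (intro sum.cong refl) (simp only: vector_minus_component vector_smult_component Const_diff Const_mult left_diff_distrib mult.assoc)

lemma linear_form_scale: "linear_form (c *s a) = Const c * linear_form (a :: ('n::{finite,linorder}) cvec)"
  by (simp only: linear_form_def vector_smult_component Const_mult mult.assoc sum_distrib_left)

lemma linear_form_eq_0_iff [simp]: "linear_form a = 0 \<longleftrightarrow> a = (0 :: ('n::{finite,linorder}) cvec)"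
proof
  assume "linear_form a = 0"
  then have "(\<Sum>j\<in>UNIV. a $ j * (axis i 1 :: 'n cvec) $ j) = 0" for i
    using poly_eval_linear_form[of a "axis i 1"] alg_hom_0[OF alg_hom_poly_eval] by metis
  then show "a = 0" by (simp add: axis_def vec_eq_iff if_distrib cong: if_cong)
qed (simp add: linear_form_def)

lemma in_vars_linear_form:
  assumes "a $ z = 0" shows "in_vars (- {z}) (linear_form (a :: ('n::{finite,linorder}) cvec))"
proof -
  have "(\<Sum>i\<in>UNIV. Const (a $ i) * restr (- {z}) (Var i)) = (\<Sum>i\<in>UNIV. Const (a $ i) * Var i)"
    using assms by (intro sum.cong) auto
  then show ?thesis by (simp add: in_vars_def alg_hom_linear_form[OF alg_hom_restr]) (simp add: linear_form_def)
qed

text \<open>Coprimality of non-proportional linear forms, without unique factorisation. Subtracting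
  a multiple of \<open>a\<close> removes a variable \<open>z\<close> from \<open>b\<close>, while a
  rescaled \<open>a\<close> is monic in \<open>z\<close>; by \<open>monic_nonzerodivisor\<close> it
  is then no zero divisor modulo the reduced form.\<close>

lemma linear_form_dvd_cancel:
  fixes a b :: "('n::{finite,linorder}) cvec"
  assumes a: "a \<noteq> 0" and ab: "\<And>c. b \<noteq> c *s a" and eq: "linear_form b * r = linear_form a * s"
  shows "linear_form a dvd r"
proof -
  obtain z where z: "a $ z \<noteq> 0" using a by (auto simp: vec_eq_iff)
  define c where "c = b $ z / a $ z"
  define d where "d = b - c *s a"
  have d: "d \<noteq> 0" using ab by (simp add: d_def)
  have dz: "d $ z = 0" using z by (simp add: d_def c_def)
  define a' where "a' = (1 / a $ z) *s a"
  have aa': "Const (a $ z) * linear_form a' = linear_form a"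
    using z by (simp add: a'_def linear_form_scale Const_mult_left)
  have "a' = axis z 1 - (- 1) *s (a' - axis z 1)" by simp
  then have "linear_form a' = linear_form (axis z 1) + linear_form (a' - axis z 1)"
    using linear_form_diff[of "axis z 1" "- 1" "a' - axis z 1"] by (simp add: Const_minus)
  moreover have "linear_form (axis z 1) = (Var z :: 'n mpoly)"
  proof -
    have "linear_form (axis z 1) = (\<Sum>i\<in>UNIV. if i = z then Var z else (0 :: 'n mpoly))"
      unfolding linear_form_def by (intro sum.cong) (auto simp: axis_def)
    then show ?thesis by simp
  qed
  moreover have "in_vars (- {z}) (linear_form (a' - axis z 1))"
    using z by (intro in_vars_linear_form) (simp add: a'_def axis_def)
  ultimately have "upoly z (linear_form a') = [:0, 1:] + [:linear_form (a' - axis z 1):]"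
    by (simp add: alg_hom_add[OF alg_hom_upoly] upoly_Var upoly_in_vars[where S="- {z}"])
  then have monic: "lead_coeff (upoly z (linear_form a')) = 1" by simp
  have "linear_form d * r = linear_form a * (s - Const c * r)"
    using eq by (simp add: d_def linear_form_diff algebra_simps)
  also have "\<dots> = linear_form a' * (Const (a $ z) * (s - Const c * r))"
    unfolding aa'[symmetric] by (simp only: ac_simps)
  finally have dr: "linear_form d * r = linear_form a' * (Const (a $ z) * (s - Const c * r))" .
  interpret module "(*) :: 'n mpoly \<Rightarrow> _ \<Rightarrow> _" by (rule module_times)
  have "r * linear_form d \<in> span {linear_form d}" by (intro span_scale span_base) simp
  then have "linear_form a' * (Const (a $ z) * (s - Const c * r)) \<in> span {linear_form d}"
    by (simp only: mult.commute[of r] dr)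
  then have "Const (a $ z) * (s - Const c * r) \<in> span {linear_form d}"
    by (rule monic_nonzerodivisor[OF _ monic, rotated]) (use in_vars_linear_form[OF dz] in auto)
  then obtain q where q: "Const (a $ z) * (s - Const c * r) = q * linear_form d" by (auto simp: span_singleton)
  have "linear_form d * r = linear_form d * (linear_form a' * q)" unfolding dr q by (simp only: ac_simps)
  then have "r = linear_form a' * q" using d by simp
  also have "\<dots> = linear_form a * (Const (1 / a $ z) * q)"
    by (simp only: a'_def linear_form_scale ac_simps)
  finally show ?thesis by simp
qed


section \<open>Rational forms\<close>

lemma to_ratfun_0 [simp]: "to_ratfun 0 = 0"
  and to_ratfun_eq_iff [simp]: "to_ratfun p = to_ratfun q \<longleftrightarrow> p = q"
  and to_ratfun_minus: "to_ratfun (- p) = - to_ratfun p"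
  by (simp_all add: to_ratfun_def Zero_fract_def eq_fract)

lemma to_ratfun_eq_0_iff [simp]: "to_ratfun p = 0 \<longleftrightarrow> p = 0"
  using to_ratfun_eq_iff[of p 0] by (simp del: to_ratfun_eq_iff)

lemma to_ratfun_sum: "to_ratfun (sum f A) = (\<Sum>x\<in>A. to_ratfun (f x))"
  by (induction A rule: infinite_finite_induct) (simp_all add: to_ratfun_add)

abbreviation regular_functions :: "('n::{finite,linorder}) ratfun set" where
  "regular_functions \<equiv> range to_ratfun"

lemma regular_functions_add: "x \<in> regular_functions \<Longrightarrow> y \<in> regular_functions \<Longrightarrow> x + y \<in> regular_functions"
  and regular_functions_mult: "x \<in> regular_functions \<Longrightarrow> y \<in> regular_functions \<Longrightarrow> x * y \<in> regular_functions"
  and regular_functions_minus: "x \<in> regular_functions \<Longrightarrow> - x \<in> regular_functions"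
  and regular_functions_0: "0 \<in> regular_functions"
  and regular_functions_1: "1 \<in> regular_functions"
  by (auto simp flip: to_ratfun_add to_ratfun_mult to_ratfun_minus to_ratfun_1)

lemma regular_functions_sum: "(\<And>x. x \<in> A \<Longrightarrow> f x \<in> regular_functions) \<Longrightarrow> sum f A \<in> regular_functions"
  by (induction A rule: infinite_finite_induct) (simp_all add: regular_functions_0 regular_functions_add)

lemma regular_functions_sgn_at: "sgn_at t T \<in> regular_functions"
  by (simp add: sgn_at_def regular_functions_1 regular_functions_minus minus_one_power_iff)

definition one_form :: "('n::{finite,linorder} \<Rightarrow> 'n ratfun) \<Rightarrow> 'n form" where
  "one_form v = (\<Sum>i\<in>UNIV. v i *s axis {i} 1)"

lemma one_form_nth: "one_form v $ I = (if \<exists>i. I = {i} then v (the_elem I) else 0)"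
proof (cases "\<exists>i. I = {i}")
  case True
  then obtain i where i: "I = {i}" by blast
  have "one_form v $ I = (\<Sum>j\<in>UNIV. if j = i then v i else 0)"
    unfolding one_form_def sum_component by (intro sum.cong) (auto simp: axis_def i)
  then show ?thesis using i by simp
next
  case False
  then show ?thesis unfolding one_form_def sum_component by (auto simp: axis_def intro!: sum.neutral)
qed

text \<open>Only singletons contribute, and the sign of the shuffle for \<open>{t}\<close> counts
  the elements below \<open>t\<close>. The rules for wedging with 1-forms thereby follow from the
  general ones, with the rational functions as a module over themselves.\<close>

lemma wedge_one_form: "(one_form v \<and>\<^sub>f \<eta>) $ K = ext_mult (*) v (($) \<eta>) K"
proof -
  let ?f = "\<lambda>I. (-1) ^ card {(i, j). i \<in> I \<and> j \<in> K - I \<and> j < i} * (one_form v $ I) * (\<eta> $ (K - I))"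
  have "(one_form v \<and>\<^sub>f \<eta>) $ K = sum ?f (Pow K)" by (simp add: wedge_def)
  also have "\<dots> = sum ?f ((\<lambda>t. {t}) ` K)"
    by (intro sum.mono_neutral_right) (auto simp: one_form_nth)
  also have "\<dots> = (\<Sum>t\<in>K. ?f {t})" by (subst sum.reindex) (auto simp: inj_on_def)
  also have "\<dots> = ext_mult (*) v (($) \<eta>) K"
    unfolding ext_mult_def
  proof (intro sum.cong refl)
    fix t
    have "{(i, j). i \<in> {t} \<and> j \<in> K - {t} \<and> j < i} = Pair t ` {j \<in> K. j < t}" by auto
    then have "card {(i, j). i \<in> {t} \<and> j \<in> K - {t} \<and> j < i} = card {j \<in> K. j < t}"
      by (simp add: card_image inj_on_def)
    then show "?f {t} = sgn_at t K * v t * (\<eta> $ (K - {t}))"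
      by (simp add: one_form_nth sgn_at_def)
  qed
  finally show ?thesis .
qed

lemma nth_wedge_one_form: "($) (one_form v \<and>\<^sub>f \<eta>) = ext_mult (*) v (($) \<eta>)"
  by (rule ext) (rule wedge_one_form)

lemma contraction_nth: "contraction v \<omega> $ J = int_mult (*) (($) v) (($) \<omega>) J"
  by (simp add: contraction_def int_mult_def sgn_at_def)

lemma nth_contraction: "($) (contraction v \<omega>) = int_mult (*) (($) v) (($) \<omega>)"
  by (rule ext) (rule contraction_nth)

lemma one_form_scale: "c *s one_form v = one_form (\<lambda>i. c * v i)"
  by (simp add: vec_eq_iff one_form_nth)

lemma one_form_sum: "(\<Sum>x\<in>A. one_form (v x)) = one_form (\<lambda>i. \<Sum>x\<in>A. v x i)"
  by (simp add: vec_eq_iff one_form_nth)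

definition dlog_coeff :: "'n cvec \<Rightarrow> 'n::{finite,linorder} \<Rightarrow> 'n ratfun" where
  "dlog_coeff a i = inverse (to_ratfun (linear_form a)) * to_ratfun (Const (a $ i))"

lemma dlog_linear_eq: "dlog_linear a = one_form (dlog_coeff a)"
proof -
  have "d_linear a = one_form (\<lambda>i. to_ratfun (Const (a $ i)))" by (simp add: d_linear_def one_form_def)
  then show ?thesis by (simp add: dlog_linear_def one_form_scale dlog_coeff_def[abs_def])
qed

definition weight_coeff :: "'n cvec set set \<Rightarrow> ('n cvec set \<Rightarrow> 'n cvec) \<Rightarrow> ('n cvec set \<Rightarrow> complex) \<Rightarrow> 'n::{finite,linorder} \<Rightarrow> 'n ratfun" where
  "weight_coeff \<A> \<alpha> l i = (\<Sum>H\<in>\<A>. to_ratfun (Const (l H)) * dlog_coeff (\<alpha> H) i)"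

lemma weight_form_eq: "weight_form \<A> \<alpha> l = one_form (weight_coeff \<A> \<alpha> l)"
  unfolding weight_form_def dlog_linear_eq one_form_scale one_form_sum weight_coeff_def ..

lemma module_ratfun: "module ((*) :: ('n::{finite,linorder}) ratfun \<Rightarrow> _ \<Rightarrow> _)"
  by (rule module_times)

lemma wedge_wedge_self: "one_form v \<and>\<^sub>f (one_form v \<and>\<^sub>f \<eta>) = 0"
  unfolding vec_eq_iff wedge_one_form
  by (simp add: nth_wedge_one_form module.ext_mult_ext_mult_self[OF module_ratfun])

lemma wedge_anticommute: "one_form v \<and>\<^sub>f (one_form w \<and>\<^sub>f \<eta>) = - (one_form w \<and>\<^sub>f (one_form v \<and>\<^sub>f \<eta>))"
  unfolding vec_eq_iff vector_uminus_component wedge_one_form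
  using module.ext_mult_anticommute[OF module_ratfun, of _ v w]
  by (simp add: nth_wedge_one_form eq_neg_iff_add_eq_0)

lemma contraction_anticommute: "contraction v (contraction w \<eta>) = - contraction w (contraction v \<eta>)"
  unfolding vec_eq_iff vector_uminus_component contraction_nth
  using module.int_mult_anticommute[OF module_ratfun, of "($) v" "($) w"]
  by (simp add: nth_contraction eq_neg_iff_add_eq_0)

lemma contraction_contraction_self: "contraction v (contraction v \<eta>) = 0"
proof -
  have "int_mult (*) (($) v) (int_mult (*) (($) v) c) T = 0" for c and T
    unfolding module.int_mult_int_mult[OF module_ratfun]
  proof (rule sum_antisymmetric)
    fix t u assume "t \<in> - T" "u \<in> - T"
    then show "(if t = u then 0 else sgn_at t T * v $ t * (sgn_at u (insert t T) * v $ u) * c (insert u (insert t T))) =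
      - (if u = t then 0 else sgn_at u T * v $ u * (sgn_at t (insert u T) * v $ t) * c (insert t (insert u T)))"
      using mult_swap_minus[OF sgn_at_insert_swap[of T t u], of "v $ t" "v $ u"]
      by (simp add: insert_commute[of t u])
  qed auto
  then show ?thesis unfolding vec_eq_iff contraction_nth by (simp add: nth_contraction)
qed

lemma contraction_wedge:
  "contraction v (one_form w \<and>\<^sub>f \<eta>) + one_form w \<and>\<^sub>f contraction v \<eta> = (\<Sum>i\<in>UNIV. v $ i * w i) *s \<eta>"
  unfolding vec_eq_iff vector_add_component contraction_nth wedge_one_form vector_smult_component
  using module.int_mult_ext_mult[OF module_ratfun, of "($) v" w]
  by (simp add: nth_contraction nth_wedge_one_form)

lemma wedge_add: "one_form v \<and>\<^sub>f (\<eta> + \<theta>) = one_form v \<and>\<^sub>f \<eta> + one_form v \<and>\<^sub>f \<theta>"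
  and wedge_scale: "one_form v \<and>\<^sub>f (c *s \<eta>) = c *s (one_form v \<and>\<^sub>f \<eta>)"
  and wedge_zero: "one_form v \<and>\<^sub>f 0 = 0"
  by (simp_all add: vec_eq_iff wedge_one_form ext_mult_def sum.distrib algebra_simps sum_distrib_left)

lemma wedge_form_scale: "one_form v \<and>\<^sub>f form_scale r \<eta> = form_scale r (one_form v \<and>\<^sub>f \<eta>)"
  by (simp add: form_scale_def wedge_scale)

lemma contraction_add: "contraction v (\<eta> + \<theta>) = contraction v \<eta> + contraction v \<theta>"
  and contraction_scale: "contraction v (c *s \<eta>) = c *s contraction v \<eta>"
  and contraction_zero: "contraction v 0 = 0"
  by (simp_all add: vec_eq_iff contraction_nth int_mult_def sum.distrib algebra_simps sum_distrib_left)

lemma contraction_form_scale: "contraction v (form_scale r \<eta>) = form_scale r (contraction v \<eta>)"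
  by (simp add: form_scale_def contraction_scale)

lemma contraction_diff: "contraction v (\<eta> - \<theta>) = contraction v \<eta> - contraction v \<theta>"
  by (simp add: vec_eq_iff contraction_nth int_mult_def sum_subtractf algebra_simps)


section \<open>Logarithmic forms\<close>

context
  fixes \<A> :: "('n::{finite,linorder}) cvec set set" and \<alpha> :: "'n cvec set \<Rightarrow> 'n cvec"
  assumes arr: "hyperplane_arrangement \<A> \<alpha>"
begin

lemma linear_form_nonzero: "H \<in> \<A> \<Longrightarrow> linear_form (\<alpha> H) \<noteq> 0"
  using arr by (auto simp: hyperplane_arrangement_def)

lemma finite_arrangement: "finite \<A>"
  using arr by (simp add: hyperplane_arrangement_def)

lemma not_proportional:
  assumes "H \<in> \<A>" "H' \<in> \<A>" "H \<noteq> H'" shows "\<alpha> H' \<noteq> c *s \<alpha> H"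
proof
  assume eq: "\<alpha> H' = c *s \<alpha> H"
  have H: "\<alpha> H \<noteq> 0" "H = {x. (\<Sum>i\<in>UNIV. \<alpha> H $ i * x $ i) = 0}" and H': "\<alpha> H' \<noteq> 0" "H' = {x. (\<Sum>i\<in>UNIV. \<alpha> H' $ i * x $ i) = 0}"
    using arr assms unfolding hyperplane_arrangement_def by blast+
  have c: "c \<noteq> 0" using eq H'(1) by auto
  have "(\<Sum>i\<in>UNIV. \<alpha> H' $ i * x $ i) = c * (\<Sum>i\<in>UNIV. \<alpha> H $ i * x $ i)" for x
    by (simp add: eq sum_distrib_left mult.assoc)
  then have "H' = H" using c H(2) H'(2) by auto
  then show False using assms(3) by simp
qed

abbreviation "defining_fun \<equiv> to_ratfun (defining_poly \<A> \<alpha>)"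

lemma defining_fun_nonzero: "defining_fun \<noteq> 0"
  using linear_form_nonzero by (simp add: defining_poly_def prod_zero_iff finite_arrangement)

lemma polar_forms_iff:
  "\<eta> \<in> polar_forms \<A> \<alpha> p \<longleftrightarrow> (\<forall>I. (card I = p \<longrightarrow> defining_fun * \<eta> $ I \<in> regular_functions) \<and> (card I \<noteq> p \<longrightarrow> \<eta> $ I = 0))"
proof
  assume "\<eta> \<in> polar_forms \<A> \<alpha> p"
  then obtain \<theta> where "\<theta> \<in> regular_forms p" "\<eta> = inverse defining_fun *s \<theta>" by (auto simp: polar_forms_def)
  then show "\<forall>I. (card I = p \<longrightarrow> defining_fun * \<eta> $ I \<in> regular_functions) \<and> (card I \<noteq> p \<longrightarrow> \<eta> $ I = 0)"
    using defining_fun_nonzero by (simp add: regular_forms_def mult.assoc[symmetric])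
next
  assume r: "\<forall>I. (card I = p \<longrightarrow> defining_fun * \<eta> $ I \<in> regular_functions) \<and> (card I \<noteq> p \<longrightarrow> \<eta> $ I = 0)"
  have "\<eta> = inverse defining_fun *s (defining_fun *s \<eta>)" using defining_fun_nonzero by (simp add: vec_eq_iff)
  moreover have "defining_fun *s \<eta> \<in> regular_forms p" using r by (simp add: regular_forms_def)
  ultimately show "\<eta> \<in> polar_forms \<A> \<alpha> p" unfolding polar_forms_def by blast
qed

lemma polar_forms_zero: "0 \<in> polar_forms \<A> \<alpha> p"
  by (simp add: polar_forms_iff regular_functions_0)

lemma polar_forms_add: "\<eta> \<in> polar_forms \<A> \<alpha> p \<Longrightarrow> \<theta> \<in> polar_forms \<A> \<alpha> p \<Longrightarrow> \<eta> + \<theta> \<in> polar_forms \<A> \<alpha> p"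
  by (simp add: polar_forms_iff distrib_left regular_functions_add)

lemma polar_forms_scale: "c \<in> regular_functions \<Longrightarrow> \<eta> \<in> polar_forms \<A> \<alpha> p \<Longrightarrow> c *s \<eta> \<in> polar_forms \<A> \<alpha> p"
  by (simp add: polar_forms_iff mult.left_commute[of _ c] regular_functions_mult)

lemma polar_forms_minus: "\<eta> \<in> polar_forms \<A> \<alpha> p \<Longrightarrow> - \<eta> \<in> polar_forms \<A> \<alpha> p"
  by (simp add: polar_forms_iff regular_functions_minus)

lemma polar_forms_diff: "\<eta> \<in> polar_forms \<A> \<alpha> p \<Longrightarrow> \<theta> \<in> polar_forms \<A> \<alpha> p \<Longrightarrow> \<eta> - \<theta> \<in> polar_forms \<A> \<alpha> p"
  using polar_forms_add[of \<eta> p "- \<theta>"] polar_forms_minus by simp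

lemma polar_forms_contraction:
  assumes v: "\<And>i. v $ i \<in> regular_functions" and \<eta>: "\<eta> \<in> polar_forms \<A> \<alpha> (Suc p)"
  shows "contraction v \<eta> \<in> polar_forms \<A> \<alpha> p"
  unfolding polar_forms_iff contraction_nth int_mult_def
proof (intro allI conjI impI)
  fix I :: "'n set"
  have card: "card (insert t I) = Suc (card I)" if "t \<in> - I" for t using that by simp
  show "defining_fun * (\<Sum>t\<in>- I. sgn_at t I * v $ t * \<eta> $ insert t I) \<in> regular_functions" if "card I = p"
  proof -
    have "defining_fun * (\<Sum>t\<in>- I. sgn_at t I * v $ t * \<eta> $ insert t I) = (\<Sum>t\<in>- I. sgn_at t I * v $ t * (defining_fun * \<eta> $ insert t I))"
      by (simp add: sum_distrib_left ac_simps)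
    also have "\<dots> \<in> regular_functions"
    proof (rule regular_functions_sum)
      fix t assume "t \<in> - I"
      then have "defining_fun * \<eta> $ insert t I \<in> regular_functions" using \<eta> card that by (simp add: polar_forms_iff)
      then show "sgn_at t I * v $ t * (defining_fun * \<eta> $ insert t I) \<in> regular_functions"
        by (rule regular_functions_mult[OF regular_functions_mult[OF regular_functions_sgn_at v]])
    qed
    finally show ?thesis .
  qed
  show "(\<Sum>t\<in>- I. sgn_at t I * v $ t * \<eta> $ insert t I) = 0" if "card I \<noteq> p"
    using \<eta> card that by (intro sum.neutral) (simp add: polar_forms_iff)
qed

lemma contraction_degree_0:
  assumes "\<eta> \<in> polar_forms \<A> \<alpha> 0" shows "contraction v \<eta> = 0"
  using assms by (simp add: vec_eq_iff contraction_nth int_mult_def polar_forms_iff)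

lemma wedge_degree:
  assumes "\<And>I. card I \<noteq> p \<Longrightarrow> \<eta> $ I = 0" "card I \<noteq> Suc p"
  shows "(one_form v \<and>\<^sub>f \<eta>) $ I = 0"
  unfolding wedge_one_form ext_mult_def
proof (intro sum.neutral ballI)
  fix t assume "t \<in> I"
  then have "card I = Suc (card (I - {t}))" by (metis card_Suc_Diff1 finite)
  then have "\<eta> $ (I - {t}) = 0" using assms by auto
  then show "sgn_at t I * v t * \<eta> $ (I - {t}) = 0" by simp
qed

abbreviation "dlog H \<equiv> one_form (dlog_coeff (\<alpha> H))"

lemma log_forms_iff:
  "\<omega> \<in> log_forms \<A> \<alpha> p \<longleftrightarrow> \<omega> \<in> polar_forms \<A> \<alpha> p \<and> (\<forall>H\<in>\<A>. dlog H \<and>\<^sub>f \<omega> \<in> polar_forms \<A> \<alpha> (Suc p))"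
  by (simp add: log_forms_def dlog_linear_eq)

text \<open>All coefficients of \<open>dlog H\<close> have the same denominator
  \<open>linear_form (\<alpha> H)\<close>, so wedging adds at most this one factor to the
  pole.\<close>

lemma clear_denominator:
  assumes "H \<in> \<A>" "\<eta> \<in> polar_forms \<A> \<alpha> p" "card I = Suc p"
  shows "to_ratfun (linear_form (\<alpha> H)) * (defining_fun * (dlog H \<and>\<^sub>f \<eta>) $ I) \<in> regular_functions"
proof -
  let ?L = "to_ratfun (linear_form (\<alpha> H))"
  have L: "?L * inverse ?L = 1" using linear_form_nonzero[OF assms(1)] by simp
  have "?L * (defining_fun * (dlog H \<and>\<^sub>f \<eta>) $ I) = (\<Sum>t\<in>I. (?L * inverse ?L) * (sgn_at t I * to_ratfun (Const (\<alpha> H $ t)) * (defining_fun * \<eta> $ (I - {t}))))"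
    unfolding wedge_one_form ext_mult_def dlog_coeff_def sum_distrib_left
    by (intro sum.cong refl) (simp only: ac_simps)
  also have "\<dots> \<in> regular_functions"
    unfolding L mult_1_left
  proof (rule regular_functions_sum)
    fix t assume "t \<in> I"
    then have "card (I - {t}) = p" using assms(3) by simp
    then have "defining_fun * \<eta> $ (I - {t}) \<in> regular_functions" using assms(2) by (simp add: polar_forms_iff)
    then show "sgn_at t I * to_ratfun (Const (\<alpha> H $ t)) * (defining_fun * \<eta> $ (I - {t})) \<in> regular_functions"
      by (rule regular_functions_mult[OF regular_functions_mult[OF regular_functions_sgn_at rangeI]])
  qed
  finally show ?thesis .
qed

text \<open>Distinct hyperplanes have non-proportional linear forms. These are coprime, so no
  denominator can divide both.\<close>

lemma regular_of_two_denominators: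
  assumes "H \<in> \<A>" "H' \<in> \<A>" "H \<noteq> H'"
    and "to_ratfun (linear_form (\<alpha> H)) * x \<in> regular_functions" "to_ratfun (linear_form (\<alpha> H')) * x \<in> regular_functions"
  shows "x \<in> regular_functions"
proof -
  obtain r s where r: "to_ratfun (linear_form (\<alpha> H)) * x = to_ratfun r" and s: "to_ratfun (linear_form (\<alpha> H')) * x = to_ratfun s"
    using assms(4,5) by blast
  have "to_ratfun (linear_form (\<alpha> H')) * to_ratfun r = to_ratfun (linear_form (\<alpha> H)) * to_ratfun s"
    unfolding r[symmetric] s[symmetric] by (simp only: ac_simps)
  then have "linear_form (\<alpha> H') * r = linear_form (\<alpha> H) * s" by (simp flip: to_ratfun_mult)
  moreover have "\<alpha> H \<noteq> 0" using linear_form_nonzero[OF assms(1)] by simp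
  ultimately have "linear_form (\<alpha> H) dvd r"
    using not_proportional[OF assms(1,2,3)] by (intro linear_form_dvd_cancel[of _ "\<alpha> H'"]) auto
  then obtain q where "r = linear_form (\<alpha> H) * q" by (rule dvdE)
  then have "to_ratfun (linear_form (\<alpha> H)) * x = to_ratfun (linear_form (\<alpha> H)) * to_ratfun q"
    using r by (simp add: to_ratfun_mult)
  then show ?thesis using linear_form_nonzero[OF assms(1)] by auto
qed

text \<open>
  A pole of \<open>dlog H' \<and> dlog H \<and> \<omega>\<close> beyond \<open>1/f\<close> could only be along \<open>H\<close>, and by anticommutativity
  only along \<open>H'\<close>.
\<close>

lemma dlog_wedge_log_forms:
  assumes H: "H \<in> \<A>" and \<omega>: "\<omega> \<in> log_forms \<A> \<alpha> p"
  shows "dlog H \<and>\<^sub>f \<omega> \<in> log_forms \<A> \<alpha> (Suc p)"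
  unfolding log_forms_iff
proof (intro conjI ballI)
  show "dlog H \<and>\<^sub>f \<omega> \<in> polar_forms \<A> \<alpha> (Suc p)" using assms by (simp add: log_forms_iff)
  fix H' assume H': "H' \<in> \<A>"
  show "dlog H' \<and>\<^sub>f (dlog H \<and>\<^sub>f \<omega>) \<in> polar_forms \<A> \<alpha> (Suc (Suc p))"
  proof (cases "H' = H")
    case True
    then show ?thesis by (simp add: wedge_wedge_self polar_forms_zero)
  next
    case False
    have pol: "dlog H \<and>\<^sub>f \<omega> \<in> polar_forms \<A> \<alpha> (Suc p)" "dlog H' \<and>\<^sub>f \<omega> \<in> polar_forms \<A> \<alpha> (Suc p)"
      using \<omega> H H' by (auto simp: log_forms_iff)
    show ?thesis unfolding polar_forms_iff
    proof (intro allI conjI impI)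
      fix I :: "'n set"
      show "(dlog H' \<and>\<^sub>f (dlog H \<and>\<^sub>f \<omega>)) $ I = 0" if "card I \<noteq> Suc (Suc p)"
        using pol(1) by (intro wedge_degree[OF _ that]) (simp add: polar_forms_iff)
      assume I: "card I = Suc (Suc p)"
      show "defining_fun * (dlog H' \<and>\<^sub>f (dlog H \<and>\<^sub>f \<omega>)) $ I \<in> regular_functions"
      proof (rule regular_of_two_denominators[OF H' H False])
        show "to_ratfun (linear_form (\<alpha> H')) * (defining_fun * (dlog H' \<and>\<^sub>f (dlog H \<and>\<^sub>f \<omega>)) $ I) \<in> regular_functions"
          by (rule clear_denominator[OF H' pol(1) I])
        have "(dlog H' \<and>\<^sub>f (dlog H \<and>\<^sub>f \<omega>)) $ I = - (dlog H \<and>\<^sub>f (dlog H' \<and>\<^sub>f \<omega>)) $ I"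
          by (subst wedge_anticommute) simp
        then show "to_ratfun (linear_form (\<alpha> H)) * (defining_fun * (dlog H' \<and>\<^sub>f (dlog H \<and>\<^sub>f \<omega>)) $ I) \<in> regular_functions"
          using regular_functions_minus[OF clear_denominator[OF H pol(2) I]] by simp
      qed
    qed
  qed
qed

lemma log_forms_zero: "0 \<in> log_forms \<A> \<alpha> p"
  by (simp add: log_forms_iff polar_forms_zero wedge_zero)

lemma log_forms_add: "\<eta> \<in> log_forms \<A> \<alpha> p \<Longrightarrow> \<theta> \<in> log_forms \<A> \<alpha> p \<Longrightarrow> \<eta> + \<theta> \<in> log_forms \<A> \<alpha> p"
  by (simp add: log_forms_iff wedge_add polar_forms_add)

lemma log_forms_scale: "c \<in> regular_functions \<Longrightarrow> \<eta> \<in> log_forms \<A> \<alpha> p \<Longrightarrow> c *s \<eta> \<in> log_forms \<A> \<alpha> p"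
  by (simp add: log_forms_iff wedge_scale polar_forms_scale)

lemma log_forms_diff: "\<eta> \<in> log_forms \<A> \<alpha> p \<Longrightarrow> \<theta> \<in> log_forms \<A> \<alpha> p \<Longrightarrow> \<eta> - \<theta> \<in> log_forms \<A> \<alpha> p"
  using log_forms_add[of \<eta> p "- 1 *s \<theta>"] log_forms_scale[of "- 1" \<theta> p]
  by (simp add: regular_functions_minus regular_functions_1)

lemma subspace_log_forms: "form.subspace (log_forms \<A> \<alpha> p)"
  unfolding form.subspace_def
  by (auto simp: log_forms_zero log_forms_add form_scale_def intro: log_forms_scale)

text \<open>By Cartan's formula, wedging \<open>dlog H\<close> with the contraction gives the
  pairing times \<open>\<omega>\<close>, minus the contraction of the wedge of \<open>dlog H\<close>
  with \<open>\<omega>\<close>; both have poles of order at most \<open>1/f\<close>. The hypotheses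
  on \<open>v\<close> say that it is a logarithmic vector field.\<close>

lemma log_forms_contraction:
  assumes v: "\<And>i. v $ i \<in> regular_functions"
    and v\<alpha>: "\<And>H. H \<in> \<A> \<Longrightarrow> (\<Sum>i\<in>UNIV. v $ i * dlog_coeff (\<alpha> H) i) \<in> regular_functions"
    and \<omega>: "\<omega> \<in> log_forms \<A> \<alpha> (Suc p)"
  shows "contraction v \<omega> \<in> log_forms \<A> \<alpha> p"
  unfolding log_forms_iff
proof (intro conjI ballI)
  have pol: "\<omega> \<in> polar_forms \<A> \<alpha> (Suc p)" using \<omega> by (simp add: log_forms_iff)
  then show "contraction v \<omega> \<in> polar_forms \<A> \<alpha> p" by (rule polar_forms_contraction[OF v])
  fix H assume H: "H \<in> \<A>"
  have "dlog H \<and>\<^sub>f contraction v \<omega> = (\<Sum>i\<in>UNIV. v $ i * dlog_coeff (\<alpha> H) i) *s \<omega> - contraction v (dlog H \<and>\<^sub>f \<omega>)"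
    using contraction_wedge[of v "dlog_coeff (\<alpha> H)" \<omega>] by (simp add: algebra_simps)
  also have "\<dots> \<in> polar_forms \<A> \<alpha> (Suc p)"
    using \<omega> H by (intro polar_forms_diff polar_forms_scale v\<alpha> pol polar_forms_contraction[OF v]) (auto simp: log_forms_iff)
  finally show "dlog H \<and>\<^sub>f contraction v \<omega> \<in> polar_forms \<A> \<alpha> (Suc p)" .
qed

lemma euler_field_regular: "euler_field $ i \<in> regular_functions"
  by (simp add: euler_field_def)

lemma euler_field_dlog:
  assumes "H \<in> \<A>" shows "(\<Sum>i\<in>UNIV. euler_field $ i * dlog_coeff (\<alpha> H) i) = 1"
proof -
  have "(\<Sum>i\<in>UNIV. euler_field $ i * dlog_coeff (\<alpha> H) i) =
      inverse (to_ratfun (linear_form (\<alpha> H))) * (\<Sum>i\<in>UNIV. to_ratfun (Const (\<alpha> H $ i) * Var i))"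
    by (simp add: euler_field_def dlog_coeff_def sum_distrib_left to_ratfun_mult ac_simps)
  also have "(\<Sum>i\<in>UNIV. to_ratfun (Const (\<alpha> H $ i) * Var i)) = to_ratfun (linear_form (\<alpha> H))"
    by (simp add: linear_form_def to_ratfun_sum)
  finally show ?thesis using linear_form_nonzero[OF assms] by simp
qed

lemma euler_contraction_log_forms:
  "\<omega> \<in> log_forms \<A> \<alpha> (Suc p) \<Longrightarrow> contraction euler_field \<omega> \<in> log_forms \<A> \<alpha> p"
  by (rule log_forms_contraction[OF euler_field_regular]) (simp_all add: euler_field_dlog regular_functions_1)

lemma subspace_rel_log_forms: "form.subspace (rel_log_forms \<A> \<alpha> p)"
  using subspace_log_forms[of p] unfolding form.subspace_def rel_log_forms_def
  by (auto simp: contraction_zero contraction_add contraction_form_scale)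

text \<open>Since \<open>\<langle>\<chi>, dlog H\<rangle> = 1\<close>, the map \<open>\<omega> \<mapsto> \<omega> - dlog H \<and> \<iota>\<^sub>\<chi> \<omega>\<close> splits off the relative forms.\<close>

lemma rel_log_forms_retract:
  assumes H: "H \<in> \<A>"
  defines "r \<equiv> \<lambda>\<omega>. \<omega> - dlog H \<and>\<^sub>f contraction euler_field \<omega>"
  shows "module_hom_between form_scale form_scale (log_forms \<A> \<alpha> p) (rel_log_forms \<A> \<alpha> p) r"
    and "\<omega> \<in> rel_log_forms \<A> \<alpha> p \<Longrightarrow> r \<omega> = \<omega>"
proof -
  show "\<omega> \<in> rel_log_forms \<A> \<alpha> p \<Longrightarrow> r \<omega> = \<omega>" by (simp add: r_def rel_log_forms_def wedge_zero)
  have "r \<omega> \<in> rel_log_forms \<A> \<alpha> p" if \<omega>: "\<omega> \<in> log_forms \<A> \<alpha> p" for \<omega>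
  proof -
    have "dlog H \<and>\<^sub>f contraction euler_field \<omega> \<in> log_forms \<A> \<alpha> p"
    \<comment> \<open>In degree 0 the contraction is zero;
      \<open>euler_contraction_log_forms\<close> covers the positive degrees.\<close>
    proof (cases p)
      case 0
      then show ?thesis using \<omega> by (simp add: log_forms_iff contraction_degree_0 wedge_zero polar_forms_zero)
    next
      case (Suc q)
      then show ?thesis using \<omega> by (auto intro: dlog_wedge_log_forms[OF H] euler_contraction_log_forms)
    qed
    then have "r \<omega> \<in> log_forms \<A> \<alpha> p" unfolding r_def using \<omega> by (intro log_forms_diff)
    \<comment> \<open>Cartan's formula with pairing 1; its other term vanishes because the Euler
      field is contracted twice.\<close>
    moreover have "contraction euler_field (dlog H \<and>\<^sub>f contraction euler_field \<omega>) = contraction euler_field \<omega>"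
      using contraction_wedge[of euler_field "dlog_coeff (\<alpha> H)" "contraction euler_field \<omega>"]
      by (simp add: contraction_contraction_self wedge_zero euler_field_dlog[OF H])
    then have "contraction euler_field (r \<omega>) = 0"
      by (simp add: r_def contraction_diff)
    ultimately show ?thesis by (simp add: rel_log_forms_def)
  qed
  then show "module_hom_between form_scale form_scale (log_forms \<A> \<alpha> p) (rel_log_forms \<A> \<alpha> p) r"
    unfolding module_hom_between_def
    by (auto simp: r_def contraction_add wedge_add contraction_form_scale wedge_form_scale form.scale_right_diff_distrib)
qed

end


section \<open>The twisted complex\<close>

text \<open>A bound by \<open>q\<close> means lying strictly below \<open>Suc q\<close>, and an
  infimum strictly below a value is undercut by an actual resolution length.\<close>

lemma projective_dimension_le:
  assumes "projective_dimension s M \<le> enat q"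
  obtains n where "n \<le> q" "has_projective_resolution s M n"
proof -
  have "\<exists>n\<in>{n. has_projective_resolution s M n}. enat n < enat (Suc q)"
    using assms unfolding projective_dimension_def
    by (intro INF_less_iff[THEN iffD1]) (simp add: order_le_less_trans)
  then obtain n where "has_projective_resolution s M n" "n < Suc q" by auto
  then show thesis by (intro that) auto
qed

lemma derivation_linear_form:
  assumes "derivation \<delta>"
  shows "\<delta> (linear_form a) = (\<Sum>i\<in>UNIV. Const (a $ i) * \<delta> (Var (i :: 'n::{finite,linorder})))"
proof -
  have add: "\<And>p q. \<delta> (p + q) = \<delta> p + \<delta> q" and sc: "\<And>c p. \<delta> (Const c * p) = Const c * \<delta> p"
    using assms by (auto simp: derivation_def)
  have "\<delta> 0 = 0" using add[of 0 0] by simp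
  then have "\<delta> (sum g A) = (\<Sum>x\<in>A. \<delta> (g x))" for g :: "'n \<Rightarrow> 'n mpoly" and A
    by (induction A rule: infinite_finite_induct) (simp_all add: add)
  then show ?thesis by (simp add: linear_form_def sc)
qed

context
  fixes \<A> :: "('n::{finite,linorder}) cvec set set" and \<alpha> :: "'n cvec set \<Rightarrow> 'n cvec"
    and l :: "'n cvec set \<Rightarrow> complex"
  assumes arr: "hyperplane_arrangement \<A> \<alpha>" and l: "(\<Sum>H\<in>\<A>. l H) = 0"
begin

abbreviation "\<omega>l \<equiv> one_form (weight_coeff \<A> \<alpha> l)"

lemma weight_wedge: "\<omega>l \<and>\<^sub>f \<eta> = (\<Sum>H\<in>\<A>. to_ratfun (Const (l H)) *s (one_form (dlog_coeff (\<alpha> H)) \<and>\<^sub>f \<eta>))"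
  by (simp add: vec_eq_iff wedge_one_form ext_mult_def weight_coeff_def sum_distrib_left sum_distrib_right
      sum.swap[of _ _ \<A>] ac_simps)

lemma weight_pairing:
  "(\<Sum>i\<in>UNIV. v $ i * weight_coeff \<A> \<alpha> l i) = (\<Sum>H\<in>\<A>. to_ratfun (Const (l H)) * (\<Sum>i\<in>UNIV. v $ i * dlog_coeff (\<alpha> H) i))"
  by (simp add: weight_coeff_def sum_distrib_left sum.swap[of _ _ \<A>] ac_simps)

text \<open>Each \<open>dlog H\<close> pairs to 1 with the Euler field, so the pairing is the sum of
  the weights. Its vanishing lets \<open>\<omega>l\<close> act on the relative forms.\<close>

lemma weight_pairing_euler: "(\<Sum>i\<in>UNIV. euler_field $ i * weight_coeff \<A> \<alpha> l i) = 0"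
proof -
  have "(\<Sum>i\<in>UNIV. euler_field $ i * weight_coeff \<A> \<alpha> l i) = (\<Sum>H\<in>\<A>. to_ratfun (Const (l H)))"
    unfolding weight_pairing using euler_field_dlog[OF arr] by (intro sum.cong) auto
  also have "\<dots> = to_ratfun (Const (\<Sum>H\<in>\<A>. l H))"
    by (induction \<A> rule: infinite_finite_induct) (simp_all add: Const_add to_ratfun_add)
  finally show ?thesis by (simp add: l)
qed

lemma weight_wedge_rel_log_forms:
  assumes "\<eta> \<in> rel_log_forms \<A> \<alpha> p"
  shows "\<omega>l \<and>\<^sub>f \<eta> \<in> rel_log_forms \<A> \<alpha> (Suc p)"
proof -
  have \<eta>: "\<eta> \<in> log_forms \<A> \<alpha> p" "contraction euler_field \<eta> = 0" using assms by (auto simp: rel_log_forms_def)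
  have "form.subspace (log_forms \<A> \<alpha> (Suc p))" by (rule subspace_log_forms[OF arr])
  then have "(\<Sum>H\<in>\<A>. form_scale (Const (l H)) (one_form (dlog_coeff (\<alpha> H)) \<and>\<^sub>f \<eta>)) \<in> log_forms \<A> \<alpha> (Suc p)"
    using dlog_wedge_log_forms[OF arr _ \<eta>(1)] by (intro form.subspace_sum form.subspace_scale)
  then have "\<omega>l \<and>\<^sub>f \<eta> \<in> log_forms \<A> \<alpha> (Suc p)" by (simp add: weight_wedge form_scale_def)
  moreover have "contraction euler_field (\<omega>l \<and>\<^sub>f \<eta>) = 0"
    using contraction_wedge[of euler_field "weight_coeff \<A> \<alpha> l" \<eta>] by (simp add: \<eta>(2) wedge_zero weight_pairing_euler)
  ultimately show ?thesis by (simp add: rel_log_forms_def)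
qed

lemma cocycles_eq: "cocycles \<A> \<alpha> l p = {\<eta> \<in> rel_log_forms \<A> \<alpha> p. \<omega>l \<and>\<^sub>f \<eta> = 0}"
  by (simp add: cocycles_def weight_form_eq)

lemma coboundaries_Suc: "coboundaries \<A> \<alpha> l (Suc p) = (\<lambda>\<eta>. \<omega>l \<and>\<^sub>f \<eta>) ` rel_log_forms \<A> \<alpha> p"
  by (simp add: weight_form_eq)

lemma weight_wedge_hom:
  "module_hom_between form_scale form_scale (rel_log_forms \<A> \<alpha> p) (coboundaries \<A> \<alpha> l (Suc p)) (\<lambda>\<eta>. \<omega>l \<and>\<^sub>f \<eta>)"
  by (auto simp: module_hom_between_def coboundaries_Suc wedge_add wedge_form_scale simp del: coboundaries.simps)

lemma subspace_coboundaries: "form.subspace (coboundaries \<A> \<alpha> l p)"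
proof (cases p)
  case 0
  then show ?thesis by (simp add: form.subspace_single_0)
next
  case (Suc q)
  have rel: "form.subspace (rel_log_forms \<A> \<alpha> q)" by (rule subspace_rel_log_forms[OF arr])
  show ?thesis unfolding Suc coboundaries_Suc form.subspace_def
  proof (intro conjI ballI allI)
    show "0 \<in> (\<lambda>\<eta>. \<omega>l \<and>\<^sub>f \<eta>) ` rel_log_forms \<A> \<alpha> q"
      using form.subspace_0[OF rel] by (intro image_eqI[of _ _ 0]) (simp_all add: wedge_zero)
    fix x assume "x \<in> (\<lambda>\<eta>. \<omega>l \<and>\<^sub>f \<eta>) ` rel_log_forms \<A> \<alpha> q"
    then obtain x' where x': "x' \<in> rel_log_forms \<A> \<alpha> q" "x = \<omega>l \<and>\<^sub>f x'" by blast
    show "form_scale c x \<in> (\<lambda>\<eta>. \<omega>l \<and>\<^sub>f \<eta>) ` rel_log_forms \<A> \<alpha> q" for c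
      using form.subspace_scale[OF rel x'(1)] by (auto simp: x'(2) wedge_form_scale[symmetric])
    fix y assume "y \<in> (\<lambda>\<eta>. \<omega>l \<and>\<^sub>f \<eta>) ` rel_log_forms \<A> \<alpha> q"
    then obtain y' where y': "y' \<in> rel_log_forms \<A> \<alpha> q" "y = \<omega>l \<and>\<^sub>f y'" by blast
    show "x + y \<in> (\<lambda>\<eta>. \<omega>l \<and>\<^sub>f \<eta>) ` rel_log_forms \<A> \<alpha> q"
      using form.subspace_add[OF rel x'(1) y'(1)] by (auto simp: x'(2) y'(2) wedge_add[symmetric])
  qed
qed

lemma coboundaries_subset: "coboundaries \<A> \<alpha> l p \<subseteq> cocycles \<A> \<alpha> l p"
proof (cases p)
  case 0
  then show ?thesis using form.subspace_0[OF subspace_rel_log_forms[OF arr]] by (simp add: cocycles_eq wedge_zero)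
next
  case (Suc q)
  show ?thesis unfolding Suc coboundaries_Suc cocycles_eq
    using weight_wedge_rel_log_forms by (auto simp: wedge_wedge_self)
qed

text \<open>On a cocycle one term of Cartan's formula drops out, and a generator \<open>g\<close>
  times \<open>z\<close> becomes \<open>\<omega>l\<close> wedged with the contraction of
  \<open>z\<close> by the coefficient vector \<open>v\<close> of the derivation. This contraction is
  again relative, because contractions with \<open>v\<close> and with the Euler field
  anticommute.\<close>

lemma critical_ideal_kills_cohomology:
  assumes g: "g \<in> critical_ideal \<A> \<alpha> l" and z: "z \<in> cocycles \<A> \<alpha> l p"
  shows "form_scale g z \<in> coboundaries \<A> \<alpha> l p"
  using g unfolding critical_ideal_def
proof (induction rule: module.span_induct_alt[OF module_times, consumes 1])
  case 1
  show ?case using form.subspace_0[OF subspace_coboundaries] by simp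
next
  case (2 c g y)
  have zr: "z \<in> rel_log_forms \<A> \<alpha> p" "\<omega>l \<and>\<^sub>f z = 0" using z by (auto simp: cocycles_eq)
  obtain \<delta> where \<delta>: "derivation \<delta>" "\<And>H. H \<in> \<A> \<Longrightarrow> linear_form (\<alpha> H) dvd \<delta> (linear_form (\<alpha> H))"
    and g: "to_ratfun g = (\<Sum>H\<in>\<A>. to_ratfun (Const (l H)) * (to_ratfun (\<delta> (linear_form (\<alpha> H))) / to_ratfun (linear_form (\<alpha> H))))"
    using 2(1) by (auto simp: log_derivations_def)
  define v where "v = (\<chi> i. to_ratfun (\<delta> (Var i)))"
  have v: "v $ i \<in> regular_functions" for i by (simp add: v_def)
  have pair: "(\<Sum>i\<in>UNIV. v $ i * dlog_coeff (\<alpha> H) i) = to_ratfun (\<delta> (linear_form (\<alpha> H))) / to_ratfun (linear_form (\<alpha> H))" for H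
    by (simp add: v_def dlog_coeff_def derivation_linear_form[OF \<delta>(1)] to_ratfun_sum to_ratfun_mult
        sum_distrib_left divide_inverse sum_distrib_right ac_simps)
  have reg: "(\<Sum>i\<in>UNIV. v $ i * dlog_coeff (\<alpha> H) i) \<in> regular_functions" if H: "H \<in> \<A>" for H
  proof -
    obtain q where "\<delta> (linear_form (\<alpha> H)) = linear_form (\<alpha> H) * q" using \<delta>(2)[OF H] by (rule dvdE)
    then show ?thesis unfolding pair using linear_form_nonzero[OF arr H] by (simp add: to_ratfun_mult)
  qed
  have "(\<Sum>i\<in>UNIV. v $ i * weight_coeff \<A> \<alpha> l i) = to_ratfun g"
    unfolding weight_pairing pair g ..
  then have gz: "form_scale g z = \<omega>l \<and>\<^sub>f contraction v z"
    using contraction_wedge[of v "weight_coeff \<A> \<alpha> l" z] by (simp add: zr(2) contraction_zero form_scale_def)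
  have "form_scale g z \<in> coboundaries \<A> \<alpha> l p"
  proof (cases p)
    case 0
    then have "contraction v z = 0"
      using zr(1) by (auto simp: rel_log_forms_def log_forms_iff[OF arr] intro: contraction_degree_0[OF arr])
    then show ?thesis using 0 by (simp add: gz wedge_zero)
  next
    case (Suc q)
    have "contraction v z \<in> log_forms \<A> \<alpha> q"
      using zr(1) Suc by (intro log_forms_contraction[OF arr v reg]) (auto simp: rel_log_forms_def)
    moreover have "contraction euler_field (contraction v z) = 0"
      using contraction_anticommute[of euler_field v z] zr(1) by (simp add: rel_log_forms_def contraction_zero)
    ultimately have "contraction v z \<in> rel_log_forms \<A> \<alpha> q" by (simp add: rel_log_forms_def)
    then show ?thesis unfolding Suc coboundaries_Suc gz by blast
  qed
  then have "form_scale c (form_scale g z) + form_scale y z \<in> coboundaries \<A> \<alpha> l p"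
    by (rule form.subspace_add[OF subspace_coboundaries form.subspace_scale[OF subspace_coboundaries] 2(2)])
  then show ?case by (simp add: form.scale_left_distrib)
qed

text \<open>Two bounds run in parallel: in degree \<open>q\<close> the relative forms have vanishing
  Koszul cohomology below \<open>p + 1 - q\<close>, the coboundaries below \<open>p + 2 - q\<close>,
  beginning with zero coboundaries for \<open>q = 0\<close>. For \<open>q \<le> p\<close> this
  includes the degrees 0 and 1 that \<open>koszul_exact_cancel\<close> asks for, so cocycles in
  degree \<open>q\<close> are coboundaries. The coboundaries in degree \<open>q + 1\<close> are then
  the forms modulo the coboundaries in degree \<open>q\<close> and obtain the next bound.\<close>

lemma cocycles_subset_coboundaries:
  assumes tame: "tame \<A> \<alpha>" and ne: "\<A> \<noteq> {}" and p: "p \<le> CARD('n)"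
    and a: "\<And>i. i < Suc p \<Longrightarrow> a i \<in> critical_ideal \<A> \<alpha> l" and reg: "regular_seq (*) a (Suc p) UNIV"
  shows "cocycles \<A> \<alpha> l p \<subseteq> coboundaries \<A> \<alpha> l p"
proof -
  let ?k = "Suc p"
  obtain H where H: "H \<in> \<A>" using ne by blast
  have rel: "koszul_grade form_scale a ?k (rel_log_forms \<A> \<alpha> q) (?k - q)" if "q \<le> p" for q
  proof -
    have "projective_dimension form_scale (log_forms \<A> \<alpha> q) \<le> enat q" using tame that p by (simp add: tame_def)
    then obtain n where n: "n \<le> q" "has_projective_resolution form_scale (log_forms \<A> \<alpha> q) n"
      by (rule projective_dimension_le)
    have "koszul_grade form_scale a ?k (log_forms \<A> \<alpha> q) (?k - n)"
      by (rule koszul_grade_projective_resolution[OF form.module_axioms reg n(2)])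
    then have grade: "koszul_grade form_scale a ?k (log_forms \<A> \<alpha> q) (?k - q)"
      by (rule koszul_grade_mono) (use n(1) in simp)
    have sub: "rel_log_forms \<A> \<alpha> q \<subseteq> log_forms \<A> \<alpha> q" by (auto simp: rel_log_forms_def)
    show ?thesis
      by (rule koszul_grade_retract[OF form.module_axioms subspace_log_forms[OF arr] sub
            rel_log_forms_retract(1)[OF arr H] _ grade])
        (rule rel_log_forms_retract(2)[OF arr H])
  qed
  have sub: "cocycles \<A> \<alpha> l q \<subseteq> coboundaries \<A> \<alpha> l q"
    if q: "q \<le> p" and B: "koszul_grade form_scale a ?k (coboundaries \<A> \<alpha> l q) (Suc ?k - q)" for q
  proof
    fix z assume z: "z \<in> cocycles \<A> \<alpha> l q"
    show "z \<in> coboundaries \<A> \<alpha> l q"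
    proof (rule form.koszul_exact_cancel[OF subspace_rel_log_forms[OF arr, of q]])
      show "coboundaries \<A> \<alpha> l q \<subseteq> rel_log_forms \<A> \<alpha> q" using coboundaries_subset by (auto simp: cocycles_eq)
      show "koszul_exact form_scale a ?k (coboundaries \<A> \<alpha> l q) 1" using B q by (simp add: koszul_grade_def)
      show "koszul_exact form_scale a ?k (rel_log_forms \<A> \<alpha> q) 0" using rel[OF q] q by (simp add: koszul_grade_def)
      show "z \<in> rel_log_forms \<A> \<alpha> q" using z by (simp add: cocycles_eq)
      show "form_scale (a i) z \<in> coboundaries \<A> \<alpha> l q" if "i < ?k" for i
        by (rule critical_ideal_kills_cohomology[OF a[OF that] z])
    qed
  qed
  have B: "koszul_grade form_scale a ?k (coboundaries \<A> \<alpha> l q) (Suc ?k - q)" if "q \<le> p" for q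
    using that
  proof (induction q)
    case 0
    show ?case by (simp add: koszul_grade_def koszul_exact_zero[OF form.module_axioms])
  next
    case (Suc q)
    then have q: "q \<le> p" and IH: "koszul_grade form_scale a ?k (coboundaries \<A> \<alpha> l q) (Suc ?k - q)" by auto
    \<comment> \<open>Exactness in degree \<open>q\<close>, available from the bound for this
      degree, replaces the kernel by coboundaries, to which the induction hypothesis
      applies.\<close>
    have ker: "{\<eta> \<in> rel_log_forms \<A> \<alpha> q. \<omega>l \<and>\<^sub>f \<eta> = 0} = coboundaries \<A> \<alpha> l q"
      using sub[OF q IH] coboundaries_subset by (auto simp: cocycles_eq)
    have "koszul_grade form_scale a ?k (coboundaries \<A> \<alpha> l (Suc q)) (?k - q)"
    proof (rule koszul_grade_image[OF form.module_axioms form.module_axioms subspace_rel_log_forms[OF arr] weight_wedge_hom])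
      show "(\<lambda>\<eta>. \<omega>l \<and>\<^sub>f \<eta>) ` rel_log_forms \<A> \<alpha> q = coboundaries \<A> \<alpha> l (Suc q)" by (rule coboundaries_Suc[symmetric])
      show "koszul_grade form_scale a ?k {\<eta> \<in> rel_log_forms \<A> \<alpha> q. \<omega>l \<and>\<^sub>f \<eta> = 0} (Suc (?k - q))"
        unfolding ker using IH q by (simp add: Suc_diff_le)
      show "koszul_grade form_scale a ?k (rel_log_forms \<A> \<alpha> q) (?k - q)" by (rule rel[OF q])
    qed
    then show ?case by simp
  qed
  show ?thesis by (rule sub[OF order_refl B[OF order_refl]])
qed

text \<open>Tameness speaks of degrees up to \<open>CARD('n)\<close>. Beyond that no index set is
  large enough, and the only form is zero.\<close>

lemma cocycles_above_rank:
  assumes "CARD('n) < p" shows "cocycles \<A> \<alpha> l p \<subseteq> coboundaries \<A> \<alpha> l p"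
proof
  fix z assume "z \<in> cocycles \<A> \<alpha> l p"
  then have "z \<in> polar_forms \<A> \<alpha> p" by (simp add: cocycles_eq rel_log_forms_def log_forms_iff[OF arr])
  moreover have "card I \<noteq> p" for I :: "'n set" using assms card_mono[of UNIV I] by auto
  ultimately have "z = 0" by (simp add: polar_forms_iff[OF arr] vec_eq_iff)
  then show "z \<in> coboundaries \<A> \<alpha> l p" using form.subspace_0[OF subspace_coboundaries] by simp
qed

lemma cohomology_trivial:
  assumes "cocycles \<A> \<alpha> l p \<subseteq> coboundaries \<A> \<alpha> l p"
  shows "cohomology \<A> \<alpha> l p = {coboundaries \<A> \<alpha> l p}"
proof -
  note B = subspace_coboundaries[of p]
  have "(+) z ` coboundaries \<A> \<alpha> l p = coboundaries \<A> \<alpha> l p" if z: "z \<in> coboundaries \<A> \<alpha> l p" for z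
  proof (intro equalityI subsetI)
    show "x \<in> coboundaries \<A> \<alpha> l p" if "x \<in> (+) z ` coboundaries \<A> \<alpha> l p" for x
      using that z form.subspace_add[OF B] by auto
    show "x \<in> (+) z ` coboundaries \<A> \<alpha> l p" if "x \<in> coboundaries \<A> \<alpha> l p" for x
      using form.subspace_diff[OF B that z] by (intro image_eqI[of _ _ "x - z"]) auto
  qed
  moreover have "0 \<in> cocycles \<A> \<alpha> l p"
    using form.subspace_0[OF B] coboundaries_subset by blast
  ultimately show ?thesis using assms unfolding cohomology_def by blast
qed

end

theorem proposition4p3:
  fixes \<A> :: "(complex ^ 'n::{finite,linorder}) set set"
    and \<alpha> :: "(complex ^ 'n::{finite,linorder}) set \<Rightarrow> complex ^ 'n::{finite,linorder}"
    and l :: "(complex ^ 'n::{finite,linorder}) set \<Rightarrow> complex"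
    and p :: nat
  assumes "hyperplane_arrangement \<A> \<alpha>" and "essential \<A>" and "tame \<A> \<alpha>"
    and "\<exists>H\<in>\<A>. l H \<noteq> 0" and "(\<Sum>H\<in>\<A>. l H) = 0"
    and "arrangement_rank \<A> \<le> 4 \<or> free_arrangement \<A> \<alpha> \<or> p \<le> 2"
    and "cohomology \<A> \<alpha> l p \<noteq> {coboundaries \<A> \<alpha> l p}"
  shows "codimension (critical_set \<A> \<alpha> l) \<le> enat p"
proof (rule ccontr)
  assume codim: "\<not> ?thesis"
  have "ideal (critical_ideal \<A> \<alpha> l)"
    unfolding critical_ideal_def by (rule module.subspace_span[OF module_times])
  then obtain a where a: "\<And>i. i < Suc p \<Longrightarrow> a i \<in> critical_ideal \<A> \<alpha> l" "regular_seq (*) a (Suc p) UNIV"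
    using codim unfolding critical_set_def by (rule regular_seq_of_codimension) blast
  have "cocycles \<A> \<alpha> l p \<subseteq> coboundaries \<A> \<alpha> l p"
  proof (cases "p \<le> CARD('n)")
    case True
    then show ?thesis
      using assms(4) by (intro cocycles_subset_coboundaries[OF assms(1,5,3) _ _ a]) auto
  next
    case False
    then show ?thesis by (intro cocycles_above_rank[OF assms(1,5)]) simp
  qed
  then show False using cohomology_trivial[OF assms(1,5)] assms(7) by blast
qed

end
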